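(* Assume $a_1=a_2=\tfrac12$. Then collaborating optimally is strictly better than merging optimally: for all initial surplus levels $(x,y)\in\mathbf{R}_+^2$, $$V(x,y)>\frac{V_M(x+y)}{2}.$$
   Context: Model. $\mathbf{R}_+^2=[0,\infty)^2$. The free surpluses of Company One and Company Two are $X_t=x+p_1t-\sum_{i=1}^{N_t^1}U_i^{(1)}$ and $Y_t=y+p_2t-\sum_{i=1}^{N_t^2}U_i^{(2)}$, with $(x,y)\in\mathbf{R}_+^2$, premium rates $p_1,p_2>0$, Poisson processes $N^k$ with intensities $\lambda_k>0$, and, for each $k=1,2$, i.i.d. positive claim sizes $U_i^{(k)}$ with continuous distribution function $F^k$. The processes $N^1,N^2$ and all claim sizes are independent, and $p_k>\lambda_kE(U_i^{(k)})$. $\delta>0$ is a discount factor, $a_1\in[0,1]$ and $a_2=1-a_1$ are weights. Collaboration and dividends. A dividend strategy is $\overline L=(L_t^1,L_t^2)$, the cumulative dividends of the two companies. The controlled surpluses are $X_t^{\overline L}=X_t-L_t^1+C_t^{2,1}-C_t^{1,2}$, $Y_t^{\overline L}=Y_t-L_t^2+C_t^{1,2}-C_t^{2,1}$, where $C^{2,1}$ (resp. $C^{1,2}$) is the cumulative amount transferred from Two to One (resp. One to Two): whenever a claim of one company makes its surplus negative and the sum of the two surpluses is still $\ge0$, the other company transfers exactly the deficit. Let $\overline\tau=\inf\{t\ge0: X_t^{\overline L}+Y_t^{\overline L}<0\}$, the time at which a company with a deficit cannot be rescued; at $\overline\tau$ no transfer occurs, so one surplus is negative (that company is ruined) and the other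 survives. $\overline L$ is admissible if each $L^k$ is non-decreasing, left continuous with right limits, starting at $0$, predictable with respect to the filtration generated by $(X_t,Y_t)$, and before $\overline\tau$ satisfies $L_t^1\le X_t+C_t^{2,1}-C_t^{1,2}$ and $L_t^2\le Y_t+C_t^{1,2}-C_t^{2,1}$. $\Pi_{x,y}$ is the set of admissible strategies with initial surplus $(x,y)$. $V_k^0$ ($k=1,2$) is the optimal value function of the one-dimensional problem of maximizing the expected $\delta$-discounted dividends of Company $k$ alone until its ruin, extended by $0$ to $(-\infty,0)$. Put $$V_{\overline L}(x,y)=E_{x,y}\Big(a_1\Big(\int_0^{\overline\tau}e^{-\delta s}dL_s^1+e^{-\delta\overline\tau}V_1^0(X_{\overline\tau}^{\overline L})\Big)+a_2\Big(\int_0^{\overline\tau}e^{-\delta s}dL_s^2+e^{-\delta\overline\tau}V_2^0(Y_{\overline\tau}^{\overline L})\Big)\Big)$$ (integrals include a lump sum paid at time $0$), and $V(x,y)=\sup_{\overline L\in\Pi_{x,y}}V_{\overline L}(x,y)$. Merger. In the merger the companies put together their surpluses, $Z_t=X_t+Y_t$ with $Z_0=x+y$. A merger dividend strategy $L=(L_t)$ is non-decreasing, left continuous with right limits, starting at $0$, predictable with respect to the filtration generated by $(X_t,Y_t)$, with $L_t\le Z_t$ before the ruin time $\tau=\inf\{t\ge 0:Z_t-L_t<0\}$. $V_M(z)$, $z=x+y$, is the supremum over such $L$ of $E(\int_0^{\tau}e^{-\delta s}dL_s)$. *)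

theory Defs
  imports "HOL-Probability.Probability"
begin

section \<open>Filtrations, predictability, dividend processes\<close>

text \<open>Stochastic processes are functions \<open>real \<Rightarrow> 'a \<Rightarrow> _\<close>; only their values at times \<open>t \<ge> 0\<close>
  are ever used.\<close>

definition natural_filtration ::
    "'a measure \<Rightarrow> 'i set \<Rightarrow> ('i \<Rightarrow> real \<Rightarrow> 'a \<Rightarrow> real) \<Rightarrow> real \<Rightarrow> 'a measure" where
  "natural_filtration M I S t =
     sigma (space M) {S i s -` B \<inter> space M | i s B. i \<in> I \<and> 0 \<le> s \<and> s \<le> t \<and> B \<in> sets borel}"

definition predictable_algebra :: "'a measure \<Rightarrow> (real \<Rightarrow> 'a measure) \<Rightarrow> (real \<times> 'a) measure" where
  "predictable_algebra M G =
     sigma ({0..} \<times> space M)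
       ({{0} \<times> A | A. A \<in> sets (G 0)} \<union>
        {{s<..t} \<times> A | s t A. 0 \<le> s \<and> s \<le> t \<and> A \<in> sets (G s)})"

definition predictable :: "'a measure \<Rightarrow> (real \<Rightarrow> 'a measure) \<Rightarrow> (real \<Rightarrow> 'a \<Rightarrow> real) \<Rightarrow> bool" where
  "predictable M G L \<longleftrightarrow> (\<lambda>(t, \<omega>). L t \<omega>) \<in> borel_measurable (predictable_algebra M G)"

definition dividend_process ::
    "'a measure \<Rightarrow> (real \<Rightarrow> 'a measure) \<Rightarrow> (real \<Rightarrow> 'a \<Rightarrow> real) \<Rightarrow> bool" where
  "dividend_process M G L \<longleftrightarrow>
     predictable M G L \<and>
     (\<forall>\<omega>\<in>space M.
        L 0 \<omega> = 0 \<and>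
        mono_on {0..} (\<lambda>t. L t \<omega>) \<and>
        (\<forall>t>0. continuous (at_left t) (\<lambda>s. L s \<omega>)) \<and>
        (\<forall>t\<ge>0. \<exists>l. ((\<lambda>s. L s \<omega>) \<longlongrightarrow> l) (at_right t)))"

text \<open>First time a path is negative; \<open>\<infinity>\<close> if there is none.\<close>

definition ruin_time :: "(real \<Rightarrow> real) \<Rightarrow> ereal" where
  "ruin_time f = Inf (ereal ` {t. 0 \<le> t \<and> f t < 0})"

text \<open>The measure \<open>dL\<close> of a left continuous path \<open>L\<close> on \<open>[0,\<infinity>)\<close>: its distribution function is the
  right continuous version \<open>L\<^sub>s\<^sub>+\<close>, extended by 0 to negative times, so that a lump sum \<open>L\<^sub>0\<^sub>+\<close> paid at
  time 0 is an atom at 0.\<close>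

definition dividend_measure :: "(real \<Rightarrow> real) \<Rightarrow> real measure" where
  "dividend_measure L = interval_measure (\<lambda>s. if s < 0 then 0 else Lim (at_right s) L)"

text \<open>The integral up to ruin is over \<open>[0,\<tau>)\<close>: for left continuous \<open>L\<close> a jump \<open>L\<^sub>\<tau>\<^sub>+ - L\<^sub>\<tau>\<close> would be
  paid after the claim that causes ruin.\<close>

definition discounted_dividends :: "real \<Rightarrow> (real \<Rightarrow> real) \<Rightarrow> ereal \<Rightarrow> ennreal" where
  "discounted_dividends \<delta> L \<tau> =
     (\<integral>\<^sup>+s\<in>{s. 0 \<le> s \<and> ereal s < \<tau>}. ennreal (exp (- \<delta> * s)) \<partial>dividend_measure L)"

section \<open>Optimal dividends for a single surplus process\<close>

text \<open>A single surplus process \<open>S\<close> with information \<open>G\<close>.  As all payoffs are non-negative, values are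
  taken in \<open>ennreal\<close>.\<close>

definition single_admissible ::
    "'a measure \<Rightarrow> (real \<Rightarrow> 'a measure) \<Rightarrow> (real \<Rightarrow> 'a \<Rightarrow> real) \<Rightarrow> (real \<Rightarrow> 'a \<Rightarrow> real) set" where
  "single_admissible M G S =
     {L. dividend_process M G L \<and>
         (\<forall>\<omega>\<in>space M. \<forall>t\<ge>0.
            ereal t < ruin_time (\<lambda>s. S s \<omega> - L s \<omega>) \<longrightarrow> L t \<omega> \<le> S t \<omega>)}"

definition single_value ::
    "'a measure \<Rightarrow> real \<Rightarrow> (real \<Rightarrow> 'a measure) \<Rightarrow> (real \<Rightarrow> 'a \<Rightarrow> real) \<Rightarrow> ennreal" where
  "single_value M \<delta> G S =
     (SUP L\<in>single_admissible M G S.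
        \<integral>\<^sup>+\<omega>. discounted_dividends \<delta> (\<lambda>s. L s \<omega>) (ruin_time (\<lambda>s. S s \<omega> - L s \<omega>)) \<partial>M)"

section \<open>The two companies\<close>

datatype company = One | Two

fun other :: "company \<Rightarrow> company" where
  "other One = Two"
| "other Two = One"

text \<open>Claims are numbered from 0: \<open>U k i\<close> is the \<open>(i+1)\<close>-st claim of company \<open>k\<close>.\<close>

definition surplus ::
    "(company \<Rightarrow> real) \<Rightarrow> (company \<Rightarrow> real \<Rightarrow> 'a \<Rightarrow> nat) \<Rightarrow> (company \<Rightarrow> nat \<Rightarrow> 'a \<Rightarrow> real) \<Rightarrow>
     (company \<Rightarrow> real) \<Rightarrow> company \<Rightarrow> real \<Rightarrow> 'a \<Rightarrow> real" where
  "surplus p N U x k t \<omega> = x k + p k * t - (\<Sum>i<N k t \<omega>. U k i \<omega>)"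

definition (in prob_space) poisson_process :: "real \<Rightarrow> (real \<Rightarrow> 'a \<Rightarrow> nat) \<Rightarrow> bool" where
  "poisson_process r N \<longleftrightarrow>
     (\<forall>t\<ge>0. N t \<in> measurable M (count_space UNIV)) \<and>
     (\<forall>\<omega>\<in>space M. N 0 \<omega> = 0 \<and> mono_on {0..} (\<lambda>t. N t \<omega>) \<and>
        (\<forall>t\<ge>0. continuous (at_right t) (\<lambda>s. N s \<omega>))) \<and>
     (\<forall>(n::nat) t. 0 \<le> t 0 \<and> mono t \<longrightarrow>
        indep_vars (\<lambda>_. count_space UNIV) (\<lambda>i \<omega>. N (t (Suc i)) \<omega> - N (t i) \<omega>) {..<n}) \<and>
     (\<forall>s t. 0 \<le> s \<and> s < t \<longrightarrow>
        distr M (count_space UNIV) (\<lambda>\<omega>. N t \<omega> - N s \<omega>) = measure_pmf (poisson_pmf (r * (t - s))))"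

datatype random_source = Arrivals company | Claim company nat

locale two_company_model = prob_space M for M :: "'a measure" +
  fixes lam :: "company \<Rightarrow> real"
    and p :: "company \<Rightarrow> real"
    and N :: "company \<Rightarrow> real \<Rightarrow> 'a \<Rightarrow> nat"
    and U :: "company \<Rightarrow> nat \<Rightarrow> 'a \<Rightarrow> real"
    and F :: "company \<Rightarrow> real \<Rightarrow> real"
  assumes intensity_pos: "lam k > 0"
    and premium_pos: "p k > 0"
    and poisson: "poisson_process (lam k) (N k)"
    and claim_measurable: "U k i \<in> borel_measurable M"
    and claim_pos: "\<omega> \<in> space M \<Longrightarrow> U k i \<omega> > 0"
    and claim_cdf: "cdf (distr M borel (U k i)) = F k"
    and cdf_continuous: "continuous_on UNIV (F k)"
    and independent:
      "indep_sets
         (\<lambda>j. case j of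
            Arrivals k \<Rightarrow> sigma_sets (space M) {N k t -` A \<inter> space M | t A. 0 \<le> t}
          | Claim k i \<Rightarrow> {U k i -` B \<inter> space M | B. B \<in> sets borel}) UNIV"
    and claim_integrable: "integrable M (U k i)"
    and net_profit: "p k > lam k * expectation (U k i)"

text \<open>\<open>V\<^sup>0\<^sub>k\<close>: only the history of company \<open>k\<close> is used.\<close>

definition standalone_value ::
    "'a measure \<Rightarrow> (company \<Rightarrow> real) \<Rightarrow> (company \<Rightarrow> real \<Rightarrow> 'a \<Rightarrow> nat) \<Rightarrow>
     (company \<Rightarrow> nat \<Rightarrow> 'a \<Rightarrow> real) \<Rightarrow> real \<Rightarrow> company \<Rightarrow> real \<Rightarrow> ennreal" where
  "standalone_value M p N U \<delta> k x =
     (if x < 0 then 0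
      else let S = surplus p N U (\<lambda>_. x)
           in single_value M \<delta> (natural_filtration M {k} S) (S k))"

text \<open>\<open>V\<^sub>M\<close>: the initial surplus \<open>z\<close> is booked entirely on company One; neither \<open>Z\<close> nor the
  filtration generated by \<open>(X, Y)\<close> depends on how \<open>z\<close> is split.\<close>

definition merger_value ::
    "'a measure \<Rightarrow> (company \<Rightarrow> real) \<Rightarrow> (company \<Rightarrow> real \<Rightarrow> 'a \<Rightarrow> nat) \<Rightarrow>
     (company \<Rightarrow> nat \<Rightarrow> 'a \<Rightarrow> real) \<Rightarrow> real \<Rightarrow> real \<Rightarrow> ennreal" where
  "merger_value M p N U \<delta> z =
     (let S = surplus p N U (case_company z 0)
      in single_value M \<delta> (natural_filtration M UNIV S) (\<lambda>t \<omega>. S One t \<omega> + S Two t \<omega>))"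

section \<open>Collaboration\<close>

text \<open>Time of the \<open>n\<close>-th claim, counting the claims of both companies together.\<close>

definition claim_time :: "(company \<Rightarrow> real \<Rightarrow> 'a \<Rightarrow> nat) \<Rightarrow> 'a \<Rightarrow> nat \<Rightarrow> real" where
  "claim_time N \<omega> n = Inf {t. 0 \<le> t \<and> n \<le> N One t \<omega> + N Two t \<omega>}"

text \<open>\<open>received_after R T n k\<close> is the cumulative amount transferred to company \<open>k\<close> by the other one
  in the course of the first \<open>n\<close> claims, where \<open>T\<close> gives the claim times and \<open>R k\<close> is the surplus
  of company \<open>k\<close> after dividends but without any transfer.  At a claim, \<open>u\<close> is the pair of surpluses
  just before the transfer.\<close>

primrec received_after ::
    "(company \<Rightarrow> real \<Rightarrow> real) \<Rightarrow> (nat \<Rightarrow> real) \<Rightarrow> nat \<Rightarrow> company \<Rightarrow> real" where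
  "received_after R T 0 = (\<lambda>_. 0)"
| "received_after R T (Suc n) =
     (let C = received_after R T n;
          u = (\<lambda>k. R k (T (Suc n)) + C k - C (other k))
      in if u One + u Two \<ge> 0 then (\<lambda>k. C k + max 0 (- u k)) else C)"

text \<open>\<open>received S N L One\<close> is \<open>C\<^sup>2\<^sup>,\<^sup>1\<close> and \<open>received S N L Two\<close> is \<open>C\<^sup>1\<^sup>,\<^sup>2\<close>.\<close>

definition received ::
    "(company \<Rightarrow> real \<Rightarrow> 'a \<Rightarrow> real) \<Rightarrow> (company \<Rightarrow> real \<Rightarrow> 'a \<Rightarrow> nat) \<Rightarrow>
     (company \<Rightarrow> real \<Rightarrow> 'a \<Rightarrow> real) \<Rightarrow> company \<Rightarrow> real \<Rightarrow> 'a \<Rightarrow> real" where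
  "received S N L k t \<omega> =
     received_after (\<lambda>k s. S k s \<omega> - L k s \<omega>) (claim_time N \<omega>) (N One t \<omega> + N Two t \<omega>) k"

definition controlled ::
    "(company \<Rightarrow> real \<Rightarrow> 'a \<Rightarrow> real) \<Rightarrow> (company \<Rightarrow> real \<Rightarrow> 'a \<Rightarrow> nat) \<Rightarrow>
     (company \<Rightarrow> real \<Rightarrow> 'a \<Rightarrow> real) \<Rightarrow> company \<Rightarrow> real \<Rightarrow> 'a \<Rightarrow> real" where
  "controlled S N L k t \<omega> =
     S k t \<omega> - L k t \<omega> + received S N L k t \<omega> - received S N L (other k) t \<omega>"

definition collab_ruin ::
    "(company \<Rightarrow> real \<Rightarrow> 'a \<Rightarrow> real) \<Rightarrow> (company \<Rightarrow> real \<Rightarrow> 'a \<Rightarrow> nat) \<Rightarrow>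
     (company \<Rightarrow> real \<Rightarrow> 'a \<Rightarrow> real) \<Rightarrow> 'a \<Rightarrow> ereal" where
  "collab_ruin S N L \<omega> = ruin_time (\<lambda>t. controlled S N L One t \<omega> + controlled S N L Two t \<omega>)"

text \<open>The last clause makes explicit that the collaboration ends only by an uncovered deficit caused
  by a claim.  Without it, paying out more than the joint surplus at a time \<open>t\<close> would give
  \<open>collab_ruin = t\<close> with both surpluses still non-negative at \<open>t\<close>, i.e. the companies could
  separate at will.\<close>

definition collab_admissible ::
    "'a measure \<Rightarrow> (company \<Rightarrow> real \<Rightarrow> 'a \<Rightarrow> real) \<Rightarrow> (company \<Rightarrow> real \<Rightarrow> 'a \<Rightarrow> nat) \<Rightarrow>
     (company \<Rightarrow> real \<Rightarrow> 'a \<Rightarrow> real) set" where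
  "collab_admissible M S N =
     {L. (\<forall>k. dividend_process M (natural_filtration M UNIV S) (L k)) \<and>
         (\<forall>\<omega>\<in>space M. \<forall>t\<ge>0. ereal t < collab_ruin S N L \<omega> \<longrightarrow>
            (\<forall>k. L k t \<omega> \<le> S k t \<omega> + received S N L k t \<omega> - received S N L (other k) t \<omega>)) \<and>
         (\<forall>\<omega>\<in>space M. \<forall>t. collab_ruin S N L \<omega> = ereal t \<longrightarrow>
            controlled S N L One t \<omega> + controlled S N L Two t \<omega> < 0)}"

text \<open>\<open>e\<^sup>-\<^sup>\<delta>\<^sup>\<tau> w(\<tau>)\<close>, read as 0 for \<open>\<tau> = \<infinity>\<close>.\<close>

definition discounted_terminal :: "real \<Rightarrow> ereal \<Rightarrow> (real \<Rightarrow> ennreal) \<Rightarrow> ennreal" where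
  "discounted_terminal \<delta> \<tau> w =
     (if \<tau> = \<infinity> then 0
      else ennreal (exp (- \<delta> * real_of_ereal \<tau>)) * w (real_of_ereal \<tau>))"

definition collab_payoff ::
    "'a measure \<Rightarrow> (company \<Rightarrow> real) \<Rightarrow> (company \<Rightarrow> real \<Rightarrow> 'a \<Rightarrow> nat) \<Rightarrow>
     (company \<Rightarrow> nat \<Rightarrow> 'a \<Rightarrow> real) \<Rightarrow> real \<Rightarrow> (company \<Rightarrow> real) \<Rightarrow>
     (company \<Rightarrow> real \<Rightarrow> 'a \<Rightarrow> real) \<Rightarrow> (company \<Rightarrow> real \<Rightarrow> 'a \<Rightarrow> real) \<Rightarrow> ennreal" where
  "collab_payoff M p N U \<delta> a S L =
     (\<integral>\<^sup>+\<omega>. (\<Sum>k\<in>{One, Two}. ennreal (a k) *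
         (discounted_dividends \<delta> (\<lambda>s. L k s \<omega>) (collab_ruin S N L \<omega>) +
          discounted_terminal \<delta> (collab_ruin S N L \<omega>)
            (\<lambda>t. standalone_value M p N U \<delta> k (controlled S N L k t \<omega>)))) \<partial>M)"

definition collab_value ::
    "'a measure \<Rightarrow> (company \<Rightarrow> real) \<Rightarrow> (company \<Rightarrow> real \<Rightarrow> 'a \<Rightarrow> nat) \<Rightarrow>
     (company \<Rightarrow> nat \<Rightarrow> 'a \<Rightarrow> real) \<Rightarrow> real \<Rightarrow> (company \<Rightarrow> real) \<Rightarrow> real \<Rightarrow> real \<Rightarrow> ennreal" where
  "collab_value M p N U \<delta> a x y =
     (let S = surplus p N U (case_company x y)
      in SUP L\<in>collab_admissible M S N. collab_payoff M p N U \<delta> a S L)"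

end

theory Submission
  imports Defs
begin

text \<open>
  Collaboration can imitate a merger and still owns something when the merger is ruined.  Every
  merger strategy \<open>L\<close> is turned into a collaboration strategy \<open>(L\<^sub>1, L\<^sub>2)\<close> with \<open>L\<^sub>1 + L\<^sub>2 = L\<close> up to the
  ruin time of the merger.  The transfers cancel in the joint surplus, so it is the surplus of the
  merger, and with weights \<open>1/2\<close> the dividends before ruin are worth at least half of those of the merger
  (\<open>collaboration_from_merger\<close>).  At ruin the company that was not hit by the fatal claim still has a non-negative
  surplus, and this is worth at least a constant \<open>c > 0\<close> whatever that surplus is, because the
  company may just pay out its premiums until its next claim (\<open>standalone_value_bounded_below\<close>).  A lower bound on
  the probability of such a ruin before time 1 has to be independent of \<open>L\<close>.  It is: paying dividends
  only accelerates ruin, so the event that One suffers by time 1 claims exceeding the initial joint surplus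
  plus all premiums while Two has none serves for all \<open>L\<close> (\<open>ruin_by_One_event\<close>).  Thus
  \<open>V \<ge> V\<^sub>M / 2 + g\<close> with \<open>g > 0\<close> (\<open>collab_value_gap\<close>), and since dividends before ruin are
  bounded by initial surplus plus premiums, \<open>V\<^sub>M\<close> is finite (\<open>merger_value_finite\<close>), which makes the
  inequality strict.

  The work lies in the split of \<open>L\<close>, in which no company may ever pay more than it owns, although
  the transfers prescribed at claims depend on how the dividends were split before.  One pays what it
  can and Two pays the rest.  If \<open>D\<close> is the net amount transferred to One, this means that \<open>L\<^sub>2\<close> is
  the running supremum of the amounts \<open>(L - X - D)\<^sup>+\<close> by which One would be overdrawn if it paid
  everything.  Conversely \<open>D\<close> is piecewise constant, and its jump at a claim is determined by \<open>L\<^sub>2\<close>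
  at that time, which only involves earlier values of \<open>D\<close>; hence \<open>D\<close> is constructed by recursion over
  the claims.  That \<open>L\<^sub>1 = L - L\<^sub>2\<close> is non-decreasing is the usual property of a Skorokhod reflection
  (\<open>paid_by_Two_increment\<close>); that Two can afford \<open>L\<^sub>2\<close> as long as the merger is alive
  (\<open>paid_by_Two_upper\<close>) follows from \<open>L \<le> X + Y\<close>.  A supremum over rational times strictly before
  \<open>t\<close> is left continuous in \<open>t\<close> and measurable with respect to the information at \<open>t\<close>, so that
  \<open>L\<^sub>2\<close> is predictable.

  One more point needs care.  A merger strategy may end its life by paying more than it owns, without
  a claim, whereas collaboration may not.  Therefore \<open>L\<close> is first stopped at its ruin time; this
  loses no dividends counted before ruin, and postpones ruin to a later claim (\<open>ruin_time_stopped\<close>).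
\<close>

section \<open>Discounted dividends as an integral over the dividend measure\<close>

text \<open>Only monotonicity is available for most paths below, so right limits are infima.\<close>

lemma mono_right_limit:
  fixes f :: "real \<Rightarrow> real"
  assumes m: "mono_on {0..} f" and s: "0 \<le> s"
  shows "(f \<longlongrightarrow> Inf (f ` {s<..})) (at_right s)"
proof (rule order_tendstoI)
  have bdd: "bdd_below (f ` {s<..})"
    by (rule bdd_belowI[of _ "f s"]) (use m s in \<open>auto simp: mono_on_def\<close>)
  fix a
  { assume a: "a < Inf (f ` {s<..})"
    have "a < f t" if "s < t" for t
      using cInf_lower[OF _ bdd, of "f t"] that a by auto
    then show "eventually (\<lambda>t. a < f t) (at_right s)"
      by (auto simp: eventually_at_filter)
  next
    assume "Inf (f ` {s<..}) < a"
    then obtain t where t: "s < t" "f t < a"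
      using cInf_less_iff[of "f ` {s<..}" a] bdd by auto
    have "f r < a" if "s < r" "r < t" for r
    proof -
      have "f r \<le> f t" using m s that by (auto simp: mono_on_def)
      with t show ?thesis by simp
    qed
    then show "eventually (\<lambda>t. f t < a) (at_right s)"
      unfolding eventually_at_right_field using t(1) by blast }
qed

lemma Lim_right_mono:
  fixes f :: "real \<Rightarrow> real"
  assumes m: "mono_on {0..} f" and s: "0 \<le> s"
  shows "Lim (at_right s) f = Inf (f ` {s<..})"
  by (rule tendsto_Lim[OF _ mono_right_limit[OF assms]]) simp

lemma Lim_right_bounds:
  fixes f :: "real \<Rightarrow> real"
  assumes m: "mono_on {0..} f" and s: "0 \<le> s"
  shows "f s \<le> Lim (at_right s) f" "s < t \<Longrightarrow> Lim (at_right s) f \<le> f t"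
proof -
  have bdd: "bdd_below (f ` {s<..})"
    by (rule bdd_belowI[of _ "f s"]) (use m s in \<open>auto simp: mono_on_def\<close>)
  show "f s \<le> Lim (at_right s) f"
    unfolding Lim_right_mono[OF assms]
    by (rule cInf_greatest) (use m s in \<open>auto simp: mono_on_def\<close>)
  show "s < t \<Longrightarrow> Lim (at_right s) f \<le> f t"
    unfolding Lim_right_mono[OF assms] by (rule cInf_lower[OF _ bdd]) auto
qed

text \<open>The distribution function from which \<open>dividend_measure\<close> is built.\<close>

definition right_version :: "(real \<Rightarrow> real) \<Rightarrow> real \<Rightarrow> real" where
  "right_version L s = (if s < 0 then 0 else Lim (at_right s) L)"

lemma right_version_mono:
  assumes m: "mono_on {0..} L" and L0: "0 \<le> L 0" and st: "s \<le> t"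
  shows "right_version L s \<le> right_version L t"
proof -
  consider "s = t" | "s < 0" "0 \<le> t" | "t < 0" | "0 \<le> s" "s < t" using st by fastforce
  then show ?thesis
  proof cases
    case 2
    have "L 0 \<le> L t" using m 2 by (auto simp: mono_on_def)
    then show ?thesis using Lim_right_bounds(1)[OF m, of t] L0 2 by (auto simp: right_version_def)
  next
    case 4
    then show ?thesis using Lim_right_bounds(2)[OF m, of s t] Lim_right_bounds(1)[OF m, of t]
      by (auto simp: right_version_def)
  qed (use st in \<open>auto simp: right_version_def\<close>)
qed

lemma right_version_right_cont:
  assumes m: "mono_on {0..} L" and L0: "0 \<le> L 0"
  shows "continuous (at_right s) (right_version L)"
proof (cases "s < 0")
  case True
  have "(right_version L \<longlongrightarrow> 0) (at_right s)"
  proof (rule tendsto_eventually)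
    show "eventually (\<lambda>t. right_version L t = 0) (at_right s)"
      unfolding eventually_at_right_field using True
      by (intro exI[of _ 0]) (auto simp: right_version_def)
  qed
  then show ?thesis using True by (simp add: continuous_within right_version_def)
next
  case False
  let ?R = "right_version L"
  have "(?R \<longlongrightarrow> ?R s) (at_right s)"
  proof (rule order_tendstoI)
    fix a assume "a < ?R s"
    then have "a < ?R t" if "s < t" for t
      using right_version_mono[OF m L0, of s t] that by simp
    then show "eventually (\<lambda>t. a < ?R t) (at_right s)"
      by (auto simp: eventually_at_filter)
  next
    fix a assume "?R s < a"
    with False have "Lim (at_right s) L < a" by (simp add: right_version_def)
    then have "eventually (\<lambda>t. L t < a) (at_right s)"
      using mono_right_limit[OF m, of s] Lim_right_mono[OF m, of s] False
      by (auto simp: order_tendsto_iff)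
    then obtain b where b: "s < b" "\<And>r. s < r \<Longrightarrow> r < b \<Longrightarrow> L r < a"
      unfolding eventually_at_right_field by blast
    have "?R r < a" if r: "s < r" "r < b" for r
    proof -
      have "?R r \<le> L ((r + b) / 2)"
        using Lim_right_bounds(2)[OF m, of r "(r+b)/2"] r False by (auto simp: right_version_def)
      also have "\<dots> < a" using b r by (auto simp: field_simps)
      finally show ?thesis .
    qed
    then show "eventually (\<lambda>t. ?R t < a) (at_right s)"
      unfolding eventually_at_right_field using b(1) by blast
  qed
  then show ?thesis by (simp add: continuous_within)
qed

lemma dividend_measure_alt: "dividend_measure L = interval_measure (right_version L)"
  by (simp add: dividend_measure_def right_version_def[abs_def])

lemma sets_dividend_measure [simp, measurable_cong]: "sets (dividend_measure L) = sets borel"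
  by (simp add: dividend_measure_alt)

lemma emeasure_dividend_measure_Ioc:
  assumes "mono_on {0..} L" "0 \<le> L 0" "a \<le> b"
  shows "emeasure (dividend_measure L) {a<..b} = ennreal (right_version L b - right_version L a)"
  unfolding dividend_measure_alt
  by (rule emeasure_interval_measure_Ioc[OF assms(3) right_version_mono[OF assms(1,2)] right_version_right_cont[OF assms(1,2)]])

lemma right_version_add:
  assumes "mono_on {0..} L" "mono_on {0..} K"
  shows "right_version (\<lambda>t. L t + K t) s = right_version L s + right_version K s"
proof (cases "s < 0")
  case False
  then have "((\<lambda>t. L t + K t) \<longlongrightarrow> Lim (at_right s) L + Lim (at_right s) K) (at_right s)"
    using mono_right_limit[OF assms(1), of s] mono_right_limit[OF assms(2), of s]
      Lim_right_mono[OF assms(1), of s] Lim_right_mono[OF assms(2), of s]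
    by (intro tendsto_add) simp_all
  from tendsto_Lim[OF _ this] False show ?thesis by (simp add: right_version_def)
qed (simp add: right_version_def)

lemma nn_integral_sum_of_measures:
  assumes s: "sets M1 = sets M" "sets M2 = sets M"
    and e: "\<And>A. A \<in> sets M \<Longrightarrow> emeasure M A = emeasure M1 A + emeasure M2 A"
    and f: "f \<in> borel_measurable M"
  shows "(\<integral>\<^sup>+x. f x \<partial>M) = (\<integral>\<^sup>+x. f x \<partial>M1) + (\<integral>\<^sup>+x. f x \<partial>M2)"
  using f
proof (induct rule: borel_measurable_induct)
  note [measurable_cong] = s
  have sp: "space M1 = space M" "space M2 = space M" using s by (auto dest: sets_eq_imp_space_eq)
  case (cong f g)
  then show ?case
    using nn_integral_cong[of M f g] nn_integral_cong[of M1 f g] nn_integral_cong[of M2 f g] sp by simp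
next
  case (set A)
  then show ?case using s e by simp
next
  note [measurable_cong] = s
  case (mult u c)
  then show ?case using s by (simp add: nn_integral_cmult measurable_cong_sets[OF s(1) refl] measurable_cong_sets[OF s(2) refl] distrib_left)
next
  case (add u v)
  then show ?case using s by (simp add: nn_integral_add measurable_cong_sets[OF s(1) refl] measurable_cong_sets[OF s(2) refl] ac_simps)
next
  case (seq U)
  have *: "integral\<^sup>N K (SUP i. U i) = (SUP i. integral\<^sup>N K (U i))" if "sets K = sets M" for K
  proof -
    have "U i \<in> borel_measurable K" for i using seq(1) that measurable_cong_sets by blast
    then have "(\<integral>\<^sup>+ x. (SUP i. U i x) \<partial>K) = (SUP i. integral\<^sup>N K (U i))"
      by (intro nn_integral_monotone_convergence_SUP seq)
    then show ?thesis by (simp add: SUP_apply[abs_def])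
  qed
  have inc: "incseq (\<lambda>i. integral\<^sup>N K (U i))" for K
    using seq(4) by (auto simp: incseq_def le_fun_def intro!: nn_integral_mono)
  have "integral\<^sup>N M (SUP i. U i) = (SUP i. integral\<^sup>N M1 (U i) + integral\<^sup>N M2 (U i))"
    using *[OF refl] seq(3) by simp
  also have "\<dots> = (SUP i. integral\<^sup>N M1 (U i)) + (SUP i. integral\<^sup>N M2 (U i))"
    by (rule ennreal_SUP_add[OF inc inc])
  finally show ?case unfolding *[OF s(1)] *[OF s(2)] .
qed

text \<open>The set function on the right is itself a measure, and both measures agree on the half-open
  intervals.  This additivity is what makes the payoff depend on the total dividends only.\<close>

lemma emeasure_dividend_measure_add:
  assumes L: "mono_on {0..} L" "0 \<le> L 0" and K: "mono_on {0..} K" "0 \<le> K 0"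
    and A: "A \<in> sets borel"
  shows "emeasure (dividend_measure (\<lambda>t. L t + K t)) A
       = emeasure (dividend_measure L) A + emeasure (dividend_measure K) A"
proof -
  let ?\<mu> = "\<lambda>A. emeasure (dividend_measure L) A + emeasure (dividend_measure K) A"
  define S where "S = measure_of (UNIV :: real set) (sets borel) ?\<mu>"
  have sS: "sets S = sets borel" unfolding S_def by (metis sets.sigma_sets_eq sets_measure_of space_borel subset_UNIV Pow_UNIV)
  have pos: "positive (sets borel) ?\<mu>" by (simp add: positive_def)
  have ca: "countably_additive (sets borel) ?\<mu>"
  proof (rule countably_additiveI)
    fix B :: "nat \<Rightarrow> real set"
    assume B: "range B \<subseteq> sets borel" "disjoint_family B" "\<Union>(range B) \<in> sets borel"
    show "(\<Sum>i. ?\<mu> (B i)) = ?\<mu> (\<Union>(range B))"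
      using B suminf_emeasure[of B "dividend_measure L"] suminf_emeasure[of B "dividend_measure K"]
      by (simp add: suminf_add[symmetric])
  qed
  have eS: "emeasure S B = ?\<mu> B" if "B \<in> sets borel" for B
    unfolding S_def
    by (rule emeasure_measure_of_sigma[OF _ pos ca that])
       (metis sets.sigma_algebra_axioms space_borel)
  let ?E = "range (\<lambda>(a::real, b::real). {a<..b})"
  have LK: "mono_on {0..} (\<lambda>t. L t + K t)" "0 \<le> L 0 + K 0"
    using L K by (auto simp: mono_on_def intro: add_mono)
  have "dividend_measure (\<lambda>t. L t + K t) = S"
  proof (rule measure_eqI_generator_eq[where E = ?E and \<Omega> = UNIV and A = "\<lambda>n. {- real n<..real n}"])
    show "Int_stable ?E"
    proof (rule Int_stableI_image)
      fix i j :: "real \<times> real"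
      show "\<exists>k\<in>UNIV. (case i of (a, b) \<Rightarrow> {a<..b}) \<inter> (case j of (a, b) \<Rightarrow> {a<..b}) =
             (case k of (a, b) \<Rightarrow> {a<..b})"
        by (intro bexI[of _ "(max (fst i) (fst j), min (snd i) (snd j))"]) (auto split: prod.splits)
    qed
    show "?E \<subseteq> Pow UNIV" by simp
    fix X assume "X \<in> ?E"
    then obtain a b where X: "X = {a<..b}" by auto
    show "emeasure (dividend_measure (\<lambda>t. L t + K t)) X = emeasure S X"
    proof (cases "a \<le> b")
      case True
      show ?thesis
        unfolding X using True LK
        by (simp add: eS emeasure_dividend_measure_Ioc[OF L True] emeasure_dividend_measure_Ioc[OF K True]
            emeasure_dividend_measure_Ioc[OF LK True] right_version_add[OF L(1) K(1)]
            ennreal_plus[symmetric] right_version_mono[OF L] right_version_mono[OF K] del: ennreal_plus)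
           (simp add: algebra_simps)
    next
      case False
      then show ?thesis unfolding X by simp
    qed
  next
    show "sets (dividend_measure (\<lambda>t. L t + K t)) = sigma_sets UNIV ?E"
      by (simp add: borel_sigma_sets_Ioc)
    show "sets S = sigma_sets UNIV ?E" by (simp add: sS borel_sigma_sets_Ioc)
    show "range (\<lambda>n. {- real n<..real n}) \<subseteq> ?E" by auto
    show "(\<Union>i. {- real i<..real i}) = UNIV"
    proof (intro set_eqI iffI UNIV_I)
      fix x :: real
      obtain n :: nat where "\<bar>x\<bar> < real n" using reals_Archimedean2 by blast
      then have "x \<in> {- real n<..real n}" by auto
      then show "x \<in> (\<Union>i. {- real i<..real i})" by blast
    qed
    show "emeasure (dividend_measure (\<lambda>t. L t + K t)) {- real i<..real i} \<noteq> \<infinity>" for i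
      by (simp add: emeasure_dividend_measure_Ioc[OF LK])
  qed
  then show ?thesis using eS[OF A] by simp
qed

lemma borel_before [measurable]: "{s::real. 0 \<le> s \<and> ereal s < \<tau>} \<in> sets borel"
  by measurable

lemma discounted_dividends_add:
  assumes L: "mono_on {0..} L" "0 \<le> L 0" and K: "mono_on {0..} K" "0 \<le> K 0"
  shows "discounted_dividends \<delta> (\<lambda>t. L t + K t) \<tau> = discounted_dividends \<delta> L \<tau> + discounted_dividends \<delta> K \<tau>"
  unfolding discounted_dividends_def
  by (rule nn_integral_sum_of_measures) (simp_all add: emeasure_dividend_measure_add[OF assms] space_borel)

lemma discounted_dividends_mono:
  "\<tau> \<le> \<sigma> \<Longrightarrow> discounted_dividends \<delta> L \<tau> \<le> discounted_dividends \<delta> L \<sigma>"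
  unfolding discounted_dividends_def
  by (rule nn_integral_mono) (auto simp: indicator_def dest: less_le_trans)

text \<open>With \<open>\<sigma> = min \<tau> b\<close>, the interval \<open>[0, \<sigma>)\<close> is exhausted by \<open>(-1, t]\<close> with \<open>t < \<sigma>\<close>.  Starting at \<open>-1\<close> includes
  the atom at 0, and the jump at \<open>\<sigma>\<close> does not count; so a bound on the paths
  strictly before ruin suffices.\<close>

lemma emeasure_dividend_measure_before:
  assumes L: "mono_on {0..} L" "0 \<le> L 0" and b: "0 \<le> b"
    and bound: "\<And>t. 0 \<le> t \<Longrightarrow> ereal t < \<tau> \<Longrightarrow> t < b \<Longrightarrow> right_version L t \<le> c" and c: "0 \<le> c"
  shows "emeasure (dividend_measure L) {t. 0 \<le> t \<and> ereal t < \<tau> \<and> t < b} \<le> ennreal c"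
proof -
  let ?m = "dividend_measure L"
  define \<sigma> where "\<sigma> = min \<tau> (ereal b)"
  have set_eq: "{t. 0 \<le> t \<and> ereal t < \<tau> \<and> t < b} = {t. 0 \<le> t \<and> ereal t < \<sigma>}"
    by (auto simp: \<sigma>_def)
  show ?thesis
  proof (cases "0 < \<sigma>")
    case False
    have "\<not> (0 \<le> t \<and> ereal t < \<sigma>)" for t
    proof
      assume "0 \<le> t \<and> ereal t < \<sigma>"
      then have "0 \<le> ereal t" "ereal t < \<sigma>" by simp_all
      then have "0 < \<sigma>" by (rule order.strict_trans1)
      with False show False by contradiction
    qed
    then have none: "{t. 0 \<le> t \<and> ereal t < \<sigma>} = {}" by blast
    show ?thesis unfolding set_eq none by simp
  next
    case True
    have "\<sigma> \<le> ereal b" by (simp add: \<sigma>_def)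
    then obtain r where r: "\<sigma> = ereal r" using True by (cases \<sigma>) auto
    with True have r0: "0 < r" by simp
    define B where "B n = {-1<..r - r / (real n + 2)}" for n :: nat
    have "r / (real n + 2) \<le> r / (real m + 2)" if "m \<le> n" for m n :: nat
      using r0 that by (intro divide_left_mono) auto
    then have inc: "incseq B"
      unfolding B_def incseq_def by (smt (verit) greaterThanAtMost_iff subsetI)
    have sub: "{t. 0 \<le> t \<and> ereal t < \<sigma>} \<subseteq> (\<Union>n. B n)"
    proof
      fix t assume "t \<in> {t. 0 \<le> t \<and> ereal t < \<sigma>}"
      then have t: "0 \<le> t" "t < r" by (auto simp: r)
      obtain n :: nat where n: "r / (r - t) < real n" using reals_Archimedean2 by blast
      then have "r < real n * (r - t)" using t by (simp add: field_simps)
      then have "r < (real n + 2) * (r - t)" using t by (simp add: algebra_simps)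
      then have "r / (real n + 2) \<le> r - t" by (simp add: field_simps)
      then have "t \<in> B n" using t by (auto simp: B_def)
      then show "t \<in> (\<Union>n. B n)" by blast
    qed
    have "emeasure ?m {t. 0 \<le> t \<and> ereal t < \<sigma>} \<le> emeasure ?m (\<Union>n. B n)"
      by (rule emeasure_mono[OF sub]) (auto simp: B_def)
    also have "\<dots> = (SUP n. emeasure ?m (B n))"
      by (rule SUP_emeasure_incseq[symmetric, OF _ inc]) (auto simp: B_def)
    also have "\<dots> \<le> ennreal c"
    proof (rule SUP_least)
      fix n :: nat
      define t where "t = r - r / (real n + 2)"
      have "r / (real n + 2) \<le> r" using r0 by (simp add: field_simps)
      moreover have "0 < r / (real n + 2)" using r0 by simp
      ultimately have t: "0 \<le> t" "t < r" by (auto simp: t_def)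
      then have "ereal t < \<sigma>" using r by simp
      then have "right_version L t \<le> c" using bound[of t] t by (auto simp: \<sigma>_def)
      then show "emeasure ?m (B n) \<le> ennreal c"
        using t unfolding B_def t_def[symmetric]
        by (simp add: emeasure_dividend_measure_Ioc[OF L] right_version_def ennreal_leI)
    qed
    finally show ?thesis unfolding set_eq .
  qed
qed

lemma discounted_dividends_zero:
  assumes L: "mono_on {0..} L" "0 \<le> L 0" and z: "\<And>t. 0 \<le> t \<Longrightarrow> ereal t < \<tau> \<Longrightarrow> L t = 0"
  shows "discounted_dividends \<delta> L \<tau> = 0"
proof -
  have rv: "right_version L t \<le> 0" if t: "0 \<le> t" "ereal t < \<tau>" for t
  proof -
    obtain v where v: "t < v" "ereal v < \<tau>" using ereal_dense2[OF t(2)] by auto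
    then have "L v = 0" using z t by auto
    then show ?thesis using Lim_right_bounds(2)[OF L(1) t(1) v(1)] t by (simp add: right_version_def)
  qed
  let ?m = "dividend_measure L"
  have n: "emeasure ?m {t. 0 \<le> t \<and> ereal t < \<tau> \<and> t < real n} = 0" for n :: nat
    using emeasure_dividend_measure_before[OF L, of "real n" \<tau> 0] rv by simp
  have "emeasure ?m (\<Union>n. {t. 0 \<le> t \<and> ereal t < \<tau> \<and> t < real n}) = 0"
    by (rule emeasure_UN_eq_0) (auto intro: n)
  also have "(\<Union>n. {t. 0 \<le> t \<and> ereal t < \<tau> \<and> t < real n}) = {t. 0 \<le> t \<and> ereal t < \<tau>}"
    using reals_Archimedean2 by auto
  finally have "{t. 0 \<le> t \<and> ereal t < \<tau>} \<in> null_sets ?m" by (simp add: null_setsI)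
  then show ?thesis unfolding discounted_dividends_def by (rule nn_integral_null_set)
qed

text \<open>Discounting each unit period \<open>[n, n + 1)\<close> from its beginning gives a bound that depends on the path
  only through its linear majorant.\<close>

lemma discounted_dividends_le_exp:
  assumes L: "mono_on {0..} L" "0 \<le> L 0" and d: "0 \<le> \<delta>"
    and bound: "\<And>t. 0 \<le> t \<Longrightarrow> ereal t < \<tau> \<Longrightarrow> L t \<le> z + q * t" and z: "0 \<le> z" "0 \<le> q"
  shows "discounted_dividends \<delta> L \<tau> \<le> (\<Sum>n. ennreal (exp (- \<delta> * real n) * (z + q * (real n + 1))))"
proof -
  let ?m = "dividend_measure L"
  let ?A = "\<lambda>n. {t. 0 \<le> t \<and> ereal t < \<tau> \<and> t < real n + 1}"
  have rv: "right_version L t \<le> z + q * b" if t: "0 \<le> t" "ereal t < \<tau>" "t < b" for t b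
  proof -
    have "ereal t < min \<tau> (ereal b)" using t by simp
    then obtain v where v: "t < v" "ereal v < \<tau>" "v < b"
      using ereal_dense2[of "ereal t" "min \<tau> (ereal b)"] by auto
    then have "right_version L t \<le> L v"
      using Lim_right_bounds(2)[OF L(1) t(1) v(1)] t by (simp add: right_version_def)
    also have "\<dots> \<le> z + q * v" using bound v t by auto
    also have "\<dots> \<le> z + q * b" using v z by (simp add: mult_left_mono)
    finally show ?thesis .
  qed
  have term_le: "f n \<le> suminf f" for f :: "nat \<Rightarrow> ennreal" and n
    using sum_le_suminf[OF summableI, of "{n}" f] by simp
  have "discounted_dividends \<delta> L \<tau> \<le> (\<integral>\<^sup>+t. (\<Sum>n. ennreal (exp (- \<delta> * real n)) * indicator (?A n) t) \<partial>?m)"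
    unfolding discounted_dividends_def
  proof (rule nn_integral_mono)
    fix t
    show "ennreal (exp (- \<delta> * t)) * indicator {s. 0 \<le> s \<and> ereal s < \<tau>} t
        \<le> (\<Sum>n. ennreal (exp (- \<delta> * real n)) * indicator (?A n) t)"
    proof (cases "0 \<le> t \<and> ereal t < \<tau>")
      case True
      define n where "n = nat \<lfloor>t\<rfloor>"
      have n: "real n \<le> t" "t < real n + 1" using True by (auto simp: n_def)
      have "ennreal (exp (- \<delta> * t)) \<le> ennreal (exp (- \<delta> * real n)) * indicator (?A n) t"
        using n True d by (auto intro!: ennreal_leI mult_left_mono)
      also have "\<dots> \<le> (\<Sum>n. ennreal (exp (- \<delta> * real n)) * indicator (?A n) t)"
        by (rule term_le)
      finally show ?thesis using True by simp
    qed auto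
  qed
  also have "\<dots> = (\<Sum>n. ennreal (exp (- \<delta> * real n)) * emeasure ?m (?A n))"
    by (subst nn_integral_suminf) (auto simp: nn_integral_cmult_indicator)
  also have "\<dots> \<le> (\<Sum>n. ennreal (exp (- \<delta> * real n) * (z + q * (real n + 1))))"
  proof (rule suminf_le[OF _ summableI summableI])
    fix n :: nat
    have "emeasure ?m (?A n) \<le> ennreal (z + q * (real n + 1))"
      by (rule emeasure_dividend_measure_before[OF L]) (use rv z in auto)
    then show "ennreal (exp (- \<delta> * real n)) * emeasure ?m (?A n) \<le> ennreal (exp (- \<delta> * real n) * (z + q * (real n + 1)))"
      using z by (simp add: ennreal_mult' mult_left_mono)
  qed
  finally show ?thesis .
qed

lemma exp_series_finite:
  assumes d: "0 < \<delta>" and z: "0 \<le> z" "0 \<le> q"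
  shows "(\<Sum>n. ennreal (exp (- \<delta> * real n) * (z + q * (real n + 1)))) < \<infinity>"
proof -
  have eq: "exp (- \<delta> * real n) = exp (-\<delta>) ^ n" for n
    by (metis exp_of_nat_mult mult.commute)
  have r: "norm (exp (-\<delta>)) < 1" using d by simp
  have "summable (\<lambda>n. (z * exp (-\<delta>) ^ n) + q * (of_nat (Suc n) * exp (-\<delta>) ^ n))"
    by (intro summable_add summable_mult summable_geometric geometric_deriv_sums[OF r, THEN sums_summable] r)
  then have "summable (\<lambda>n. exp (- \<delta> * real n) * (z + q * (real n + 1)))"
    unfolding eq by (simp add: algebra_simps)
  then show ?thesis using z by (subst suminf_ennreal2) auto
qed

section \<open>Splitting one stream of dividends between two companies, path by path\<close>

text \<open>The recursion over claims runs along the jump times of the total claims \<open>A\<close>.  It must be driven by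
  \<open>A\<close> and not by the number of claims: whether the counting process
  jumps by 1 or 2 cannot be seen from the surpluses, so its jumps are not known to the companies.  An
  additional, harmless restart is scheduled one unit of time after the previous one, which makes all
  these times finite even if there are only finitely many claims.\<close>

primrec restart :: "(real \<Rightarrow> real) \<Rightarrow> nat \<Rightarrow> real" where
  "restart A 0 = 0"
| "restart A (Suc n) =
     Inf {s. restart A n \<le> s \<and> (restart A n + 1 \<le> s \<or> A (restart A n) < A s)}"

declare restart.simps(2) [simp del]

text \<open>The supremum is over rationals before \<open>t\<close>, which yields left continuity and measurability at the
  same time; the value 0 elsewhere keeps the index set independent of \<open>t\<close>.\<close>

definition second_pays :: "(real \<Rightarrow> real) \<Rightarrow> (real \<Rightarrow> real) \<Rightarrow> (real \<Rightarrow> real) \<Rightarrow> real \<Rightarrow> real" where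
  "second_pays X L D t = (SUP q\<in>\<rat> \<inter> {0..}. if q < t then max 0 (L q - X q - D q) else 0)"

text \<open>The net transfer to One when only the first \<open>n\<close> restarts are taken into account.  At a restart \<open>s\<close>,
  \<open>v\<close> is the surplus of One without transfers and \<open>v\<close> plus the previous transfers is its surplus
  just before the new one; the latter is moved into the interval from 0 to the joint surplus.  The outer
  maximum makes the surplus of One non-negative even after ruin, so that monotonicity
  of the split needs no case distinction.\<close>

primrec transfers ::
    "(real \<Rightarrow> real) \<Rightarrow> (real \<Rightarrow> real) \<Rightarrow> (real \<Rightarrow> real) \<Rightarrow> (nat \<Rightarrow> real) \<Rightarrow> nat \<Rightarrow> real \<Rightarrow> real" where
  "transfers X Y L T 0 t = 0"
| "transfers X Y L T (Suc n) t =
     (if t < T (Suc n) then transfers X Y L T n t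
      else let s = T (Suc n);
               v = X s - L s + second_pays X L (transfers X Y L T n) s
           in max 0 (min (v + transfers X Y L T n (T n)) (X s + Y s - L s)) - v)"

definition net_transfer ::
    "(real \<Rightarrow> real) \<Rightarrow> (real \<Rightarrow> real) \<Rightarrow> (real \<Rightarrow> real) \<Rightarrow> (nat \<Rightarrow> real) \<Rightarrow> real \<Rightarrow> real" where
  "net_transfer X Y L T t = lim (\<lambda>n. transfers X Y L T n t)"

locale claim_path =
  fixes A :: "real \<Rightarrow> real" and K :: "real \<Rightarrow> nat"
  assumes K_mono: "0 \<le> s \<Longrightarrow> s \<le> t \<Longrightarrow> K s \<le> K t"
    and K_right: "0 \<le> t \<Longrightarrow> \<exists>e>0. \<forall>s. t \<le> s \<and> s < t + e \<longrightarrow> K s = K t"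
    and A_less_iff: "0 \<le> s \<Longrightarrow> s \<le> t \<Longrightarrow> A s < A t \<longleftrightarrow> K s < K t"
begin

abbreviation T :: "nat \<Rightarrow> real" where "T \<equiv> restart A"

text \<open>The set in the definition of the next restart is upward closed because \<open>A\<close> is non-decreasing, and
  contains its infimum because \<open>A\<close> is locally constant to the right.  The equivalence is what later
  makes the restarts stopping times.\<close>

lemma restart_Suc_iff:
  assumes "0 \<le> T n" "T n \<le> s"
  shows "T (Suc n) \<le> s \<longleftrightarrow> T n + 1 \<le> s \<or> A (T n) < A s"
    and "T n < T (Suc n)" and "T (Suc n) \<le> T n + 1"
proof -
  let ?a = "T n"
  let ?S = "{s. ?a \<le> s \<and> (?a + 1 \<le> s \<or> A ?a < A s)}"
  have T: "T (Suc n) = Inf ?S" by (rule restart.simps(2))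
  have bdd: "bdd_below ?S" by (auto intro: bdd_belowI[of _ ?a])
  have ne: "?a + 1 \<in> ?S" by simp
  have up: "t \<in> ?S" if "s \<in> ?S" "s \<le> t" for s t
  proof -
    have "A ?a < A t" if "A ?a < A s"
      using that A_less_iff[of ?a s] A_less_iff[of ?a t] K_mono[of s t] \<open>s \<in> ?S\<close> \<open>s \<le> t\<close> assms(1)
      by simp
    then show ?thesis using that by auto
  qed
  have ge: "?a \<le> Inf ?S" by (rule cInf_greatest) (use ne in blast)+
  have le1: "Inf ?S \<le> ?a + 1" using ne bdd by (rule cInf_lower)
  have att: "Inf ?S \<in> ?S"
  proof (rule ccontr)
    assume n: "Inf ?S \<notin> ?S"
    let ?i = "Inf ?S"
    have i1: "?i < ?a + 1" using n le1 ne by (metis (no_types, lifting) order_le_less)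
    from K_right[of ?i] ge assms(1) obtain e where e: "e > 0" "\<And>s. ?i \<le> s \<Longrightarrow> s < ?i + e \<Longrightarrow> K s = K ?i"
      by auto
    have "?i < min (?i + e) (?a + 1)" using e i1 by simp
    then obtain s where s: "s \<in> ?S" "s < min (?i + e) (?a + 1)"
      using cInf_less_iff[of ?S "min (?i + e) (?a + 1)"] ne bdd by blast
    have "?i \<le> s" using s(1) bdd by (rule cInf_lower)
    moreover have "s < ?i + e" using s(2) by simp
    ultimately have "K s = K ?i" by (rule e(2))
    moreover have "K ?a < K s"
    proof -
      have "?a \<le> s" "A ?a < A s" using s by auto
      then show ?thesis using A_less_iff[of ?a s] assms(1) by blast
    qed
    ultimately have "A ?a < A ?i" using A_less_iff[OF assms(1) ge] by presburger
    then have "?i \<in> ?S" using ge by blast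
    with n show False by contradiction
  qed
  have att': "T (Suc n) \<in> ?S" unfolding T by (rule att)
  show "T (Suc n) \<le> s \<longleftrightarrow> T n + 1 \<le> s \<or> A (T n) < A s"
  proof
    assume "T (Suc n) \<le> s"
    then have "s \<in> ?S" by (rule up[OF att'])
    then show "T n + 1 \<le> s \<or> A (T n) < A s" by simp
  next
    assume "T n + 1 \<le> s \<or> A (T n) < A s"
    then have "s \<in> ?S" using assms by simp
    then show "T (Suc n) \<le> s" unfolding T using bdd by (rule cInf_lower)
  qed
  show "T n < T (Suc n)"
    using att' by (cases "T (Suc n) = T n") auto
  show "T (Suc n) \<le> T n + 1" unfolding T by (rule le1)
qed

lemma T_nonneg: "0 \<le> T n"
  by (induction n) (use restart_Suc_iff(2) in fastforce)+

lemma T_less: "T n < T (Suc n)" and T_le: "T (Suc n) \<le> T n + 1"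
  using restart_Suc_iff[OF T_nonneg order_refl] by blast+

lemma T_Suc_iff: "T n \<le> s \<Longrightarrow> T (Suc n) \<le> s \<longleftrightarrow> T n + 1 \<le> s \<or> A (T n) < A s"
  by (rule restart_Suc_iff[OF T_nonneg])

lemma T_strict_mono: "strict_mono T"
  by (rule strict_mono_Suc_iff[THEN iffD2]) (use T_less in blast)

lemma T_mono: "m \<le> n \<Longrightarrow> T m \<le> T n"
  using T_strict_mono by (simp add: strict_mono_less_eq)

lemma K_const: "T n \<le> s \<Longrightarrow> s < T (Suc n) \<Longrightarrow> K s = K (T n)"
  using T_Suc_iff[of n s] A_less_iff[of "T n" s] K_mono[of "T n" s] T_nonneg[of n] by force

text \<open>Each restart raises either the number of claims or the time by at least 1.\<close>

lemma T_unbounded: "\<exists>n. t < T n"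
proof (rule ccontr)
  assume "\<nexists>n. t < T n"
  then have le: "T n \<le> t" for n by (simp add: not_less)
  have "real n \<le> real (K (T n)) + T n" for n
  proof (induction n)
    case (Suc n)
    have "T n + 1 \<le> T (Suc n) \<or> K (T n) < K (T (Suc n))"
      using T_Suc_iff[of n "T (Suc n)"] T_less[of n] A_less_iff[of "T n" "T (Suc n)"] T_nonneg[of n] by simp
    then show ?case using Suc T_less[of n] K_mono[of "T n" "T (Suc n)"] T_nonneg[of n] by force
  qed simp
  moreover have "real (K (T n)) + T n \<le> real (K t) + t" for n
    using K_mono[OF T_nonneg le] le by (simp add: add_mono)
  ultimately have "real n \<le> real (K t) + t" for n by (meson order_trans)
  then show False using reals_Archimedean2[of "real (K t) + t"] by (metis not_less)
qed

lemma T_interval: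
  assumes "0 \<le> t" obtains n where "T n \<le> t" "t < T (Suc n)"
proof -
  define m where "m = (LEAST m. t < T m)"
  have m: "t < T m" unfolding m_def using T_unbounded by (rule LeastI_ex)
  then obtain n where n: "m = Suc n" using assms by (cases m) auto
  have "\<not> t < T n" using not_less_Least[of n "\<lambda>m. t < T m"] n m_def by simp
  then show ?thesis using m n by (intro that[of n]) simp_all
qed

lemma T_interval':
  assumes "0 < t" obtains n where "T n < t" "t \<le> T (Suc n)"
proof -
  obtain n where n: "T n \<le> t" "t < T (Suc n)" using T_interval[of t] assms by auto
  show ?thesis
  proof (cases "T n < t")
    case False
    with n have t: "t = T n" by simp
    then obtain m where "n = Suc m" using assms by (cases n) auto
    then show ?thesis using t T_less[of m] that[of m] by simp
  qed (use n that in auto)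
qed

end

text \<open>The surpluses enter only through their initial values and their growth between claims.\<close>

locale split_path = claim_path +
  fixes X Y L :: "real \<Rightarrow> real"
  assumes X_mono: "0 \<le> s \<Longrightarrow> s \<le> t \<Longrightarrow> K s = K t \<Longrightarrow> X s \<le> X t"
    and Y_mono: "0 \<le> s \<Longrightarrow> s \<le> t \<Longrightarrow> K s = K t \<Longrightarrow> Y s \<le> Y t"
    and X0: "0 \<le> X 0" and Y0: "0 \<le> Y 0"
    and L_mono: "0 \<le> s \<Longrightarrow> s \<le> t \<Longrightarrow> L s \<le> L t"
    and L0: "L 0 = 0"
    and L_left: "0 < t \<Longrightarrow> continuous (at_left t) L"
begin

abbreviation "Dn \<equiv> transfers X Y L T"
definition D where "D = net_transfer X Y L T"
definition paid_by_Two where "paid_by_Two = second_pays X L D"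

lemma L_nonneg: "0 \<le> t \<Longrightarrow> 0 \<le> L t" using L_mono[of 0 t] L0 by simp

lemma Dn_stable: "n \<le> m \<Longrightarrow> t < T (Suc n) \<Longrightarrow> Dn m t = Dn n t"
proof (induction m rule: dec_induct)
  case (step m)
  have "T (Suc n) \<le> T (Suc m)" using T_mono step by simp
  then show ?case using step by simp
qed simp

lemma D_eq_Dn: "t < T (Suc n) \<Longrightarrow> D t = Dn n t"
  unfolding D_def net_transfer_def
  by (rule limI, rule tendsto_eventually) (use Dn_stable in \<open>auto simp: eventually_sequentially\<close>)

lemma second_pays_cong: "(\<And>q. 0 \<le> q \<Longrightarrow> q < t \<Longrightarrow> D1 q = D2 q) \<Longrightarrow> second_pays X L D1 t = second_pays X L D2 t"
  unfolding second_pays_def by (intro SUP_cong) auto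

lemma D_0: "D 0 = 0"
  using D_eq_Dn[of 0 0] T_less[of 0] by simp

lemma D_const: "T n \<le> t \<Longrightarrow> t < T (Suc n) \<Longrightarrow> D t = D (T n)"
  using T_less[of n] D_eq_Dn[of t n] D_eq_Dn[of "T n" n] by (cases n) (auto simp: Let_def)

text \<open>The construction of \<open>D\<close> is used only through its initial value, its constancy between restarts and this
  equation, in which \<open>paid_by_Two\<close> involves only values of \<open>D\<close> before the restart.\<close>

lemma D_jump:
  "D (T (Suc n)) = max 0 (min (X (T (Suc n)) - L (T (Suc n)) + paid_by_Two (T (Suc n)) + D (T n))
       (X (T (Suc n)) + Y (T (Suc n)) - L (T (Suc n)))) - (X (T (Suc n)) - L (T (Suc n)) + paid_by_Two (T (Suc n)))"
proof -
  have "second_pays X L (Dn n) (T (Suc n)) = paid_by_Two (T (Suc n))"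
    unfolding paid_by_Two_def by (rule second_pays_cong) (simp add: D_eq_Dn)
  then show ?thesis
    using D_eq_Dn[of "T (Suc n)" "Suc n"] T_less[of "Suc n"] D_eq_Dn[of "T n" n] T_less[of n]
    by (simp add: Let_def)
qed

text \<open>The amount by which One would be overdrawn at \<open>q\<close> if it had paid all dividends itself.\<close>

definition overdraft where "overdraft q = L q - X q - D q"

lemma paid_by_Two_alt: "paid_by_Two t = (SUP q\<in>\<rat> \<inter> {0..}. if q < t then max 0 (overdraft q) else 0)"
  by (simp add: paid_by_Two_def second_pays_def overdraft_def)

text \<open>Between restarts the premiums can only diminish the overdraft.\<close>

lemma overdraft_step: "T n \<le> s \<Longrightarrow> s \<le> q \<Longrightarrow> q < T (Suc n) \<Longrightarrow> overdraft q \<le> overdraft s + L q - L s"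
  using X_mono[of s q] T_nonneg[of n] K_const[of n s] K_const[of n q] D_const[of n s] D_const[of n q]
  by (simp add: overdraft_def)

lemma idx_ne: "\<rat> \<inter> {0::real..} \<noteq> {}" by (auto intro: exI[of _ 0])

lemma paid_by_Two_le: "0 \<le> c \<Longrightarrow> (\<And>q. 0 \<le> q \<Longrightarrow> q < t \<Longrightarrow> overdraft q \<le> c) \<Longrightarrow> paid_by_Two t \<le> c"
  unfolding paid_by_Two_alt by (rule cSUP_least[OF idx_ne]) auto

lemma overdraft_T: "overdraft (T n) \<le> paid_by_Two (T n)" if "n \<noteq> 0"
  using that D_jump by (cases n) (auto simp: overdraft_def)

lemma overdraft_0: "overdraft 0 \<le> 0" using X0 L0 D_0 by (simp add: overdraft_def)

text \<open>This bound is proved before anything else about \<open>paid_by_Two\<close>, because the real supremum in its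
  definition is meaningful only for bounded sets.  It goes along the restarts: at a restart
  the overdraft is at most what Two has paid, which is a supremum of earlier overdrafts.\<close>

lemma overdraft_le_L:
  assumes "0 \<le> q" shows "overdraft q \<le> L q"
proof -
  have "T n \<le> q \<Longrightarrow> q < T (Suc n) \<Longrightarrow> overdraft q \<le> L q" for n q
  proof (induction n arbitrary: q rule: less_induct)
    case (less n)
    have "overdraft (T n) \<le> L (T n)"
    proof (cases "n = 0")
      case True
      then show ?thesis using overdraft_0 L0 by simp
    next
      case False
      have "paid_by_Two (T n) \<le> L (T n)"
      proof (rule paid_by_Two_le)
        fix r assume r: "0 \<le> r" "r < T n"
        then obtain m where m: "T m \<le> r" "r < T (Suc m)" using T_interval by blast
        have "m < n"
          using m(1) r(2) T_strict_mono by (meson le_less_trans strict_mono_less)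
        then have "overdraft r \<le> L r" using less.IH m by blast
        also have "\<dots> \<le> L (T n)" using L_mono r by simp
        finally show "overdraft r \<le> L (T n)" .
      qed (simp add: L_nonneg T_nonneg)
      then show ?thesis using overdraft_T[OF False] by simp
    qed
    then show ?case using overdraft_step[of n "T n" q] less.prems by simp
  qed
  then show ?thesis using T_interval[OF assms] by metis
qed

lemma paid_by_Two_bdd: "bdd_above ((\<lambda>q. if q < t then max 0 (overdraft q) else 0) ` (\<rat> \<inter> {0..}))"
proof (rule bdd_aboveI2)
  fix q :: real assume "q \<in> \<rat> \<inter> {0..}"
  then show "(if q < t then max 0 (overdraft q) else 0) \<le> max 0 (L t)"
    using overdraft_le_L[of q] L_mono[of q t] L_nonneg[of q] by auto
qed

lemma paid_by_Two_ge: "q \<in> \<rat> \<Longrightarrow> 0 \<le> q \<Longrightarrow> q < t \<Longrightarrow> overdraft q \<le> paid_by_Two t"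
  unfolding paid_by_Two_alt using cSUP_upper[OF _ paid_by_Two_bdd, of q t] by simp

lemma paid_by_Two_nonneg: "0 \<le> paid_by_Two t"
  unfolding paid_by_Two_alt using cSUP_upper[OF _ paid_by_Two_bdd, of 0 t] by (simp split: if_splits)

lemma paid_by_Two_mono: "s \<le> t \<Longrightarrow> paid_by_Two s \<le> paid_by_Two t"
  unfolding paid_by_Two_alt
proof (rule cSUP_mono[OF idx_ne paid_by_Two_bdd])
  fix q :: real assume "s \<le> t" "q \<in> \<rat> \<inter> {0..}"
  then show "\<exists>m\<in>\<rat> \<inter> {0..}. (if q < s then max 0 (overdraft q) else 0) \<le> (if m < t then max 0 (overdraft m) else 0)"
    by (intro bexI[of _ q]) auto
qed

lemma paid_by_Two_0: "paid_by_Two 0 = 0"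
  using paid_by_Two_le[of 0 0] paid_by_Two_nonneg[of 0] by simp

lemma paid_by_Two_left: "continuous (at_left t) paid_by_Two"
proof -
  have "(paid_by_Two \<longlongrightarrow> paid_by_Two t) (at_left t)"
  proof (rule order_tendstoI)
    fix a assume "paid_by_Two t < a"
    then show "eventually (\<lambda>s. paid_by_Two s < a) (at_left t)"
      unfolding eventually_at_filter
      by (intro always_eventually) (meson paid_by_Two_mono le_less_trans lessThan_iff less_imp_le)
  next
    fix a assume a: "a < paid_by_Two t"
    show "eventually (\<lambda>s. a < paid_by_Two s) (at_left t)"
    proof (cases "a < 0")
      case True
      then show ?thesis using paid_by_Two_nonneg by (intro always_eventually) (auto intro: less_le_trans)
    next
      case False
      obtain q where q: "q \<in> \<rat>" "0 \<le> q" "a < (if q < t then max 0 (overdraft q) else 0)"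
        using a unfolding paid_by_Two_alt less_cSUP_iff[OF idx_ne paid_by_Two_bdd] by auto
      with False have qt: "q < t" "a < overdraft q" by (auto split: if_splits)
      have "a < paid_by_Two s" if "q < s" "s < t" for s
        using paid_by_Two_ge[OF q(1,2) that(1)] qt by simp
      then show ?thesis unfolding eventually_at_left_field using qt(1) by blast
    qed
  qed
  then show ?thesis by (simp add: continuous_within)
qed

text \<open>One never becomes overdrawn.  At restarts this is enforced by \<open>D\<close>; between them the overdraft is
  approximated from the left, where it is covered by the supremum.\<close>

lemma overdraft_le_paid_by_Two:
  assumes "0 \<le> t" shows "overdraft t \<le> paid_by_Two t"
proof -
  obtain n where n: "T n \<le> t" "t < T (Suc n)" using T_interval assms by blast
  show ?thesis
  proof (cases "t = T n")
    case True
    then show ?thesis using overdraft_T[of n] overdraft_0 paid_by_Two_0 by (cases "n = 0") auto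
  next
    case False
    with n have tn: "T n < t" by simp
    then have t0: "0 < t" using T_nonneg[of n] by simp
    show ?thesis
    proof (rule ccontr)
      assume "\<not> overdraft t \<le> paid_by_Two t"
      then have "L t - (overdraft t - paid_by_Two t) < L t" by simp
      moreover have "(L \<longlongrightarrow> L t) (at_left t)" using L_left[OF t0] by (simp add: continuous_within)
      ultimately have "eventually (\<lambda>s. L t - (overdraft t - paid_by_Two t) < L s) (at_left t)"
        by (simp add: order_tendsto_iff)
      then obtain b where b: "b < t" "\<And>s. b < s \<Longrightarrow> s < t \<Longrightarrow> L t - (overdraft t - paid_by_Two t) < L s"
        unfolding eventually_at_left_field by blast
      obtain q where q: "q \<in> \<rat>" "max b (T n) < q" "q < t"
        using Rats_dense_in_real[of "max b (T n)" t] b tn by auto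
      have "overdraft t \<le> overdraft q + L t - L q" using overdraft_step[of n q t] q n by simp
      moreover have "overdraft q \<le> paid_by_Two t" using paid_by_Two_ge[of q t] q T_nonneg[of n] by simp
      moreover have "L t - (overdraft t - paid_by_Two t) < L q" using b q by simp
      ultimately show False by simp
    qed
  qed
qed

text \<open>Once One is not overdrawn at \<open>s\<close>, later overdrafts can only come from dividends after \<open>s\<close>.  Across a
  restart the bound is inherited from the supremum \<open>paid_by_Two\<close> at that restart.\<close>

lemma overdraft_increment:
  assumes s: "0 \<le> s" "s \<le> q" shows "overdraft q \<le> paid_by_Two s + L q - L s"
proof -
  have "T n \<le> q \<Longrightarrow> q < T (Suc n) \<Longrightarrow> s \<le> q \<Longrightarrow> overdraft q \<le> paid_by_Two s + L q - L s" for n q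
  proof (induction n arbitrary: q rule: less_induct)
    case (less n)
    show ?case
    proof (cases "T n \<le> s")
      case True
      then show ?thesis using overdraft_step[of n s q] less.prems overdraft_le_paid_by_Two[OF s(1)] by simp
    next
      case False
      then have sT: "s < T n" by simp
      have "paid_by_Two (T n) \<le> paid_by_Two s + L (T n) - L s"
      proof (rule paid_by_Two_le)
        show "0 \<le> paid_by_Two s + L (T n) - L s" using paid_by_Two_nonneg[of s] L_mono[of s "T n"] s sT by simp
        fix r assume r: "0 \<le> r" "r < T n"
        show "overdraft r \<le> paid_by_Two s + L (T n) - L s"
        proof (cases "r < s")
          case True
          obtain b where b: "r < b" "b < s" using dense True by blast
          have "overdraft r \<le> paid_by_Two r" using overdraft_le_paid_by_Two r by simp
          also have "\<dots> \<le> paid_by_Two s" using paid_by_Two_mono True by simp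
          finally show ?thesis using L_mono[of s "T n"] s sT by simp
        next
          case False
          obtain m where m: "T m \<le> r" "r < T (Suc m)" using T_interval r by blast
          have "m < n" using m(1) r(2) T_strict_mono by (meson le_less_trans strict_mono_less)
          then have "overdraft r \<le> paid_by_Two s + L r - L s" using less.IH m False by simp
          then show ?thesis using L_mono[of r "T n"] r by simp
        qed
      qed
      moreover have "overdraft (T n) \<le> paid_by_Two (T n)" using overdraft_le_paid_by_Two T_nonneg by simp
      moreover have "overdraft q \<le> overdraft (T n) + L q - L (T n)" using overdraft_step[of n "T n" q] less.prems by simp
      ultimately show ?thesis by simp
    qed
  qed
  then show ?thesis using T_interval[of q] s by (metis order_trans)
qed

text \<open>Equivalently, \<open>L - paid_by_Two\<close> is non-decreasing.\<close>

lemma paid_by_Two_increment: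
  assumes "0 \<le> s" "s \<le> t" shows "paid_by_Two t - paid_by_Two s \<le> L t - L s"
proof -
  have "paid_by_Two t \<le> paid_by_Two s + L t - L s"
  proof (rule paid_by_Two_le)
    show "0 \<le> paid_by_Two s + L t - L s" using paid_by_Two_nonneg[of s] L_mono[of s t] assms by simp
    fix r assume r: "0 \<le> r" "r < t"
    show "overdraft r \<le> paid_by_Two s + L t - L s"
    proof (cases "r < s")
      case True
      then have "overdraft r \<le> paid_by_Two s" using overdraft_le_paid_by_Two[of r] paid_by_Two_mono[of r s] r by simp
      then show ?thesis using L_mono[of s t] assms by simp
    next
      case False
      then show ?thesis using overdraft_increment[of s r] assms L_mono[of r t] r by simp
    qed
  qed
  then show ?thesis by simp
qed

text \<open>Before ruin, a restart leaves One with at most the joint surplus, hence Two with at least 0.\<close>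

lemma paid_by_Two_upper_T:
  assumes "\<And>s. 0 \<le> s \<Longrightarrow> s \<le> T n \<Longrightarrow> L s \<le> X s + Y s"
  shows "paid_by_Two (T n) \<le> Y (T n) - D (T n)"
proof (cases n)
  case 0
  then show ?thesis using paid_by_Two_0 D_0 Y0 by simp
next
  case (Suc m)
  have "0 \<le> X (T n) + Y (T n) - L (T n)" using assms[of "T n"] T_nonneg by simp
  then show ?thesis using D_jump[of m] Suc by simp
qed

text \<open>Since \<open>L \<le> X + Y\<close>, each overdraft \<open>L - X - D\<close> is at most \<open>Y - D\<close>, the surplus of Two before dividends.
  The statement reaches up to the next restart \<open>t\<close>, with the transfers made before it, because it is
  also applied at the ruin time itself.\<close>

lemma paid_by_Two_upper_before:
  assumes L: "\<And>s. 0 \<le> s \<Longrightarrow> s < t \<Longrightarrow> L s \<le> X s + Y s"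
    and n: "T n < t" "t \<le> T (Suc n)" and Y: "\<And>s. T n \<le> s \<Longrightarrow> s < t \<Longrightarrow> Y s \<le> Y t"
  shows "paid_by_Two t \<le> Y t - D (T n)"
proof (rule paid_by_Two_le)
  have MT: "paid_by_Two (T n) \<le> Y (T n) - D (T n)" by (rule paid_by_Two_upper_T) (use L n in simp)
  have YT: "Y (T n) \<le> Y t" using Y n by simp
  show "0 \<le> Y t - D (T n)" using MT YT paid_by_Two_nonneg[of "T n"] by simp
  fix q assume q: "0 \<le> q" "q < t"
  show "overdraft q \<le> Y t - D (T n)"
  proof (cases "q < T n")
    case True
    then show ?thesis using overdraft_le_paid_by_Two[of q] paid_by_Two_mono[of q "T n"] q MT YT by simp
  next
    case False
    then have "D q = D (T n)" using D_const[of n q] q n by simp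
    then show ?thesis using Y[of q] L[of q] q False by (simp add: overdraft_def)
  qed
qed

lemma paid_by_Two_upper:
  assumes L: "\<And>s. 0 \<le> s \<Longrightarrow> s \<le> t \<Longrightarrow> L s \<le> X s + Y s" and t: "0 \<le> t"
  shows "paid_by_Two t \<le> Y t - D t"
proof -
  obtain n where n: "T n \<le> t" "t < T (Suc n)" using T_interval t by blast
  show ?thesis
  proof (cases "t = T n")
    case True
    then show ?thesis using paid_by_Two_upper_T[of n] L by simp
  next
    case False
    have "paid_by_Two t \<le> Y t - D (T n)"
    proof (rule paid_by_Two_upper_before)
      fix s assume s: "T n \<le> s" "s < t"
      then show "Y s \<le> Y t"
        using Y_mono[of s t] K_const[of n s] K_const[of n t] n T_nonneg[of n] by simp
    qed (use L n False in auto)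
    then show ?thesis using D_const n by simp
  qed
qed

text \<open>As long as the joint surplus is non-negative, moving the surplus of One into its admissible interval
  is the same as covering whichever deficit occurred.\<close>

lemma D_jump_transfer:
  assumes W: "0 \<le> X (T (Suc n)) + Y (T (Suc n)) - L (T (Suc n))"
  defines "u \<equiv> X (T (Suc n)) - L (T (Suc n)) + paid_by_Two (T (Suc n)) + D (T n)"
    and "w \<equiv> Y (T (Suc n)) - paid_by_Two (T (Suc n)) - D (T n)"
  shows "D (T (Suc n)) = D (T n) + max 0 (- u) - max 0 (- w)"
  using D_jump[of n] W unfolding u_def w_def by (auto simp: max_def min_def)

text \<open>Before ruin, a restart without a claim has no effect, since both surpluses are non-negative already
  when it arrives.\<close>

lemma D_no_jump:
  assumes K: "K (T (Suc n)) = K (T n)" and L: "\<And>s. 0 \<le> s \<Longrightarrow> s \<le> T (Suc n) \<Longrightarrow> L s \<le> X s + Y s"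
  shows "D (T (Suc n)) = D (T n)"
proof -
  let ?t = "T (Suc n)"
  have "paid_by_Two ?t \<le> Y ?t - D (T n)"
  proof (rule paid_by_Two_upper_before)
    fix s assume s: "T n \<le> s" "s < ?t"
    then show "Y s \<le> Y ?t"
      using Y_mono[of s ?t] K_const[of n s] K T_nonneg[of n] by simp
  qed (use L T_less in auto)
  moreover have "L ?t - X ?t - D (T n) \<le> paid_by_Two ?t"
  proof (rule ccontr)
    let ?overdraft = "L ?t - X ?t - D (T n)"
    assume "\<not> ?overdraft \<le> paid_by_Two ?t"
    then have "L ?t - (?overdraft - paid_by_Two ?t) < L ?t" by simp
    moreover have "(L \<longlongrightarrow> L ?t) (at_left ?t)"
      using L_left[of ?t] T_less[of n] T_nonneg[of n] by (simp add: continuous_within)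
    ultimately have "eventually (\<lambda>s. L ?t - (?overdraft - paid_by_Two ?t) < L s) (at_left ?t)"
      by (simp add: order_tendsto_iff)
    then obtain b where b: "b < ?t" "\<And>s. b < s \<Longrightarrow> s < ?t \<Longrightarrow> L ?t - (?overdraft - paid_by_Two ?t) < L s"
      unfolding eventually_at_left_field by blast
    define q where "q = (max b (T n) + ?t) / 2"
    have q: "max b (T n) < q" "q < ?t" unfolding q_def using b T_less[of n] by (auto simp: max_def)
    have q0: "0 \<le> q" using q T_nonneg[of n] by simp
    have "X q \<le> X ?t" using X_mono[of q ?t] K_const[of n q] q K q0 by simp
    moreover have "D q = D (T n)" using D_const[of n q] q by simp
    moreover have "L ?t - (?overdraft - paid_by_Two ?t) < L q" using b q by simp
    ultimately have "paid_by_Two ?t < overdraft q" by (simp add: overdraft_def)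
    also have "overdraft q \<le> paid_by_Two ?t" using overdraft_le_paid_by_Two[OF q0] paid_by_Two_mono[of q ?t] q by simp
    finally show False by simp
  qed
  moreover have "0 \<le> X ?t + Y ?t - L ?t" using L[of ?t] T_nonneg by simp
  ultimately show ?thesis using D_jump_transfer[of n] by simp
qed

end

section \<open>The prescribed transfers\<close>

text \<open>One step of the recursion \<open>received_after\<close>.\<close>

definition transfer_step :: "(company \<Rightarrow> real) \<Rightarrow> (company \<Rightarrow> real) \<Rightarrow> company \<Rightarrow> real" where
  "transfer_step r C =
     (let u = (\<lambda>k. r k + C k - C (other k))
      in if u One + u Two \<ge> 0 then (\<lambda>k. C k + max 0 (- u k)) else C)"

text \<open>After a step there is no deficit left, or the joint surplus is negative and nothing is transferred.\<close>

lemma transfer_step_idem: "transfer_step r (transfer_step r C) = transfer_step r C"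
proof
  fix k
  show "transfer_step r (transfer_step r C) k = transfer_step r C k"
    by (cases k) (auto simp: transfer_step_def Let_def max_def)
qed

lemma received_after_Suc:
  "received_after R T (Suc n) = transfer_step (\<lambda>k. R k (T (Suc n))) (received_after R T n)"
  by (simp add: transfer_step_def Let_def)

text \<open>Hence several claims arriving at the same time, which cannot be excluded for every outcome, act like
  a single one.\<close>

lemma received_after_simultaneous:
  assumes "n < m" "\<And>i. n < i \<Longrightarrow> i \<le> m \<Longrightarrow> T i = t"
  shows "received_after R T m = transfer_step (\<lambda>k. R k t) (received_after R T n)"
  using assms
proof (induction m)
  case (Suc m)
  show ?case
  proof (cases "n = m")
    case True
    then show ?thesis using Suc.prems by (simp only: received_after_Suc)
  next
    case False
    then have "received_after R T m = transfer_step (\<lambda>k. R k t) (received_after R T n)"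
      using Suc by simp
    then show ?thesis
      using Suc.prems by (simp only: received_after_Suc) (simp add: transfer_step_idem)
  qed
qed simp

lemma received_jump:
  assumes mono: "\<And>k. mono_on {0..} (\<lambda>t. N k t \<omega>)" and st: "0 \<le> s" "s < t"
    and const: "\<And>r. s \<le> r \<Longrightarrow> r < t \<Longrightarrow> N One r \<omega> + N Two r \<omega> = N One s \<omega> + N Two s \<omega>"
    and jump: "N One s \<omega> + N Two s \<omega> < N One t \<omega> + N Two t \<omega>"
  shows "(\<lambda>k. received S N L k t \<omega>) =
    transfer_step (\<lambda>k. S k t \<omega> - L k t \<omega>) (\<lambda>k. received S N L k s \<omega>)"
proof -
  let ?K = "\<lambda>t. N One t \<omega> + N Two t \<omega>"
  have K_mono: "?K r \<le> ?K r'" if "0 \<le> r" "r \<le> r'" for r r'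
    using mono[of One] mono[of Two] that by (auto simp: mono_on_def intro: add_mono)
  have "claim_time N \<omega> i = t" if i: "?K s < i" "i \<le> ?K t" for i
    unfolding claim_time_def
  proof (rule cInf_eq_minimum)
    show "t \<in> {t. 0 \<le> t \<and> i \<le> ?K t}" using st i by simp
    fix r assume r: "r \<in> {t. 0 \<le> t \<and> i \<le> ?K t}"
    show "t \<le> r"
    proof (rule ccontr)
      assume "\<not> t \<le> r"
      then have "?K r \<le> ?K s" using K_mono[of r s] const[of r] r by (cases "r \<le> s") auto
      then show False using r i by simp
    qed
  qed
  from received_after_simultaneous[OF jump this]
  show ?thesis unfolding received_def by simp
qed

context split_path
begin

text \<open>The two properties required of \<open>C\<close> are those of \<open>received\<close>.  At the ruin time itself the prescribed
  rule makes no transfer whereas \<open>D\<close> may jump, so there the value of \<open>D\<close> at the last restart before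
  ruin has to be taken.\<close>

lemma received_eq_D:
  fixes C :: "company \<Rightarrow> real \<Rightarrow> real"
  assumes C0: "\<And>k. C k 0 = 0"
    and const: "\<And>k s t. 0 \<le> s \<Longrightarrow> K s = K t \<Longrightarrow> C k s = C k t"
    and jump: "\<And>s t. 0 \<le> s \<Longrightarrow> s < t \<Longrightarrow> (\<And>r. s \<le> r \<Longrightarrow> r < t \<Longrightarrow> K r = K s) \<Longrightarrow> K s < K t \<Longrightarrow>
      (\<lambda>k. C k t) = transfer_step (case_company (X t - (L t - paid_by_Two t)) (Y t - paid_by_Two t)) (\<lambda>k. C k s)"
  shows "0 \<le> t \<Longrightarrow> (\<And>s. 0 \<le> s \<Longrightarrow> s \<le> t \<Longrightarrow> L s \<le> X s + Y s) \<Longrightarrow> C One t - C Two t = D t"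
    and "T n < t \<Longrightarrow> t \<le> T (Suc n) \<Longrightarrow> (\<And>s. 0 \<le> s \<Longrightarrow> s < t \<Longrightarrow> L s \<le> X s + Y s) \<Longrightarrow>
      X t + Y t < L t \<Longrightarrow> C One t - C Two t = D (T n)"
proof -
  have at_T: "C One (T n) - C Two (T n) = D (T n)"
    if "\<And>s. 0 \<le> s \<Longrightarrow> s \<le> T n \<Longrightarrow> L s \<le> X s + Y s" for n
    using that
  proof (induction n)
    case 0
    then show ?case using C0 D_0 by simp
  next
    case (Suc n)
    have IH: "C One (T n) - C Two (T n) = D (T n)"
      using Suc T_less[of n] by simp
    have W: "0 \<le> X (T (Suc n)) + Y (T (Suc n)) - L (T (Suc n))"
      using Suc.prems[of "T (Suc n)"] T_nonneg by simp
    have "K (T n) \<le> K (T (Suc n))" using K_mono T_nonneg T_less[of n] by simp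
    then consider "K (T (Suc n)) = K (T n)" | "K (T n) < K (T (Suc n))" by fastforce
    then show ?case
    proof cases
      case 1
      then show ?thesis
        using const[of "T n" "T (Suc n)"] T_nonneg[of n] IH D_no_jump[OF 1 Suc.prems] by simp
    next
      case 2
      have "(\<lambda>k. C k (T (Suc n))) = transfer_step (case_company (X (T (Suc n)) - (L (T (Suc n)) - paid_by_Two (T (Suc n))))
          (Y (T (Suc n)) - paid_by_Two (T (Suc n)))) (\<lambda>k. C k (T n))"
        by (rule jump[OF T_nonneg T_less K_const 2])
      then have "C k (T (Suc n)) = transfer_step (case_company (X (T (Suc n)) - (L (T (Suc n)) - paid_by_Two (T (Suc n))))
          (Y (T (Suc n)) - paid_by_Two (T (Suc n)))) (\<lambda>k. C k (T n)) k" for k by metis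
      then show ?thesis
        unfolding D_jump_transfer[OF W] using IH W
        by (simp add: transfer_step_def Let_def)
    qed
  qed
  show "C One t - C Two t = D t" if t: "0 \<le> t" and L: "\<And>s. 0 \<le> s \<Longrightarrow> s \<le> t \<Longrightarrow> L s \<le> X s + Y s"
  proof -
    obtain n where n: "T n \<le> t" "t < T (Suc n)" using T_interval t by blast
    then have "C k t = C k (T n)" for k using const[of "T n" t k] K_const[of n t] T_nonneg[of n] by simp
    then show ?thesis using at_T[of n] L n D_const[of n t] by simp
  qed
  show "C One t - C Two t = D (T n)"
    if n: "T n < t" "t \<le> T (Suc n)" and L: "\<And>s. 0 \<le> s \<Longrightarrow> s < t \<Longrightarrow> L s \<le> X s + Y s"
      and neg: "X t + Y t < L t"
  proof -
    have C_eq: "C One (T n) - C Two (T n) = D (T n)" using at_T[of n] L n by simp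
    have "K (T n) \<le> K t" using K_mono T_nonneg n(1) by simp
    then consider "K (T n) = K t" | "K (T n) < K t" by fastforce
    then show ?thesis
    proof cases
      case 1
      then show ?thesis using const[of "T n" t] T_nonneg[of n] C_eq by simp
    next
      case 2
      have "(\<lambda>k. C k t) = transfer_step (case_company (X t - (L t - paid_by_Two t)) (Y t - paid_by_Two t)) (\<lambda>k. C k (T n))"
        by (rule jump[OF T_nonneg n(1) K_const 2]) (use n in auto)
      also have "\<dots> = (\<lambda>k. C k (T n))"
        using neg by (simp add: transfer_step_def Let_def)
      finally have "C k t = C k (T n)" for k by metis
      then show ?thesis using C_eq by simp
    qed
  qed
qed

end

section \<open>Adapted and predictable processes\<close>

definition adapted :: "(real \<Rightarrow> 'a measure) \<Rightarrow> (real \<Rightarrow> 'a \<Rightarrow> real) \<Rightarrow> bool" where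
  "adapted G f \<longleftrightarrow> (\<forall>t\<ge>0. f t \<in> borel_measurable (G t))"

locale information =
  fixes G :: "real \<Rightarrow> 'a measure" and \<Omega> :: "'a set"
  assumes space_G: "0 \<le> t \<Longrightarrow> space (G t) = \<Omega>"
    and sets_mono: "0 \<le> s \<Longrightarrow> s \<le> t \<Longrightarrow> sets (G s) \<subseteq> sets (G t)"
begin

lemma measurable_later:
  "0 \<le> s \<Longrightarrow> s \<le> t \<Longrightarrow> f \<in> measurable (G s) B \<Longrightarrow> f \<in> measurable (G t) B"
  using sets_mono[of s t] space_G[of s] space_G[of t] by (auto simp: measurable_def)

lemma adaptedD: "adapted G f \<Longrightarrow> 0 \<le> s \<Longrightarrow> s \<le> t \<Longrightarrow> f s \<in> borel_measurable (G t)"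
  using measurable_later[of s t "f s" borel] by (auto simp: adapted_def)

end

lemma measurable_discretized:
  fixes f :: "real \<Rightarrow> 'a \<Rightarrow> real" and c :: "int \<Rightarrow> real"
  assumes f: "\<And>i. f (c i) \<in> borel_measurable H" and i: "i \<in> measurable H (count_space UNIV)"
  shows "(\<lambda>\<omega>. f (c (i \<omega>)) \<omega>) \<in> borel_measurable H"
  by (rule measurable_compose_countable[OF f i])

text \<open>The random time is rounded down to a grid, where the process is measurable by countably many cases,
  and the grid is refined.\<close>

lemma measurable_eval_left:
  fixes f :: "real \<Rightarrow> 'a \<Rightarrow> real"
  assumes f: "\<And>r. 0 \<le> r \<Longrightarrow> r \<le> t \<Longrightarrow> f r \<in> borel_measurable H" and t: "0 \<le> t"
    and th[measurable]: "\<theta> \<in> borel_measurable H"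
    and th_range: "\<And>\<omega>. \<omega> \<in> space H \<Longrightarrow> 0 \<le> \<theta> \<omega> \<and> \<theta> \<omega> \<le> t"
    and cont: "\<And>\<omega> r. \<omega> \<in> space H \<Longrightarrow> 0 < r \<Longrightarrow> continuous (at_left r) (\<lambda>s. f s \<omega>)"
  shows "(\<lambda>\<omega>. f (\<theta> \<omega>) \<omega>) \<in> borel_measurable H"
proof (rule borel_measurable_LIMSEQ_real)
  let ?c = "\<lambda>n \<omega>. max 0 (min t (real_of_int \<lfloor>\<theta> \<omega> * real (Suc n)\<rfloor> / real (Suc n)))"
  show "(\<lambda>\<omega>. f (?c n \<omega>) \<omega>) \<in> borel_measurable H" for n
    by (rule measurable_discretized[where i = "\<lambda>\<omega>. \<lfloor>\<theta> \<omega> * real (Suc n)\<rfloor>"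
          and c = "\<lambda>i. max 0 (min t (real_of_int i / real (Suc n)))"])
       (use f t in \<open>auto intro!: f\<close>)
  fix \<omega> assume w: "\<omega> \<in> space H"
  note r = th_range[OF w]
  let ?d = "\<lambda>n. real_of_int \<lfloor>\<theta> \<omega> * real (Suc n)\<rfloor> / real (Suc n)"
  have c: "?c n \<omega> = ?d n"
    and le: "?d n \<le> \<theta> \<omega>" and ge: "\<theta> \<omega> - 1 / real (Suc n) \<le> ?d n" for n
  proof -
    show le: "?d n \<le> \<theta> \<omega>" by (simp add: divide_le_eq)
    have "\<theta> \<omega> * real (Suc n) - 1 \<le> real_of_int \<lfloor>\<theta> \<omega> * real (Suc n)\<rfloor>" by linarith
    then have "(\<theta> \<omega> * real (Suc n) - 1) / real (Suc n) \<le> ?d n" by (rule divide_right_mono) simp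
    then show "\<theta> \<omega> - 1 / real (Suc n) \<le> ?d n" by (simp add: diff_divide_distrib)
    have "0 \<le> ?d n" using r by simp
    then show "?c n \<omega> = ?d n" using le r by simp
  qed
  have lim: "(\<lambda>n. ?c n \<omega>) \<longlonglongrightarrow> \<theta> \<omega>"
  proof (rule tendsto_sandwich[where f = "\<lambda>n. \<theta> \<omega> - 1 / real (Suc n)" and h = "\<lambda>_. \<theta> \<omega>"])
    show "(\<lambda>n. \<theta> \<omega> - 1 / real (Suc n)) \<longlonglongrightarrow> \<theta> \<omega>"
      using tendsto_diff[OF tendsto_const[of "\<theta> \<omega>"] LIMSEQ_inverse_real_of_nat] by (simp add: inverse_eq_divide)
  qed (use c le ge in simp_all)
  show "(\<lambda>n. f (?c n \<omega>) \<omega>) \<longlonglongrightarrow> f (\<theta> \<omega>) \<omega>"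
  proof (cases "\<theta> \<omega> = 0")
    case True
    then show ?thesis using t by simp
  next
    case False
    then have "continuous (at_left (\<theta> \<omega>)) (\<lambda>s. f s \<omega>)" using cont w r by simp
    then have "continuous (at (\<theta> \<omega>) within {..\<theta> \<omega>}) (\<lambda>s. f s \<omega>)"
      unfolding continuous_within at_within_Iic_at_left .
    moreover have "?c n \<omega> \<in> {..\<theta> \<omega>}" for n unfolding c atMost_iff by (rule le)
    ultimately show ?thesis using lim by (rule continuous_within_tendsto_compose')
  qed
qed

text \<open>The same with rounding up, cut off at \<open>t\<close> so as not to use later information.\<close>

lemma measurable_eval_right:
  fixes f :: "real \<Rightarrow> 'a \<Rightarrow> real"
  assumes f: "\<And>r. 0 \<le> r \<Longrightarrow> r \<le> t \<Longrightarrow> f r \<in> borel_measurable H" and t: "0 \<le> t"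
    and th[measurable]: "\<theta> \<in> borel_measurable H"
    and th_range: "\<And>\<omega>. \<omega> \<in> space H \<Longrightarrow> 0 \<le> \<theta> \<omega> \<and> \<theta> \<omega> \<le> t"
    and cont: "\<And>\<omega> r. \<omega> \<in> space H \<Longrightarrow> 0 \<le> r \<Longrightarrow> continuous (at_right r) (\<lambda>s. f s \<omega>)"
  shows "(\<lambda>\<omega>. f (\<theta> \<omega>) \<omega>) \<in> borel_measurable H"
proof (rule borel_measurable_LIMSEQ_real)
  let ?c = "\<lambda>n \<omega>. max 0 (min t (real_of_int \<lceil>\<theta> \<omega> * real (Suc n)\<rceil> / real (Suc n)))"
  show "(\<lambda>\<omega>. f (?c n \<omega>) \<omega>) \<in> borel_measurable H" for n
    by (rule measurable_discretized[where i = "\<lambda>\<omega>. \<lceil>\<theta> \<omega> * real (Suc n)\<rceil>"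
          and c = "\<lambda>i. max 0 (min t (real_of_int i / real (Suc n)))"])
       (use f t in \<open>auto intro!: f\<close>)
  fix \<omega> assume w: "\<omega> \<in> space H"
  note r = th_range[OF w]
  have ge: "\<theta> \<omega> \<le> ?c n \<omega>" and le: "?c n \<omega> \<le> \<theta> \<omega> + 1 / real (Suc n)" for n
  proof -
    let ?d = "real_of_int \<lceil>\<theta> \<omega> * real (Suc n)\<rceil> / real (Suc n)"
    have ge: "\<theta> \<omega> \<le> ?d" by (simp add: le_divide_eq)
    have "real_of_int \<lceil>\<theta> \<omega> * real (Suc n)\<rceil> \<le> \<theta> \<omega> * real (Suc n) + 1" by linarith
    then have "?d \<le> (\<theta> \<omega> * real (Suc n) + 1) / real (Suc n)" by (rule divide_right_mono) simp
    then have "?d \<le> \<theta> \<omega> + 1 / real (Suc n)" by (simp add: add_divide_distrib)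
    moreover have "0 \<le> \<theta> \<omega> + 1 / real (Suc n)" using r by simp
    ultimately show "?c n \<omega> \<le> \<theta> \<omega> + 1 / real (Suc n)" by (meson max.bounded_iff min.cobounded2 order_trans)
    show "\<theta> \<omega> \<le> ?c n \<omega>" using ge r by auto
  qed
  have lim: "(\<lambda>n. ?c n \<omega>) \<longlonglongrightarrow> \<theta> \<omega>"
  proof (rule tendsto_sandwich[where h = "\<lambda>n. \<theta> \<omega> + 1 / real (Suc n)" and f = "\<lambda>_. \<theta> \<omega>"])
    show "(\<lambda>n. \<theta> \<omega> + 1 / real (Suc n)) \<longlonglongrightarrow> \<theta> \<omega>"
      using tendsto_add[OF tendsto_const[of "\<theta> \<omega>"] LIMSEQ_inverse_real_of_nat] by (simp add: inverse_eq_divide)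
  qed (use le ge in simp_all)
  have "continuous (at_right (\<theta> \<omega>)) (\<lambda>s. f s \<omega>)" using cont w r by simp
  then have "continuous (at (\<theta> \<omega>) within {\<theta> \<omega>..}) (\<lambda>s. f s \<omega>)"
    unfolding continuous_within at_within_Ici_at_right .
  from continuous_within_tendsto_compose'[OF this _ lim]
  show "(\<lambda>n. f (?c n \<omega>) \<omega>) \<longlonglongrightarrow> f (\<theta> \<omega>) \<omega>" using ge by simp
qed

text \<open>The section at a fixed time of each generating rectangle belongs to the information at that time.\<close>

lemma (in information) adapted_if_predictable:
  assumes "predictable M G L" and sp: "space M = \<Omega>"
  shows "adapted G L"
  unfolding adapted_def
proof (intro allI impI)
  fix t :: real assume t: "0 \<le> t"
  have "(\<lambda>\<omega>. (t, \<omega>)) \<in> measurable (G t) (predictable_algebra M G)"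
    unfolding predictable_algebra_def
  proof (rule measurable_measure_of)
    have sub: "A \<subseteq> \<Omega>" if "A \<in> sets (G s)" "0 \<le> s" for A s
      using sets.sets_into_space[OF that(1)] space_G[OF that(2)] by simp
    show "{{0} \<times> A |A. A \<in> sets (G 0)} \<union> {{s<..t} \<times> A |s t A. 0 \<le> s \<and> s \<le> t \<and> A \<in> sets (G s)}
      \<subseteq> Pow ({0..} \<times> space M)"
      using sub sp by fastforce
    show "Pair t \<in> space (G t) \<rightarrow> {0..} \<times> space M" using t sp space_G by auto
    fix E assume "E \<in> {{0} \<times> A |A. A \<in> sets (G 0)} \<union> {{s<..t} \<times> A |s t A. 0 \<le> s \<and> s \<le> t \<and> A \<in> sets (G s)}"
    then consider A where "E = {0} \<times> A" "A \<in> sets (G 0)"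
      | s u A where "E = {s<..u} \<times> A" "0 \<le> s" "A \<in> sets (G s)" by auto
    then show "Pair t -` E \<inter> space (G t) \<in> sets (G t)"
    proof cases
      case 1
      then have "Pair t -` E \<inter> space (G t) = (if t = 0 then A \<inter> space (G t) else {})" by auto
      then show ?thesis using 1 by auto
    next
      case 2
      show ?thesis
      proof (cases "s < t \<and> t \<le> u")
        case True
        then have "Pair t -` E \<inter> space (G t) = A \<inter> space (G t)" using 2 by auto
        then show ?thesis using sets_mono[of s t] 2 True by auto
      next
        case False
        then have "Pair t -` E \<inter> space (G t) = {}" using 2 by auto
        then show ?thesis by simp
      qed
    qed
  qed
  from measurable_compose[OF this assms(1)[unfolded predictable_def]]
  show "L t \<in> borel_measurable (G t)" by simp
qed

text \<open>The approximating processes are constant on cells \<open>(i/m, (i+1)/m]\<close>, with the value at the left end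
  point, which is known when the cell begins; their level sets are unions of generating rectangles.\<close>

lemma (in information) predictable_if_left_continuous:
  assumes ad: "adapted G L" and sp: "space M = \<Omega>"
    and cont: "\<And>\<omega> t. \<omega> \<in> \<Omega> \<Longrightarrow> 0 < t \<Longrightarrow> continuous (at_left t) (\<lambda>s. L s \<omega>)"
  shows "predictable M G L"
  unfolding predictable_def
proof (rule borel_measurable_LIMSEQ_real)
  let ?P = "predictable_algebra M G"
  let ?E = "{{0} \<times> A |A. A \<in> sets (G 0)} \<union> {{s<..t} \<times> A |s t A. 0 \<le> s \<and> s \<le> t \<and> A \<in> sets (G s)}"
  have sub: "A \<subseteq> \<Omega>" if "A \<in> sets (G s)" "0 \<le> s" for A s
    using sets.sets_into_space[OF that(1)] space_G[OF that(2)] by simp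
  have E: "?E \<subseteq> Pow ({0..} \<times> space M)" using sub sp by fastforce
  have spP: "space ?P = {0..} \<times> \<Omega>"
    unfolding predictable_algebra_def using E sp by (simp add: space_measure_of)
  have inP: "B \<in> sets ?P" if "B \<in> ?E" for B
    unfolding predictable_algebra_def by (rule in_measure_of[OF E that])
  let ?c = "\<lambda>n t. max 0 (real_of_int (\<lceil>t * real (Suc n)\<rceil> - 1) / real (Suc n))"
  show "(\<lambda>(t, \<omega>). L (?c n t) \<omega>) \<in> borel_measurable ?P" for n
  proof (rule measurableI)
    fix B :: "real set" assume B: "B \<in> sets borel"
    let ?m = "real (Suc n)"
    let ?cell = "\<lambda>i::nat. {real i / ?m<..real (Suc i) / ?m} \<times> (L (real i / ?m) -` B \<inter> \<Omega>)"
    have cell: "?c n t = real i / ?m" if "real i / ?m < t" "t \<le> real (Suc i) / ?m" for t i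
    proof -
      have "real i < t * ?m" "t * ?m \<le> real i + 1"
        using that by (simp_all add: field_simps)
      then have "\<lceil>t * ?m\<rceil> = int i + 1" by linarith
      then show ?thesis by simp
    qed
    have eq: "(\<lambda>(t, \<omega>). L (?c n t) \<omega>) -` B \<inter> space ?P =
      {0} \<times> (L 0 -` B \<inter> \<Omega>) \<union> (\<Union>i. ?cell i)" (is "?l = ?r")
    proof (intro equalityI subsetI)
      fix z assume "z \<in> ?l"
      then obtain t \<omega> where z: "z = (t, \<omega>)" and t: "0 \<le> t" "\<omega> \<in> \<Omega>" "L (?c n t) \<omega> \<in> B"
        using spP by auto
      show "z \<in> ?r"
      proof (cases "t = 0")
        case True
        then show ?thesis using t z by (simp add: max_def)
      next
        case False
        then have "0 < t * ?m" using t by simp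
        then have c1: "1 \<le> \<lceil>t * ?m\<rceil>" by linarith
        define i where "i = nat (\<lceil>t * ?m\<rceil> - 1)"
        have "real i < t * ?m" "t * ?m \<le> real (Suc i)" using c1 unfolding i_def by linarith+
        then have i: "real i / ?m < t" "t \<le> real (Suc i) / ?m"
          by (simp_all only: divide_less_eq le_divide_eq) simp_all
        then have "(t, \<omega>) \<in> ?cell i" using t cell[OF i] by simp
        then show ?thesis unfolding z by blast
      qed
    next
      fix z assume "z \<in> ?r"
      then consider \<omega> where "z = (0, \<omega>)" "\<omega> \<in> \<Omega>" "L 0 \<omega> \<in> B"
        | i t \<omega> where "z = (t, \<omega>)" "real i / ?m < t" "t \<le> real (Suc i) / ?m" "\<omega> \<in> \<Omega>" "L (real i / ?m) \<omega> \<in> B"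
        by fastforce
      then show "z \<in> ?l"
      proof cases
        case 1
        then show ?thesis using spP by (simp add: max_def)
      next
        case 2
        have "0 \<le> real i / ?m" by simp
        then have "0 \<le> t" using 2(2) by linarith
        then show ?thesis using 2 spP cell[OF 2(2,3)] by simp
      qed
    qed
    have "{0} \<times> (L 0 -` B \<inter> \<Omega>) \<in> sets ?P"
      using ad measurable_sets[OF _ B, of "L 0" "G 0"] space_G[of 0]
      by (intro inP) (auto simp: adapted_def)
    moreover have "?cell i \<in> sets ?P" for i
    proof (rule inP, rule UnI2)
      have "L (real i / ?m) -` B \<inter> \<Omega> \<in> sets (G (real i / ?m))"
        using ad measurable_sets[OF _ B, of "L (real i / ?m)" "G (real i / ?m)"] space_G[of "real i / ?m"]
        by (simp add: adapted_def)
      then show "?cell i \<in> {{s<..t} \<times> A |s t A. 0 \<le> s \<and> s \<le> t \<and> A \<in> sets (G s)}"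
        by (intro CollectI exI[of _ "real i / ?m"] exI[of _ "real (Suc i) / ?m"] exI[of _ "L (real i / ?m) -` B \<inter> \<Omega>"])
           (simp add: divide_right_mono)
    qed
    ultimately show "(\<lambda>(t, \<omega>). L (?c n t) \<omega>) -` B \<inter> space ?P \<in> sets ?P"
      unfolding eq by auto
  qed simp
  fix z assume "z \<in> space ?P"
  then obtain t \<omega> where z: "z = (t, \<omega>)" and t: "0 \<le> t" and w: "\<omega> \<in> \<Omega>" using spP by auto
  show "(\<lambda>n. case z of (t, \<omega>) \<Rightarrow> L (?c n t) \<omega>) \<longlonglongrightarrow> (case z of (t, \<omega>) \<Rightarrow> L t \<omega>)"
  proof (cases "t = 0")
    case True
    then show ?thesis by (simp add: z max_def)
  next
    case False
    with t have t0: "0 < t" by simp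
    have le: "?c n t \<le> t" and ge: "t - 1 / real (Suc n) \<le> ?c n t" for n
    proof -
      let ?d = "real_of_int (\<lceil>t * real (Suc n)\<rceil> - 1) / real (Suc n)"
      have "real_of_int (\<lceil>t * real (Suc n)\<rceil> - 1) \<le> t * real (Suc n)" by linarith
      then have "?d \<le> t" by (simp add: divide_le_eq)
      then show "?c n t \<le> t" using t by simp
      have "t * real (Suc n) - 1 \<le> real_of_int (\<lceil>t * real (Suc n)\<rceil> - 1)" by linarith
      then have "(t * real (Suc n) - 1) / real (Suc n) \<le> ?d" by (rule divide_right_mono) simp
      then have "t - 1 / real (Suc n) \<le> ?d" by (simp add: diff_divide_distrib)
      then show "t - 1 / real (Suc n) \<le> ?c n t" by simp
    qed
    have lim: "(\<lambda>n. ?c n t) \<longlonglongrightarrow> t"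
    proof (rule tendsto_sandwich[where f = "\<lambda>n. t - 1 / real (Suc n)" and h = "\<lambda>_. t"])
      show "(\<lambda>n. t - 1 / real (Suc n)) \<longlonglongrightarrow> t"
        using tendsto_diff[OF tendsto_const[of t] LIMSEQ_inverse_real_of_nat] by (simp add: inverse_eq_divide)
    qed (use le ge in simp_all)
    have "continuous (at_left t) (\<lambda>s. L s \<omega>)" using cont w t0 by simp
    then have "continuous (at t within {..t}) (\<lambda>s. L s \<omega>)"
      unfolding continuous_within at_within_Iic_at_left .
    from continuous_within_tendsto_compose'[OF this _ lim] show ?thesis using le z by simp
  qed
qed

section \<open>The split is adapted\<close>

lemma (in split_path) Dn_const: "T n \<le> t \<Longrightarrow> Dn n t = Dn n (T n)"
  by (cases n) (auto simp: Let_def)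

locale adapted_split = information G \<Omega> for G :: "real \<Rightarrow> 'a measure" and \<Omega> :: "'a set" +
  fixes X Y L A :: "real \<Rightarrow> 'a \<Rightarrow> real" and K :: "real \<Rightarrow> 'a \<Rightarrow> nat"
  assumes adapted: "adapted G X" "adapted G Y" "adapted G L" "adapted G A"
    and right_cont: "\<And>\<omega> t. \<omega> \<in> \<Omega> \<Longrightarrow> 0 \<le> t \<Longrightarrow> continuous (at_right t) (\<lambda>s. X s \<omega>)"
      "\<And>\<omega> t. \<omega> \<in> \<Omega> \<Longrightarrow> 0 \<le> t \<Longrightarrow> continuous (at_right t) (\<lambda>s. Y s \<omega>)"
      "\<And>\<omega> t. \<omega> \<in> \<Omega> \<Longrightarrow> 0 \<le> t \<Longrightarrow> continuous (at_right t) (\<lambda>s. A s \<omega>)"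
    and path: "\<And>\<omega>. \<omega> \<in> \<Omega> \<Longrightarrow> split_path (\<lambda>t. A t \<omega>) (\<lambda>t. K t \<omega>) (\<lambda>t. X t \<omega>) (\<lambda>t. Y t \<omega>) (\<lambda>t. L t \<omega>)"
begin

definition T where "T n \<omega> = restart (\<lambda>t. A t \<omega>) n"
definition Dn where "Dn n t \<omega> = transfers (\<lambda>t. X t \<omega>) (\<lambda>t. Y t \<omega>) (\<lambda>t. L t \<omega>) (\<lambda>n. T n \<omega>) n t"
definition Dt where "Dt t \<omega> = net_transfer (\<lambda>t. X t \<omega>) (\<lambda>t. Y t \<omega>) (\<lambda>t. L t \<omega>) (\<lambda>n. T n \<omega>) t"
definition paid_by_second where
  "paid_by_second t \<omega> = second_pays (\<lambda>t. X t \<omega>) (\<lambda>t. L t \<omega>) (\<lambda>t. Dt t \<omega>) t"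

lemma measurable_T_min:
  assumes T: "\<And>t. 0 \<le> t \<Longrightarrow> {\<omega>\<in>\<Omega>. T n \<omega> \<le> t} \<in> sets (G t)" and t: "0 \<le> t"
  shows "(\<lambda>\<omega>. min (T n \<omega>) t) \<in> borel_measurable (G t)"
proof (rule borel_measurableI_le)
  fix a
  have T0: "0 \<le> T n \<omega>" if "\<omega> \<in> \<Omega>" for \<omega>
  proof -
    interpret p: split_path "\<lambda>t. A t \<omega>" "\<lambda>t. K t \<omega>" "\<lambda>t. X t \<omega>" "\<lambda>t. Y t \<omega>" "\<lambda>t. L t \<omega>" by (rule path[OF that])
    show ?thesis unfolding T_def by (rule p.T_nonneg)
  qed
  consider "t \<le> a" | "a < 0" | "0 \<le> a" "a < t" by linarith
  then show "{\<omega> \<in> space (G t). min (T n \<omega>) t \<le> a} \<in> sets (G t)"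
  proof cases
    case 1
    then have "{\<omega> \<in> space (G t). min (T n \<omega>) t \<le> a} = space (G t)" by auto
    then show ?thesis by simp
  next
    case 2
    have "0 \<le> min (T n \<omega>) t" if "\<omega> \<in> space (G t)" for \<omega> using T0[of \<omega>] that t space_G[OF t] by simp
    with 2 have "{\<omega> \<in> space (G t). min (T n \<omega>) t \<le> a} = {}" by fastforce
    then show ?thesis by (metis sets.empty_sets)
  next
    case 3
    then have "{\<omega> \<in> space (G t). min (T n \<omega>) t \<le> a} = {\<omega>\<in>\<Omega>. T n \<omega> \<le> a}" using space_G[OF t] by auto
    then show ?thesis using T[of a] sets_mono[of a t] 3 by auto
  qed
qed

text \<open>Whether the next restart has happened by \<open>t\<close> can be read off from \<open>A\<close> at \<open>t\<close> and at the previous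
  restart; truncating that restart at \<open>t\<close> allows to evaluate \<open>A\<close> there with the information at \<open>t\<close>.\<close>

lemma T_stopping:
  "0 \<le> t \<Longrightarrow> {\<omega>\<in>\<Omega>. T n \<omega> \<le> t} \<in> sets (G t)"
proof (induction n arbitrary: t)
  case 0
  then have "{\<omega>\<in>\<Omega>. T 0 \<omega> \<le> t} = space (G t)" using space_G by (auto simp: T_def)
  then show ?case by simp
next
  case (Suc n)
  note t = \<open>0 \<le> t\<close>
  have [measurable]: "(\<lambda>\<omega>. min (T n \<omega>) t) \<in> borel_measurable (G t)"
    by (rule measurable_T_min[OF Suc.IH t])
  have T0: "0 \<le> T n \<omega>" "T n \<omega> < T (Suc n) \<omega>"
    "T n \<omega> \<le> t \<Longrightarrow> T (Suc n) \<omega> \<le> t \<longleftrightarrow> T n \<omega> + 1 \<le> t \<or> A (T n \<omega>) \<omega> < A t \<omega>" if "\<omega> \<in> \<Omega>" for \<omega>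
  proof -
    interpret p: split_path "\<lambda>t. A t \<omega>" "\<lambda>t. K t \<omega>" "\<lambda>t. X t \<omega>" "\<lambda>t. Y t \<omega>" "\<lambda>t. L t \<omega>" by (rule path[OF that])
    show "0 \<le> T n \<omega>" "T n \<omega> < T (Suc n) \<omega>"
      "T n \<omega> \<le> t \<Longrightarrow> T (Suc n) \<omega> \<le> t \<longleftrightarrow> T n \<omega> + 1 \<le> t \<or> A (T n \<omega>) \<omega> < A t \<omega>"
      unfolding T_def by (rule p.T_nonneg p.T_less p.T_Suc_iff | assumption)+
  qed
  have [measurable]: "(\<lambda>\<omega>. A (min (T n \<omega>) t) \<omega>) \<in> borel_measurable (G t)"
  proof (rule measurable_eval_right[where f = A and t = t])
    show "A r \<in> borel_measurable (G t)" if "0 \<le> r" "r \<le> t" for r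
      using adaptedD[OF adapted(4) that] .
    show "0 \<le> min (T n \<omega>) t \<and> min (T n \<omega>) t \<le> t" if "\<omega> \<in> space (G t)" for \<omega>
      using T0(1)[of \<omega>] that t space_G[OF t] by simp
    show "continuous (at_right r) (\<lambda>s. A s \<omega>)" if "\<omega> \<in> space (G t)" "0 \<le> r" for \<omega> r
      using right_cont(3) that space_G[OF t] by simp
  qed (use t in simp_all)
  have [measurable]: "A t \<in> borel_measurable (G t)" by (rule adaptedD[OF adapted(4) t order_refl])
  have [measurable]: "{\<omega>\<in>\<Omega>. T n \<omega> \<le> t} \<in> sets (G t)" by (rule Suc.IH[OF t])
  have "{\<omega>\<in>\<Omega>. T (Suc n) \<omega> \<le> t} = {\<omega>\<in>\<Omega>. T n \<omega> \<le> t} \<inter>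
      ({\<omega>\<in>space (G t). min (T n \<omega>) t + 1 \<le> t} \<union> {\<omega>\<in>space (G t). A (min (T n \<omega>) t) \<omega> < A t \<omega>})"
  proof (rule set_eqI)
    fix \<omega>
    show "\<omega> \<in> {\<omega>\<in>\<Omega>. T (Suc n) \<omega> \<le> t} \<longleftrightarrow> \<omega> \<in> {\<omega>\<in>\<Omega>. T n \<omega> \<le> t} \<inter>
      ({\<omega>\<in>space (G t). min (T n \<omega>) t + 1 \<le> t} \<union> {\<omega>\<in>space (G t). A (min (T n \<omega>) t) \<omega> < A t \<omega>})"
    proof (cases "\<omega> \<in> \<Omega> \<and> T n \<omega> \<le> t")
      case True
      then have "min (T n \<omega>) t = T n \<omega>" by simp
      then show ?thesis using T0(3)[of \<omega>] True space_G[OF t] by simp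
    next
      case False
      then show ?thesis using T0(2)[of \<omega>] by auto
    qed
  qed
  also have "\<dots> \<in> sets (G t)" by measurable
  finally show ?case .
qed

lemmas measurable_min_T = measurable_T_min[OF T_stopping]

text \<open>Boundedness of the supremum is known only for the true transfers, hence the assumption that \<open>f\<close> agrees
  with them before \<open>\<theta>\<close>.\<close>

lemma measurable_second_pays:
  assumes t: "0 \<le> t" and f: "\<And>q. 0 \<le> q \<Longrightarrow> q \<le> t \<Longrightarrow> f q \<in> borel_measurable (G q)"
    and th[measurable]: "\<theta> \<in> borel_measurable (G t)" and th_le: "\<And>\<omega>. \<omega> \<in> \<Omega> \<Longrightarrow> \<theta> \<omega> \<le> t"
    and eq: "\<And>\<omega> q. \<omega> \<in> \<Omega> \<Longrightarrow> 0 \<le> q \<Longrightarrow> q < \<theta> \<omega> \<Longrightarrow> f q \<omega> = Dt q \<omega>"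
  shows "(\<lambda>\<omega>. second_pays (\<lambda>t. X t \<omega>) (\<lambda>t. L t \<omega>) (\<lambda>t. f t \<omega>) (\<theta> \<omega>)) \<in> borel_measurable (G t)"
  unfolding second_pays_def
proof (rule borel_measurable_cSUP)
  show "countable (\<rat> \<inter> {0..} :: real set)" using countable_rat by blast
  fix q :: real assume q: "q \<in> \<rat> \<inter> {0..}"
  show "(\<lambda>\<omega>. if q < \<theta> \<omega> then max 0 (L q \<omega> - X q \<omega> - f q \<omega>) else 0) \<in> borel_measurable (G t)"
  proof (cases "q \<le> t")
    case True
    with q have [measurable]: "L q \<in> borel_measurable (G t)" "X q \<in> borel_measurable (G t)" "f q \<in> borel_measurable (G t)"
      using adaptedD[OF adapted(3)] adaptedD[OF adapted(1)] measurable_later[OF _ True f] by auto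
    show ?thesis by measurable
  next
    case False
    then have "(if q < \<theta> \<omega> then max 0 (L q \<omega> - X q \<omega> - f q \<omega>) else 0) = 0" if "\<omega> \<in> space (G t)" for \<omega>
      using th_le[of \<omega>] that space_G[OF t] by auto
    then show ?thesis by (subst measurable_cong[where g = "\<lambda>_. 0"]) auto
  qed
next
  fix \<omega> assume w: "\<omega> \<in> space (G t)"
  then have w: "\<omega> \<in> \<Omega>" using space_G t by simp
  interpret p: split_path "\<lambda>t. A t \<omega>" "\<lambda>t. K t \<omega>" "\<lambda>t. X t \<omega>" "\<lambda>t. Y t \<omega>" "\<lambda>t. L t \<omega>" by (rule path[OF w])
  have "(\<lambda>q. if q < \<theta> \<omega> then max 0 (L q \<omega> - X q \<omega> - f q \<omega>) else 0) ` (\<rat> \<inter> {0..}) =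
      (\<lambda>q. if q < \<theta> \<omega> then max 0 (p.overdraft q) else 0) ` (\<rat> \<inter> {0..})"
    using eq[OF w] by (intro image_cong) (auto simp: p.overdraft_def p.D_def Dt_def T_def)
  then show "bdd_above ((\<lambda>q. if q < \<theta> \<omega> then max 0 (L q \<omega> - X q \<omega> - f q \<omega>) else 0) ` (\<rat> \<inter> {0..}))"
    using p.paid_by_Two_bdd by simp
qed

lemma Dn_eq_Dt:
  assumes "\<omega> \<in> \<Omega>" "q < T (Suc n) \<omega>" shows "Dn n q \<omega> = Dt q \<omega>"
proof -
  interpret p: split_path "\<lambda>t. A t \<omega>" "\<lambda>t. K t \<omega>" "\<lambda>t. X t \<omega>" "\<lambda>t. Y t \<omega>" "\<lambda>t. L t \<omega>" by (rule path[OF assms(1)])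
  show ?thesis using p.D_eq_Dn[of q n] assms(2) by (simp add: Dn_def Dt_def p.D_def T_def)
qed

text \<open>On the event that restart \<open>n + 1\<close> has happened by \<open>t\<close>, all quantities at this restart are evaluated at
  its minimum \<open>\<theta>\<close> with \<open>t\<close>.\<close>

lemma Dn_adapted: "adapted G (Dn n)"
proof (induction n)
  case 0
  then show ?case by (simp add: adapted_def Dn_def)
next
  case (Suc n)
  show ?case
    unfolding adapted_def
  proof (intro allI impI)
    fix t :: real assume t: "0 \<le> t"
    define \<theta> where "\<theta> \<omega> = min (T (Suc n) \<omega>) t" for \<omega>
    have th[measurable]: "\<theta> \<in> borel_measurable (G t)"
      unfolding \<theta>_def by (rule measurable_min_T[OF _ t])
    have T0: "0 \<le> T (Suc n) \<omega>" "T n \<omega> < T (Suc n) \<omega>" if "\<omega> \<in> \<Omega>" for \<omega>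
    proof -
      interpret p: split_path "\<lambda>t. A t \<omega>" "\<lambda>t. K t \<omega>" "\<lambda>t. X t \<omega>" "\<lambda>t. Y t \<omega>" "\<lambda>t. L t \<omega>" by (rule path[OF that])
      show "0 \<le> T (Suc n) \<omega>" "T n \<omega> < T (Suc n) \<omega>" unfolding T_def by (rule p.T_nonneg p.T_less)+
    qed
    have thr: "0 \<le> \<theta> \<omega> \<and> \<theta> \<omega> \<le> t" if "\<omega> \<in> space (G t)" for \<omega>
      using T0[of \<omega>] that t space_G by (simp add: \<theta>_def)
    have [measurable]: "(\<lambda>\<omega>. X (\<theta> \<omega>) \<omega>) \<in> borel_measurable (G t)" "(\<lambda>\<omega>. Y (\<theta> \<omega>) \<omega>) \<in> borel_measurable (G t)"
      by (rule measurable_eval_right[where t = t, OF adaptedD[OF adapted(1)] t th thr];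
          simp add: space_G[OF t] right_cont)
         (rule measurable_eval_right[where t = t, OF adaptedD[OF adapted(2)] t th thr];
          simp add: space_G[OF t] right_cont)
    have Lc: "continuous (at_left r) (\<lambda>s. L s \<omega>)" if "\<omega> \<in> \<Omega>" "0 < r" for \<omega> r
    proof -
      interpret p: split_path "\<lambda>t. A t \<omega>" "\<lambda>t. K t \<omega>" "\<lambda>t. X t \<omega>" "\<lambda>t. Y t \<omega>" "\<lambda>t. L t \<omega>" by (rule path[OF that(1)])
      show ?thesis using p.L_left that by simp
    qed
    have [measurable]: "(\<lambda>\<omega>. L (\<theta> \<omega>) \<omega>) \<in> borel_measurable (G t)"
      by (rule measurable_eval_left[where t = t, OF adaptedD[OF adapted(3)] t th thr];
          simp add: space_G[OF t] Lc)
    have [measurable]: "(\<lambda>\<omega>. second_pays (\<lambda>t. X t \<omega>) (\<lambda>t. L t \<omega>) (\<lambda>t. Dn n t \<omega>) (\<theta> \<omega>)) \<in> borel_measurable (G t)"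
      by (rule measurable_second_pays[OF t _ th]) (use Suc thr space_G t Dn_eq_Dt in \<open>auto simp: adapted_def \<theta>_def\<close>)
    have [measurable]: "Dn n t \<in> borel_measurable (G t)" using Suc t by (simp add: adapted_def)
    have [measurable]: "Measurable.pred (G t) (\<lambda>\<omega>. T (Suc n) \<omega> \<le> t)"
      using T_stopping[OF t, of "Suc n"] space_G[OF t] by (simp add: pred_def)
    define v where "v \<omega> = X (\<theta> \<omega>) \<omega> - L (\<theta> \<omega>) \<omega> +
        second_pays (\<lambda>t. X t \<omega>) (\<lambda>t. L t \<omega>) (\<lambda>t. Dn n t \<omega>) (\<theta> \<omega>)" for \<omega>
    have [measurable]: "v \<in> borel_measurable (G t)" unfolding v_def by measurable
    have eq: "Dn (Suc n) t \<omega> = (if T (Suc n) \<omega> \<le> t then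
         max 0 (min (v \<omega> + Dn n t \<omega>) (X (\<theta> \<omega>) \<omega> + Y (\<theta> \<omega>) \<omega> - L (\<theta> \<omega>) \<omega>)) - v \<omega>
         else Dn n t \<omega>)" if "\<omega> \<in> space (G t)" for \<omega>
    proof -
      have w: "\<omega> \<in> \<Omega>" using that space_G t by simp
      interpret p: split_path "\<lambda>t. A t \<omega>" "\<lambda>t. K t \<omega>" "\<lambda>t. X t \<omega>" "\<lambda>t. Y t \<omega>" "\<lambda>t. L t \<omega>" by (rule path[OF w])
      show ?thesis
      proof (cases "T (Suc n) \<omega> \<le> t")
        case True
        then have "Dn n t \<omega> = Dn n (T n \<omega>) \<omega>"
          using p.Dn_const[of n t] T0(2)[OF w] by (simp add: Dn_def T_def)
        then show ?thesis using True by (simp add: Dn_def Let_def \<theta>_def v_def)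
      qed (simp add: Dn_def)
    qed
    show "Dn (Suc n) t \<in> borel_measurable (G t)"
      by (subst measurable_cong[OF eq]) measurable
  qed
qed

lemma Dt_adapted: "adapted G Dt"
  unfolding adapted_def
proof (intro allI impI)
  fix t :: real assume t: "0 \<le> t"
  have [measurable]: "Dn n t \<in> borel_measurable (G t)" for n using Dn_adapted[of n] t by (simp add: adapted_def)
  have "Dt t = (\<lambda>\<omega>. lim (\<lambda>n. Dn n t \<omega>))" by (simp add: Dt_def net_transfer_def Dn_def fun_eq_iff)
  then show "Dt t \<in> borel_measurable (G t)" by simp
qed

lemma paid_by_second_adapted: "adapted G paid_by_second"
  unfolding adapted_def
proof (intro allI impI)
  fix t :: real assume t: "0 \<le> t"
  have "(\<lambda>\<omega>. second_pays (\<lambda>t. X t \<omega>) (\<lambda>t. L t \<omega>) (\<lambda>t. Dt t \<omega>) t) \<in> borel_measurable (G t)"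
    by (rule measurable_second_pays[OF t]) (use Dt_adapted in \<open>auto simp: adapted_def\<close>)
  then show "paid_by_second t \<in> borel_measurable (G t)" by (simp add: paid_by_second_def[abs_def])
qed

end

section \<open>Natural filtrations\<close>

lemma natural_filtration_gens:
  "{S i s -` B \<inter> space M | i s B. i \<in> I \<and> 0 \<le> s \<and> s \<le> t \<and> B \<in> sets borel} \<subseteq> Pow (space M)"
  by auto

lemma space_natural_filtration [simp]: "space (natural_filtration M I S t) = space M"
  by (simp add: natural_filtration_def space_measure_of natural_filtration_gens)

lemma information_natural_filtration: "information (natural_filtration M I S) (space M)"
proof
  fix s t :: real assume "0 \<le> s" "s \<le> t"
  then show "sets (natural_filtration M I S s) \<subseteq> sets (natural_filtration M I S t)"
    unfolding natural_filtration_def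
    by (simp add: sets_measure_of natural_filtration_gens)
       (rule sigma_sets_mono', force)
qed simp

lemma natural_filtration_adapted: "i \<in> I \<Longrightarrow> adapted (natural_filtration M I S) (S i)"
  unfolding adapted_def
proof (intro allI impI measurableI)
  fix t :: real and B :: "real set" assume i: "i \<in> I" and t: "0 \<le> t" and B: "B \<in> sets borel"
  show "S i t -` B \<inter> space (natural_filtration M I S t) \<in> sets (natural_filtration M I S t)"
    unfolding space_natural_filtration unfolding natural_filtration_def
    by (rule in_measure_of[OF natural_filtration_gens]) (use i t B in auto)
qed simp

text \<open>The surpluses of the merger and of the collaboration differ by constants only, so they carry the same
  information.\<close>

lemma natural_filtration_shift:
  fixes S S' :: "'i \<Rightarrow> real \<Rightarrow> 'w \<Rightarrow> real"
  assumes shift: "\<And>i s \<omega>. i \<in> I \<Longrightarrow> S' i s \<omega> = S i s \<omega> + c i"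
  shows "natural_filtration M I S' t = natural_filtration M I S t"
proof -
  have sub: "{S' i s -` B \<inter> space M | i s B. i \<in> I \<and> 0 \<le> s \<and> s \<le> t \<and> B \<in> sets borel} \<subseteq>
     {S i s -` B \<inter> space M | i s B. i \<in> I \<and> 0 \<le> s \<and> s \<le> t \<and> B \<in> sets borel}"
    if "\<And>i s \<omega>. i \<in> I \<Longrightarrow> S' i s \<omega> = S i s \<omega> + c i" for S S' :: "'i \<Rightarrow> real \<Rightarrow> 'w \<Rightarrow> real" and c
  proof clarify
    fix i s and B :: "real set" assume i: "i \<in> I" "0 \<le> s" "s \<le> t" and B: "B \<in> sets borel"
    have "(\<lambda>r. r + c i) -` B \<inter> space borel \<in> sets borel"
      by (rule measurable_sets[OF _ B]) simp
    moreover have "S' i s -` B \<inter> space M = S i s -` ((\<lambda>r. r + c i) -` B \<inter> space borel) \<inter> space M"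
      using that[OF i(1)] by auto
    ultimately show "\<exists>i' s' B'. S' i s -` B \<inter> space M = S i' s' -` B' \<inter> space M \<and>
       i' \<in> I \<and> 0 \<le> s' \<and> s' \<le> t \<and> B' \<in> sets borel"
      using i by blast
  qed
  have "{S' i s -` B \<inter> space M | i s B. i \<in> I \<and> 0 \<le> s \<and> s \<le> t \<and> B \<in> sets borel} =
     {S i s -` B \<inter> space M | i s B. i \<in> I \<and> 0 \<le> s \<and> s \<le> t \<and> B \<in> sets borel}"
    by (intro equalityI sub[of S' S c] sub[of S S' "\<lambda>i. - c i"]) (simp_all add: shift)
  then show ?thesis unfolding natural_filtration_def by simp
qed

section \<open>Stopping the dividends at ruin\<close>

definition stop_at :: "ereal \<Rightarrow> real \<Rightarrow> real" where
  "stop_at \<tau> t = (if ereal t \<le> \<tau> then t else real_of_ereal \<tau>)"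

lemma stop_at_range: "0 \<le> \<tau> \<Longrightarrow> 0 \<le> t \<Longrightarrow> 0 \<le> stop_at \<tau> t \<and> stop_at \<tau> t \<le> t"
  by (cases \<tau>) (auto simp: stop_at_def)

lemma stop_at_mono: "0 \<le> \<tau> \<Longrightarrow> s \<le> t \<Longrightarrow> stop_at \<tau> s \<le> stop_at \<tau> t"
  by (cases \<tau>) (auto simp: stop_at_def)

lemma stop_at_less_iff: "0 \<le> \<tau> \<Longrightarrow> a \<le> t \<Longrightarrow> stop_at \<tau> t < a \<longleftrightarrow> \<tau> < ereal a"
  by (cases \<tau>) (auto simp: stop_at_def)

lemma ruin_time_nonneg: "0 \<le> ruin_time f"
  unfolding ruin_time_def by (rule Inf_greatest) auto

lemma ruin_time_less_iff: "ruin_time f < ereal a \<longleftrightarrow> (\<exists>t\<ge>0. t < a \<and> f t < 0)"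
  unfolding ruin_time_def Inf_less_iff by auto

text \<open>In particular any dividend process satisfies the constraint of the one-dimensional problem, in which
  the ruin time already accounts for overpayment.\<close>

lemma before_ruin: "0 \<le> t \<Longrightarrow> ereal t < ruin_time f \<Longrightarrow> 0 \<le> f t"
  unfolding ruin_time_def
  by (metis (mono_tags, lifting) Inf_lower imageI leD mem_Collect_eq not_le_imp_less)

locale dividend_path =
  fixes L :: "real \<Rightarrow> real"
  assumes L_mono: "mono_on {0..} L" and L_0: "L 0 = 0"
    and L_left: "0 < t \<Longrightarrow> continuous (at_left t) L"
begin

lemma L_monoD: "0 \<le> s \<Longrightarrow> s \<le> t \<Longrightarrow> L s \<le> L t"
  using L_mono by (auto simp: mono_on_def)

text \<open>Before \<open>\<tau>\<close> nothing has changed, and after \<open>\<tau>\<close> the stopped path is constant; it is left continuous at \<open>\<tau>\<close>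
  because the path keeps its value at \<open>\<tau>\<close>, before a possible jump.\<close>

lemma stopped_left:
  assumes \<tau>: "0 \<le> \<tau>" and t: "0 < t"
  shows "continuous (at_left t) (\<lambda>s. L (stop_at \<tau> s))"
proof (cases "ereal t \<le> \<tau>")
  case True
  have "stop_at \<tau> s = s" if "s \<le> t" for s
  proof -
    have "ereal s \<le> \<tau>" using that True by (meson ereal_less_eq(3) order_trans)
    then show ?thesis by (simp add: stop_at_def)
  qed
  then have "eventually (\<lambda>s. L s = L (stop_at \<tau> s)) (at_left t)" "L t = L (stop_at \<tau> t)"
    by (auto simp: eventually_at_filter)
  then show ?thesis
    using L_left[OF t] by (simp add: continuous_within tendsto_cong)
next
  case False
  then obtain r where r: "\<tau> = ereal r" using \<tau> by (cases \<tau>) auto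
  with False have rt: "r < t" by simp
  have "eventually (\<lambda>s. L (stop_at \<tau> s) = L (stop_at \<tau> t)) (at_left t)"
    unfolding eventually_at_left_field using rt by (intro exI[of _ r]) (auto simp: stop_at_def r)
  then show ?thesis by (simp add: continuous_within tendsto_eventually)
qed

lemma dividend_path_stopped: "0 \<le> \<tau> \<Longrightarrow> dividend_path (\<lambda>t. L (stop_at \<tau> t))"
proof
  assume \<tau>: "0 \<le> \<tau>"
  show "mono_on {0..} (\<lambda>t. L (stop_at \<tau> t))"
    using stop_at_range[OF \<tau>] stop_at_mono[OF \<tau>] by (auto simp: mono_on_def intro!: L_monoD)
  have "stop_at \<tau> 0 = 0" using stop_at_range[OF \<tau>, of 0] by simp
  then show "L (stop_at \<tau> 0) = 0" using L_0 by simp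
qed (rule stopped_left)

text \<open>The dividends suppressed by stopping form a path of their own that is zero before \<open>\<tau>\<close>.\<close>

lemma discounted_dividends_stopped:
  assumes \<tau>: "0 \<le> \<tau>"
  shows "discounted_dividends \<delta> (\<lambda>t. L (stop_at \<tau> t)) \<tau> = discounted_dividends \<delta> L \<tau>"
proof -
  interpret s: dividend_path "\<lambda>t. L (stop_at \<tau> t)" by (rule dividend_path_stopped[OF \<tau>])
  let ?R = "\<lambda>t. L t - L (stop_at \<tau> t)"
  have R: "mono_on {0..} ?R"
  proof (rule mono_onI)
    fix s t :: real assume st: "s \<in> {0..}" "t \<in> {0..}" "s \<le> t"
    show "?R s \<le> ?R t"
    proof (cases "ereal t \<le> \<tau>")
      case True
      then have "ereal s \<le> \<tau>" using st by (meson ereal_less_eq(3) order_trans)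
      then show ?thesis using True by (simp add: stop_at_def)
    next
      case False
      then obtain r where r: "\<tau> = ereal r" using \<tau> by (cases \<tau>) auto
      then have r0: "0 \<le> r" using \<tau> by simp
      show ?thesis using L_monoD[of s t] L_monoD[of r t] False st r0 by (auto simp: stop_at_def r)
    qed
  qed
  have "discounted_dividends \<delta> (\<lambda>t. L (stop_at \<tau> t) + ?R t) \<tau> =
    discounted_dividends \<delta> (\<lambda>t. L (stop_at \<tau> t)) \<tau> + discounted_dividends \<delta> ?R \<tau>"
    by (rule discounted_dividends_add[OF s.L_mono _ R]) (use s.L_0 L_0 in simp_all)
  also have "discounted_dividends \<delta> ?R \<tau> = 0"
    by (rule discounted_dividends_zero[OF R]) (use s.L_0 L_0 in \<open>auto simp: stop_at_def\<close>)
  finally show ?thesis by simp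
qed

text \<open>If the stopped path caused ruin at \<open>t\<close> without a deficit at \<open>t\<close>, there would be deficits
  arbitrarily shortly after \<open>t\<close>; but no dividends are paid there any more and the surplus grows until
  the next claim.\<close>

lemma ruin_time_stopped:
  fixes Z :: "real \<Rightarrow> real"
  assumes Z: "\<And>t. 0 \<le> t \<Longrightarrow> \<exists>e>0. \<forall>s. t \<le> s \<and> s < t + e \<longrightarrow> Z t \<le> Z s"
  defines "\<tau> \<equiv> ruin_time (\<lambda>t. Z t - L t)"
  defines "\<tau>' \<equiv> ruin_time (\<lambda>t. Z t - L (stop_at \<tau> t))"
  shows "\<tau> \<le> \<tau>'" and "\<tau>' = ereal t \<Longrightarrow> Z t - L (stop_at \<tau> t) < 0"
proof -
  have \<tau>: "0 \<le> \<tau>" unfolding \<tau>_def by (rule ruin_time_nonneg)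
  show le: "\<tau> \<le> \<tau>'"
  proof (rule ccontr)
    assume "\<not> \<tau> \<le> \<tau>'"
    then have "\<tau>' < \<tau>" by (simp only: not_le)
    then obtain a where a: "\<tau>' < ereal a" "ereal a < \<tau>" using ereal_dense2 by blast
    from a(1) obtain s where s: "0 \<le> s" "s < a" "Z s - L (stop_at \<tau> s) < 0"
      unfolding \<tau>'_def ruin_time_less_iff by blast
    have st: "ereal s < \<tau>" using s(2) a(2) by (meson ereal_less(2) less_ereal.simps(1) less_trans)
    then have "0 \<le> Z s - L s" using before_ruin[of s "\<lambda>t. Z t - L t"] s(1) by (simp add: \<tau>_def)
    then show False using s(3) st by (simp add: stop_at_def less_imp_le)
  qed
  assume t: "\<tau>' = ereal t"
  then have t0: "0 \<le> t" using ruin_time_nonneg[of "\<lambda>t. Z t - L (stop_at \<tau> t)"] by (simp add: \<tau>'_def)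
  obtain r where r: "\<tau> = ereal r" "0 \<le> r" "r \<le> t" using le t \<tau> by (cases \<tau>) auto
  show "Z t - L (stop_at \<tau> t) < 0"
  proof (rule ccontr)
    assume "\<not> ?thesis"
    then have n: "L r \<le> Z t" using r by (auto simp: stop_at_def split: if_splits)
    from Z[OF t0] obtain e where e: "e > 0" "\<And>s. t \<le> s \<Longrightarrow> s < t + e \<Longrightarrow> Z t \<le> Z s" by blast
    have "\<tau>' < ereal (t + e)" using t e by simp
    then obtain s where s: "0 \<le> s" "s < t + e" "Z s - L (stop_at \<tau> s) < 0"
      unfolding \<tau>'_def ruin_time_less_iff by blast
    show False
    proof (cases "s < t")
      case True
      then have "0 \<le> Z s - L (stop_at \<tau> s)"
        using before_ruin[of s "\<lambda>t. Z t - L (stop_at \<tau> t)"] s(1) t by (simp add: \<tau>'_def)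
      then show False using s by simp
    next
      case False
      then have "stop_at \<tau> s = r" using r by (simp add: stop_at_def)
      then show False using e(2)[of s] s n False by simp
    qed
  qed
qed

end

context information
begin

text \<open>A deficit persists for a short time, because the surplus is right continuous and dividends do not
  decrease; so ruin before \<open>a\<close> shows at a rational time before \<open>a\<close>.\<close>

lemma ruin_time_before_measurable:
  assumes Z: "adapted G Z" and L: "adapted G L" and t: "a \<le> t" "0 \<le> t"
    and rc: "\<And>\<omega> s. \<omega> \<in> \<Omega> \<Longrightarrow> 0 \<le> s \<Longrightarrow> continuous (at_right s) (\<lambda>s. Z s \<omega>)"
    and mono: "\<And>\<omega>. \<omega> \<in> \<Omega> \<Longrightarrow> mono_on {0..} (\<lambda>t. L t \<omega>)"
  shows "{\<omega>\<in>\<Omega>. ruin_time (\<lambda>s. Z s \<omega> - L s \<omega>) < ereal a} \<in> sets (G t)"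
proof -
  have "{\<omega>\<in>\<Omega>. ruin_time (\<lambda>s. Z s \<omega> - L s \<omega>) < ereal a} =
    (\<Union>q\<in>{q\<in>\<rat>. 0 \<le> q \<and> q < a}. {\<omega>\<in>space (G t). Z q \<omega> < L q \<omega>})" (is "?l = ?r")
  proof (intro equalityI subsetI)
    fix \<omega> assume "\<omega> \<in> ?l"
    then obtain s where w: "\<omega> \<in> \<Omega>" and s: "0 \<le> s" "s < a" "Z s \<omega> < L s \<omega>"
      unfolding ruin_time_less_iff by auto
    have "eventually (\<lambda>q. Z q \<omega> < L s \<omega>) (at_right s)"
      using rc[OF w s(1)] s(3) by (simp add: continuous_within order_tendsto_iff)
    then obtain b where b: "s < b" "\<And>q. s < q \<Longrightarrow> q < b \<Longrightarrow> Z q \<omega> < L s \<omega>"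
      unfolding eventually_at_right_field by blast
    obtain q where q: "q \<in> \<rat>" "s < q" "q < min a b"
      using Rats_dense_in_real[of s "min a b"] s b by auto
    have "L s \<omega> \<le> L q \<omega>" using mono[OF w] s q by (auto simp: mono_on_def)
    then have "Z q \<omega> < L q \<omega>" using b(2)[of q] q by simp
    then show "\<omega> \<in> ?r" using w q s space_G[OF t(2)] by auto
  next
    fix \<omega> assume "\<omega> \<in> ?r"
    then show "\<omega> \<in> ?l" using space_G[OF t(2)] by (auto simp: ruin_time_less_iff)
  qed
  also have "\<dots> \<in> sets (G t)"
  proof (rule sets.countable_UN')
    show "countable {q \<in> \<rat>. 0 \<le> q \<and> q < a}" using countable_rat by (rule countable_subset[rotated]) auto
    show "(\<lambda>q. {\<omega>\<in>space (G t). Z q \<omega> < L q \<omega>}) ` {q \<in> \<rat>. 0 \<le> q \<and> q < a} \<subseteq> sets (G t)"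
    proof safe
      fix q assume q: "0 \<le> q" "q < a"
      then have [measurable]: "Z q \<in> borel_measurable (G t)" "L q \<in> borel_measurable (G t)"
        using adaptedD[OF Z, of q t] adaptedD[OF L, of q t] t by auto
      show "{\<omega>\<in>space (G t). Z q \<omega> < L q \<omega>} \<in> sets (G t)" by measurable
    qed
  qed
  finally show ?thesis .
qed

lemma stopped_adapted:
  assumes Z: "adapted G Z" and L: "adapted G L"
    and rc: "\<And>\<omega> s. \<omega> \<in> \<Omega> \<Longrightarrow> 0 \<le> s \<Longrightarrow> continuous (at_right s) (\<lambda>s. Z s \<omega>)"
    and path: "\<And>\<omega>. \<omega> \<in> \<Omega> \<Longrightarrow> dividend_path (\<lambda>t. L t \<omega>)"
  shows "adapted G (\<lambda>t \<omega>. L (stop_at (ruin_time (\<lambda>s. Z s \<omega> - L s \<omega>)) t) \<omega>)"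
  unfolding adapted_def
proof (intro allI impI)
  fix t :: real assume t: "0 \<le> t"
  let ?\<tau> = "\<lambda>\<omega>. ruin_time (\<lambda>s. Z s \<omega> - L s \<omega>)"
  show "(\<lambda>\<omega>. L (stop_at (?\<tau> \<omega>) t) \<omega>) \<in> borel_measurable (G t)"
  proof (rule measurable_eval_left[where t = t, OF adaptedD[OF L] t])
    show "(\<lambda>\<omega>. stop_at (?\<tau> \<omega>) t) \<in> borel_measurable (G t)"
    proof (rule borel_measurableI_less)
      fix a
      show "{\<omega> \<in> space (G t). stop_at (?\<tau> \<omega>) t < a} \<in> sets (G t)"
      proof (cases "a \<le> t")
        case True
        then have "{\<omega> \<in> space (G t). stop_at (?\<tau> \<omega>) t < a} = {\<omega>\<in>\<Omega>. ?\<tau> \<omega> < ereal a}"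
          using stop_at_less_iff[OF ruin_time_nonneg True] space_G[OF t] by simp
        also have "\<dots> \<in> sets (G t)"
          by (rule ruin_time_before_measurable[OF Z L True t rc]) (use path in \<open>auto simp: dividend_path_def\<close>)
        finally show ?thesis .
      next
        case False
        have "stop_at (?\<tau> \<omega>) t < a" for \<omega>
          using stop_at_range[OF ruin_time_nonneg t, of "\<lambda>s. Z s \<omega> - L s \<omega>"] False by linarith
        then have "{\<omega> \<in> space (G t). stop_at (?\<tau> \<omega>) t < a} = space (G t)" by auto
        then show ?thesis by simp
      qed
    qed
    show "0 \<le> stop_at (?\<tau> \<omega>) t \<and> stop_at (?\<tau> \<omega>) t \<le> t" for \<omega>
      by (rule stop_at_range[OF ruin_time_nonneg t])
    show "continuous (at_left r) (\<lambda>s. L s \<omega>)" if "\<omega> \<in> space (G t)" "0 < r" for \<omega> r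
      using path[of \<omega>] that space_G[OF t] by (simp add: dividend_path_def)
  qed
qed

end

section \<open>Collaborating with the dividends of a merger\<close>

context two_company_model
begin

definition claims :: "company \<Rightarrow> real \<Rightarrow> 'a \<Rightarrow> real" where
  "claims k t \<omega> = (\<Sum>i<N k t \<omega>. U k i \<omega>)"

lemma surplus_alt: "surplus p N U x k t \<omega> = x k + p k * t - claims k t \<omega>"
  by (simp add: surplus_def claims_def)

lemma N_path:
  assumes "\<omega> \<in> space M"
  shows "N k 0 \<omega> = 0" "mono_on {0..} (\<lambda>t. N k t \<omega>)"
    "0 \<le> s \<Longrightarrow> s \<le> t \<Longrightarrow> N k s \<omega> \<le> N k t \<omega>"
    "0 \<le> t \<Longrightarrow> continuous (at_right t) (\<lambda>s. N k s \<omega>)"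
proof -
  have "N k 0 \<omega> = 0 \<and> mono_on {0..} (\<lambda>t. N k t \<omega>) \<and> (\<forall>t\<ge>0. continuous (at_right t) (\<lambda>s. N k s \<omega>))"
    using poisson[of k] assms unfolding poisson_process_def by blast
  then show "N k 0 \<omega> = 0" "mono_on {0..} (\<lambda>t. N k t \<omega>)"
    "0 \<le> s \<Longrightarrow> s \<le> t \<Longrightarrow> N k s \<omega> \<le> N k t \<omega>"
    "0 \<le> t \<Longrightarrow> continuous (at_right t) (\<lambda>s. N k s \<omega>)"
    by (auto simp: mono_on_def)
qed

text \<open>For integers right continuity means being constant for a while.\<close>

lemma N_locally_const:
  assumes w: "\<omega> \<in> space M" and t: "0 \<le> t"
  shows "\<exists>e>0. \<forall>s. t \<le> s \<and> s < t + e \<longrightarrow> N k s \<omega> = N k t \<omega>"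
proof -
  have "eventually (\<lambda>s. N k s \<omega> = N k t \<omega>) (at_right t)"
    using N_path(4)[OF w t, of k] by (simp add: continuous_within tendsto_discrete)
  then obtain b where b: "t < b" "\<And>s. t < s \<Longrightarrow> s < b \<Longrightarrow> N k s \<omega> = N k t \<omega>"
    unfolding eventually_at_right_field by blast
  show ?thesis
  proof (intro exI[of _ "b - t"] conjI allI impI)
    fix s assume "t \<le> s \<and> s < t + (b - t)"
    then show "N k s \<omega> = N k t \<omega>" using b(2)[of s] by (cases "s = t") auto
  qed (use b in simp)
qed

lemma N_total_locally_const:
  assumes w: "\<omega> \<in> space M" and t: "0 \<le> t"
  shows "\<exists>e>0. \<forall>s. t \<le> s \<and> s < t + e \<longrightarrow> N One s \<omega> = N One t \<omega> \<and> N Two s \<omega> = N Two t \<omega>"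
proof -
  obtain d e where de: "d > 0" "e > 0" and *: "\<And>s. t \<le> s \<Longrightarrow> s < t + d \<Longrightarrow> N One s \<omega> = N One t \<omega>"
    "\<And>s. t \<le> s \<Longrightarrow> s < t + e \<Longrightarrow> N Two s \<omega> = N Two t \<omega>"
    using N_locally_const[OF assms, of One] N_locally_const[OF assms, of Two] by blast
  have "N One s \<omega> = N One t \<omega> \<and> N Two s \<omega> = N Two t \<omega>" if "t \<le> s \<and> s < t + min d e" for s
    by (intro conjI *) (use that in auto)
  then show ?thesis using de by (meson min_less_iff_conj)
qed

lemma claims_mono:
  assumes "\<omega> \<in> space M" "N k s \<omega> \<le> N k t \<omega>" shows "claims k s \<omega> \<le> claims k t \<omega>"
  unfolding claims_def by (rule sum_mono2) (use assms claim_pos in \<open>auto intro: less_imp_le\<close>)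

lemma claims_strict_mono:
  assumes "\<omega> \<in> space M" "N k s \<omega> < N k t \<omega>" shows "claims k s \<omega> < claims k t \<omega>"
  unfolding claims_def
  by (rule sum_strict_mono2[where b = "N k s \<omega>"]) (use assms claim_pos in \<open>auto intro: less_imp_le\<close>)

lemma claims_cong: "N k s \<omega> = N k t \<omega> \<Longrightarrow> claims k s \<omega> = claims k t \<omega>"
  by (simp add: claims_def)

lemma claims_nonneg: "\<omega> \<in> space M \<Longrightarrow> 0 \<le> claims k t \<omega>"
  unfolding claims_def by (rule sum_nonneg) (use claim_pos in \<open>auto intro: less_imp_le\<close>)

lemma claims_right_cont:
  assumes "\<omega> \<in> space M" "0 \<le> t" shows "continuous (at_right t) (\<lambda>s. claims k s \<omega>)"
proof -
  obtain e where e: "e > 0" and *: "\<And>s. t \<le> s \<Longrightarrow> s < t + e \<Longrightarrow> N k s \<omega> = N k t \<omega>"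
    using N_locally_const[OF assms] by blast
  have "claims k s \<omega> = claims k t \<omega>" if "t < s" "s < t + e" for s
    by (rule claims_cong, rule *) (use that in auto)
  then have "eventually (\<lambda>s. claims k s \<omega> = claims k t \<omega>) (at_right t)"
    unfolding eventually_at_right_field using e by (intro exI[of _ "t + e"]) simp
  then show ?thesis by (simp add: continuous_within tendsto_eventually)
qed

lemma surplus_right_cont:
  assumes "\<omega> \<in> space M" "0 \<le> t" shows "continuous (at_right t) (\<lambda>s. surplus p N U x k s \<omega>)"
  unfolding surplus_alt by (intro continuous_intros claims_right_cont assms)

lemma surplus_mono:
  "N k s \<omega> = N k t \<omega> \<Longrightarrow> s \<le> t \<Longrightarrow> surplus p N U x k s \<omega> \<le> surplus p N U x k t \<omega>"
  using premium_pos[of k] by (simp add: surplus_alt claims_def mult_left_mono)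

lemma claim_path_total:
  assumes w: "\<omega> \<in> space M"
  shows "claim_path (\<lambda>t. claims One t \<omega> + claims Two t \<omega>) (\<lambda>t. N One t \<omega> + N Two t \<omega>)"
proof
  fix s t :: real assume st: "0 \<le> s" "s \<le> t"
  note le = N_path(3)[OF w st]
  show "N One s \<omega> + N Two s \<omega> \<le> N One t \<omega> + N Two t \<omega>" using le by (simp add: add_mono)
  show "claims One s \<omega> + claims Two s \<omega> < claims One t \<omega> + claims Two t \<omega> \<longleftrightarrow>
     N One s \<omega> + N Two s \<omega> < N One t \<omega> + N Two t \<omega>"
  proof
    assume *: "claims One s \<omega> + claims Two s \<omega> < claims One t \<omega> + claims Two t \<omega>"
    show "N One s \<omega> + N Two s \<omega> < N One t \<omega> + N Two t \<omega>"
    proof (rule ccontr)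
      assume "\<not> ?thesis"
      then have "N One s \<omega> = N One t \<omega>" "N Two s \<omega> = N Two t \<omega>" using le[of One] le[of Two] by auto
      then show False using * by (simp add: claims_def)
    qed
  next
    assume "N One s \<omega> + N Two s \<omega> < N One t \<omega> + N Two t \<omega>"
    then consider "N One s \<omega> < N One t \<omega>" | "N Two s \<omega> < N Two t \<omega>" by linarith
    then show "claims One s \<omega> + claims Two s \<omega> < claims One t \<omega> + claims Two t \<omega>"
      using claims_mono[OF w le] claims_strict_mono[OF w]
      by cases (auto intro: add_less_le_mono add_le_less_mono)
  qed
next
  fix t :: real assume "0 \<le> t"
  from N_total_locally_const[OF w this] obtain e where
    e: "e > 0" "\<And>s. t \<le> s \<and> s < t + e \<Longrightarrow> N One s \<omega> = N One t \<omega> \<and> N Two s \<omega> = N Two t \<omega>" by blast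
  have "N One s \<omega> + N Two s \<omega> = N One t \<omega> + N Two t \<omega>" if "t \<le> s \<and> s < t + e" for s
    using e(2)[OF that] by presburger
  with e(1) show "\<exists>e>0. \<forall>s. t \<le> s \<and> s < t + e \<longrightarrow> N One s \<omega> + N Two s \<omega> = N One t \<omega> + N Two t \<omega>"
    by blast
qed

lemma split_path_model:
  assumes w: "\<omega> \<in> space M" and x: "0 \<le> x One" "0 \<le> x Two" and L: "dividend_path L"
  shows "split_path (\<lambda>t. claims One t \<omega> + claims Two t \<omega>) (\<lambda>t. N One t \<omega> + N Two t \<omega>)
    (\<lambda>t. surplus p N U x One t \<omega>) (\<lambda>t. surplus p N U x Two t \<omega>) L"
proof -
  interpret L: dividend_path L by (rule L)
  interpret claim_path "\<lambda>t. claims One t \<omega> + claims Two t \<omega>" "\<lambda>t. N One t \<omega> + N Two t \<omega>"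
    by (rule claim_path_total[OF w])
  show ?thesis
  proof
    fix s t :: real assume st: "0 \<le> s" "s \<le> t"
    { assume "N One s \<omega> + N Two s \<omega> = N One t \<omega> + N Two t \<omega>"
      then have "N One s \<omega> = N One t \<omega>" "N Two s \<omega> = N Two t \<omega>"
        using N_path(3)[OF w st, of One] N_path(3)[OF w st, of Two] by auto
      then show "surplus p N U x One s \<omega> \<le> surplus p N U x One t \<omega>"
        "surplus p N U x Two s \<omega> \<le> surplus p N U x Two t \<omega>"
        using surplus_mono st by auto }
    show "L s \<le> L t" using L.L_monoD st by simp
  next
    show "0 \<le> surplus p N U x One 0 \<omega>" "0 \<le> surplus p N U x Two 0 \<omega>"
      using x by (simp_all add: surplus_def N_path(1)[OF w])
  qed (simp_all add: L.L_0 L.L_left)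
qed

text \<open>The strategy \<open>LL\<close> is the split of \<open>L\<close> stopped at ruin.  The last conclusion is the one point where
  \<open>V\<close> gains over \<open>V\<^sub>M\<close>: if Two has had no claim by the ruin time, then its surplus at ruin is non-negative.\<close>

lemma collaboration_from_merger:
  fixes x :: "company \<Rightarrow> real"
  defines "S \<equiv> surplus p N U x"
  assumes x: "0 \<le> x One" "0 \<le> x Two"
    and L: "dividend_process M (natural_filtration M UNIV S) L"
  obtains LL where "LL \<in> collab_admissible M S N"
    and "\<And>\<omega>. \<omega> \<in> space M \<Longrightarrow> discounted_dividends \<delta> (\<lambda>s. L s \<omega>) (ruin_time (\<lambda>s. S One s \<omega> + S Two s \<omega> - L s \<omega>))
       \<le> discounted_dividends \<delta> (\<lambda>s. LL One s \<omega>) (collab_ruin S N LL \<omega>) +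
         discounted_dividends \<delta> (\<lambda>s. LL Two s \<omega>) (collab_ruin S N LL \<omega>)"
    and "\<And>\<omega>. \<omega> \<in> space M \<Longrightarrow> collab_ruin S N LL \<omega> \<le> ruin_time (\<lambda>t. S One t \<omega> + S Two t \<omega>)"
    and "\<And>\<omega> t. \<omega> \<in> space M \<Longrightarrow> collab_ruin S N LL \<omega> = ereal t \<Longrightarrow> N Two t \<omega> = 0 \<Longrightarrow>
       0 \<le> controlled S N LL Two t \<omega>"
proof -
  let ?G = "natural_filtration M UNIV S"
  let ?Z = "\<lambda>t \<omega>. S One t \<omega> + S Two t \<omega>"
  let ?\<tau> = "\<lambda>\<omega>. ruin_time (\<lambda>s. ?Z s \<omega> - L s \<omega>)"
  let ?A = "\<lambda>t \<omega>. claims One t \<omega> + claims Two t \<omega>"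
  let ?K = "\<lambda>t \<omega>. N One t \<omega> + N Two t \<omega>"
  define L' where "L' t \<omega> = L (stop_at (?\<tau> \<omega>) t) \<omega>" for t \<omega>
  interpret information ?G "space M" by (rule information_natural_filtration)
  have aS: "adapted ?G (S k)" for k by (rule natural_filtration_adapted) simp
  have aZ: "adapted ?G ?Z" 
    using aS[of One] aS[of Two] unfolding adapted_def by (intro allI impI borel_measurable_add) blast+
  have aL: "adapted ?G L" 
    by (rule adapted_if_predictable[OF _ refl]) (use L in \<open>unfold dividend_process_def, blast\<close>)
  have rc: "continuous (at_right s) (\<lambda>s. S k s \<omega>)" if "\<omega> \<in> space M" "0 \<le> s" for \<omega> s k
    unfolding S_def by (rule surplus_right_cont[OF that])
  have L_path: "dividend_path (\<lambda>t. L t \<omega>)" if "\<omega> \<in> space M" for \<omega>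
    using L that unfolding dividend_process_def dividend_path_def by blast
  have aL': "adapted ?G L'"
    unfolding L'_def
    by (rule stopped_adapted[OF aZ aL _ L_path]) (intro continuous_add rc; assumption)+
  have L'_path: "dividend_path (\<lambda>t. L' t \<omega>)" if "\<omega> \<in> space M" for \<omega>
    unfolding L'_def using dividend_path.dividend_path_stopped[OF L_path[OF that] ruin_time_nonneg] .
  have aA: "adapted ?G ?A"
    unfolding adapted_def
  proof (intro allI impI)
    fix t :: real assume t: "0 \<le> t"
    have [measurable]: "S One t \<in> borel_measurable (?G t)" "S Two t \<in> borel_measurable (?G t)"
      using aS t unfolding adapted_def by blast+
    have "?A t = (\<lambda>\<omega>. x One + p One * t - S One t \<omega> + (x Two + p Two * t - S Two t \<omega>))"
      by (simp add: S_def surplus_alt fun_eq_iff)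
    then show "?A t \<in> borel_measurable (?G t)" by simp
  qed
  interpret adapted_split ?G "space M" "S One" "S Two" L' ?A ?K
  proof (intro adapted_split.intro adapted_split_axioms.intro)
    show "information ?G (space M)" by (rule information_natural_filtration)
    show "adapted ?G (S One)" "adapted ?G (S Two)" "adapted ?G L'" "adapted ?G ?A" by fact+
    fix \<omega> assume w: "\<omega> \<in> space M"
    { fix t :: real assume t: "0 \<le> t"
      show "continuous (at_right t) (\<lambda>s. S One s \<omega>)" "continuous (at_right t) (\<lambda>s. S Two s \<omega>)"
        by (rule rc[OF w t])+
      show "continuous (at_right t) (\<lambda>s. ?A s \<omega>)"
        by (intro continuous_intros claims_right_cont w t) }
    show "split_path (\<lambda>t. ?A t \<omega>) (\<lambda>t. ?K t \<omega>) (\<lambda>t. S One t \<omega>) (\<lambda>t. S Two t \<omega>) (\<lambda>t. L' t \<omega>)"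
      unfolding S_def by (rule split_path_model[OF w x L'_path[OF w]])
  qed
  define P where "P = paid_by_second"
  define LL where "LL = case_company (\<lambda>t \<omega>. L' t \<omega> - P t \<omega>) P"
  have LL: "LL One t \<omega> = L' t \<omega> - P t \<omega>" "LL Two t \<omega> = P t \<omega>" for t \<omega> by (simp_all add: LL_def)
  have ctrl_sum: "controlled S N LL One t \<omega> + controlled S N LL Two t \<omega> = ?Z t \<omega> - L' t \<omega>" for t \<omega>
    by (simp add: controlled_def LL)
  have ruin: "collab_ruin S N LL \<omega> = ruin_time (\<lambda>t. ?Z t \<omega> - L' t \<omega>)" for \<omega>
    by (simp add: collab_ruin_def ctrl_sum)
  have aP: "adapted ?G P" unfolding P_def by (rule paid_by_second_adapted)
  have aLL: "adapted ?G (LL k)" for k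
  proof (cases k)
    case One
    show ?thesis unfolding adapted_def
    proof (intro allI impI)
      fix t :: real assume "0 \<le> t"
      then have [measurable]: "L' t \<in> borel_measurable (?G t)" "P t \<in> borel_measurable (?G t)"
        using aL' aP unfolding adapted_def by blast+
      show "LL k t \<in> borel_measurable (?G t)" by (simp add: LL_def One)
    qed
  next
    case Two
    then show ?thesis using aP by (simp add: LL_def)
  qed
  have LL_path: "dividend_path (\<lambda>t. LL k t \<omega>)" if w: "\<omega> \<in> space M" for k \<omega>
  proof -
    interpret sp: split_path "\<lambda>t. ?A t \<omega>" "\<lambda>t. ?K t \<omega>" "\<lambda>t. S One t \<omega>" "\<lambda>t. S Two t \<omega>" "\<lambda>t. L' t \<omega>"
      by (rule path[OF w])
    have PM: "P t \<omega> = sp.paid_by_Two t" for t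
      by (simp add: P_def paid_by_second_def sp.paid_by_Two_def sp.D_def Dt_def[abs_def] T_def[abs_def])
    show ?thesis
    proof (cases k)
      case One
      show ?thesis unfolding One LL PM
      proof
        show "mono_on {0..} (\<lambda>t. L' t \<omega> - sp.paid_by_Two t)"
        proof (rule mono_onI)
          fix s t :: real assume "s \<in> {0..}" "t \<in> {0..}" "s \<le> t"
          then show "L' s \<omega> - sp.paid_by_Two s \<le> L' t \<omega> - sp.paid_by_Two t" using sp.paid_by_Two_increment[of s t] by simp
        qed
        show "L' 0 \<omega> - sp.paid_by_Two 0 = 0" by (simp add: sp.paid_by_Two_0 sp.L0)
        show "continuous (at_left t) (\<lambda>t. L' t \<omega> - sp.paid_by_Two t)" if "0 < t" for t
          by (intro continuous_intros sp.L_left[OF that] sp.paid_by_Two_left)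
      qed
    next
      case Two
      show ?thesis unfolding Two LL PM
        by standard (auto simp: sp.paid_by_Two_0 intro: sp.paid_by_Two_mono sp.paid_by_Two_left mono_onI)
    qed
  qed
  \<comment> \<open>The comparison of the prescribed transfers with \<open>D\<close> is valid only before ruin and, without the last
    jump, at ruin; both cases need the same instantiation of the split at a fixed outcome.\<close>
  have transfers: "(0 \<le> t \<longrightarrow> ereal t < collab_ruin S N LL \<omega> \<longrightarrow>
        0 \<le> controlled S N LL One t \<omega> \<and> 0 \<le> controlled S N LL Two t \<omega>) \<and>
      (collab_ruin S N LL \<omega> = ereal t \<longrightarrow> ?Z t \<omega> < L' t \<omega> \<longrightarrow> N Two t \<omega> = 0 \<longrightarrow> 0 \<le> controlled S N LL Two t \<omega>)"
    if w: "\<omega> \<in> space M" for \<omega> t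
  proof -
    interpret sp: split_path "\<lambda>t. ?A t \<omega>" "\<lambda>t. ?K t \<omega>" "\<lambda>t. S One t \<omega>" "\<lambda>t. S Two t \<omega>" "\<lambda>t. L' t \<omega>"
      by (rule path[OF w])
    have PM: "P t \<omega> = sp.paid_by_Two t" for t
      by (simp add: P_def paid_by_second_def sp.paid_by_Two_def sp.D_def Dt_def[abs_def] T_def[abs_def])
    let ?C = "\<lambda>k t. received S N LL k t \<omega>"
    have C0: "?C k 0 = 0" for k by (simp add: received_def N_path(1)[OF w])
    have C_const: "?C k s = ?C k t" if "?K s \<omega> = ?K t \<omega>" for k s t
      using that by (simp add: received_def)
    have R: "(\<lambda>k. S k t \<omega> - LL k t \<omega>) = case_company (S One t \<omega> - (L' t \<omega> - sp.paid_by_Two t)) (S Two t \<omega> - sp.paid_by_Two t)" for t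
    proof
      fix k show "S k t \<omega> - LL k t \<omega> = case_company (S One t \<omega> - (L' t \<omega> - sp.paid_by_Two t)) (S Two t \<omega> - sp.paid_by_Two t) k"
        by (cases k) (simp_all add: LL PM)
    qed
    have C_jump: "(\<lambda>k. ?C k t) = transfer_step (case_company (S One t \<omega> - (L' t \<omega> - sp.paid_by_Two t)) (S Two t \<omega> - sp.paid_by_Two t)) (\<lambda>k. ?C k s)"
      if "0 \<le> s" "s < t" "\<And>r. s \<le> r \<Longrightarrow> r < t \<Longrightarrow> ?K r \<omega> = ?K s \<omega>" "?K s \<omega> < ?K t \<omega>" for s t
      unfolding R[symmetric] by (rule received_jump[where N = N and \<omega> = \<omega> and s = s and t = t, OF N_path(2)[OF w] that])
    have C_before: "?C One t - ?C Two t = sp.D t"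
      if "0 \<le> t" "\<And>s. 0 \<le> s \<Longrightarrow> s \<le> t \<Longrightarrow> L' s \<omega> \<le> ?Z s \<omega>" for t
    proof (rule sp.received_eq_D(1)[of ?C])
      show "?C k s = ?C k t" if "?K s \<omega> = ?K t \<omega>" for k s t by (rule C_const[OF that])
    qed (rule C0 C_jump that; assumption)+
    have C_at_ruin: "?C One t - ?C Two t = sp.D (sp.T n)"
      if "sp.T n < t" "t \<le> sp.T (Suc n)" "\<And>s. 0 \<le> s \<Longrightarrow> s < t \<Longrightarrow> L' s \<omega> \<le> ?Z s \<omega>" "?Z t \<omega> < L' t \<omega>" for t n
    proof (rule sp.received_eq_D(2)[of ?C])
      show "?C k s = ?C k t" if "?K s \<omega> = ?K t \<omega>" for k s t by (rule C_const[OF that])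
    qed (rule C0 C_jump that; assumption)+
    have alive: "L' s \<omega> \<le> ?Z s \<omega>" if "0 \<le> s" "ereal s < collab_ruin S N LL \<omega>" for s
      using before_ruin[of s "\<lambda>t. ?Z t \<omega> - L' t \<omega>"] that ruin by simp
    have 1: "0 \<le> controlled S N LL One t \<omega> \<and> 0 \<le> controlled S N LL Two t \<omega>"
      if t: "0 \<le> t" "ereal t < collab_ruin S N LL \<omega>"
    proof -
      have al: "L' s \<omega> \<le> ?Z s \<omega>" if "0 \<le> s" "s \<le> t" for s
        using alive[of s] t that by (meson ereal_less_eq(3) le_less_trans)
      have "?C One t - ?C Two t = sp.D t" by (rule C_before[OF t(1) al])
      then show ?thesis
        using sp.paid_by_Two_upper[OF al t(1)] sp.overdraft_le_paid_by_Two[OF t(1)] by (simp add: controlled_def LL PM sp.overdraft_def)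
    qed
    have 2: "0 \<le> controlled S N LL Two t \<omega>"
      if t: "collab_ruin S N LL \<omega> = ereal t" and neg: "?Z t \<omega> < L' t \<omega>" and NT: "N Two t \<omega> = 0"
    proof -
      have t0: "0 \<le> t" using t ruin ruin_time_nonneg[of "\<lambda>t. ?Z t \<omega> - L' t \<omega>"] by simp
      \<comment> \<open>At time 0 the joint surplus is non-negative, so there is a last restart strictly before ruin.\<close>
      have "t \<noteq> 0" using neg sp.X0 sp.Y0 sp.L0 by auto
      with t0 have "0 < t" by simp
      then obtain n where n: "sp.T n < t" "t \<le> sp.T (Suc n)" using sp.T_interval' by blast
      have al: "L' s \<omega> \<le> ?Z s \<omega>" if "0 \<le> s" "s < t" for s
        using alive[of s] t that by simp
      have "?C One t - ?C Two t = sp.D (sp.T n)" by (rule C_at_ruin[OF n al neg])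
      moreover have "sp.paid_by_Two t \<le> S Two t \<omega> - sp.D (sp.T n)"
      proof (rule sp.paid_by_Two_upper_before[OF al n])
        fix s assume s: "sp.T n \<le> s" "s < t"
        then have "0 \<le> s" using sp.T_nonneg[of n] by simp
        then have "N Two s \<omega> = N Two t \<omega>" using N_path(3)[OF w, of s t Two] s NT by simp
        then show "S Two s \<omega> \<le> S Two t \<omega>" unfolding S_def using surplus_mono s by simp
      qed
      ultimately show ?thesis by (simp add: controlled_def LL PM)
    qed
    from 1 2 show ?thesis by blast
  qed
  have Z_up: "\<exists>e>0. \<forall>s. t \<le> s \<and> s < t + e \<longrightarrow> ?Z t \<omega> \<le> ?Z s \<omega>" if w: "\<omega> \<in> space M" and t: "0 \<le> t" for t \<omega>
  proof -
    obtain e where e: "e > 0" "\<And>s. t \<le> s \<Longrightarrow> s < t + e \<Longrightarrow> N One s \<omega> = N One t \<omega> \<and> N Two s \<omega> = N Two t \<omega>"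
      using N_total_locally_const[OF w t] by blast
    have "?Z t \<omega> \<le> ?Z s \<omega>" if "t \<le> s" "s < t + e" for s
      unfolding S_def by (intro add_mono surplus_mono) (use e(2)[OF that] that in \<open>simp_all only:\<close>)
    with e(1) show ?thesis by blast
  qed
  have ruin_neg: "?Z t \<omega> - L' t \<omega> < 0" if "\<omega> \<in> space M" "collab_ruin S N LL \<omega> = ereal t" for \<omega> t
    using dividend_path.ruin_time_stopped(2)[OF L_path[OF that(1)] Z_up[OF that(1)]] that(2)
    unfolding ruin L'_def by blast
  show thesis
  proof
    show "LL \<in> collab_admissible M S N"
      unfolding collab_admissible_def
    proof (intro CollectI conjI allI ballI impI)
      show "dividend_process M ?G (LL k)" for k
        unfolding dividend_process_def
      proof (intro conjI ballI)
        show "predictable M ?G (LL k)"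
          by (rule predictable_if_left_continuous[OF aLL refl]) (use LL_path in \<open>auto simp: dividend_path_def\<close>)
        fix \<omega> assume w: "\<omega> \<in> space M"
        interpret d: dividend_path "\<lambda>t. LL k t \<omega>" by (rule LL_path[OF w])
        show "LL k 0 \<omega> = 0" "mono_on {0..} (\<lambda>t. LL k t \<omega>)" by (rule d.L_0 d.L_mono)+
        show "\<forall>t>0. continuous (at_left t) (\<lambda>s. LL k s \<omega>)" using d.L_left by blast
        show "\<forall>t\<ge>0. \<exists>l. ((\<lambda>s. LL k s \<omega>) \<longlongrightarrow> l) (at_right t)"
          using mono_right_limit[OF d.L_mono] by blast
      qed
    next
      fix \<omega> t k assume "\<omega> \<in> space M" "0 \<le> t" "ereal t < collab_ruin S N LL \<omega>"
      then show "LL k t \<omega> \<le> S k t \<omega> + received S N LL k t \<omega> - received S N LL (other k) t \<omega>"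
        using transfers[of \<omega> t] by (cases k) (auto simp: controlled_def)
    next
      fix \<omega> t assume "\<omega> \<in> space M" "collab_ruin S N LL \<omega> = ereal t"
      then show "controlled S N LL One t \<omega> + controlled S N LL Two t \<omega> < 0"
        unfolding ctrl_sum by (rule ruin_neg)
    qed
    fix \<omega> assume w: "\<omega> \<in> space M"
    have "discounted_dividends \<delta> (\<lambda>s. L s \<omega>) (?\<tau> \<omega>) = discounted_dividends \<delta> (\<lambda>s. L' s \<omega>) (?\<tau> \<omega>)"
      unfolding L'_def using dividend_path.discounted_dividends_stopped[OF L_path[OF w] ruin_time_nonneg] by simp
    also have "\<dots> \<le> discounted_dividends \<delta> (\<lambda>s. L' s \<omega>) (collab_ruin S N LL \<omega>)"
      unfolding ruin unfolding L'_def
      by (rule discounted_dividends_mono dividend_path.ruin_time_stopped(1) L_path[OF w] Z_up[OF w] | assumption)+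
    also have "(\<lambda>s. L' s \<omega>) = (\<lambda>s. LL One s \<omega> + LL Two s \<omega>)" by (simp add: LL)
    also have "discounted_dividends \<delta> (\<lambda>s. LL One s \<omega> + LL Two s \<omega>) (collab_ruin S N LL \<omega>) =
      discounted_dividends \<delta> (\<lambda>s. LL One s \<omega>) (collab_ruin S N LL \<omega>) +
      discounted_dividends \<delta> (\<lambda>s. LL Two s \<omega>) (collab_ruin S N LL \<omega>)"
      by (rule discounted_dividends_add)
         (use LL_path[OF w, of One] LL_path[OF w, of Two] in \<open>auto simp: dividend_path_def\<close>)
    finally show "discounted_dividends \<delta> (\<lambda>s. L s \<omega>) (?\<tau> \<omega>) \<le>
      discounted_dividends \<delta> (\<lambda>s. LL One s \<omega>) (collab_ruin S N LL \<omega>) +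
      discounted_dividends \<delta> (\<lambda>s. LL Two s \<omega>) (collab_ruin S N LL \<omega>)" .
    interpret d: dividend_path "\<lambda>t. L' t \<omega>" by (rule L'_path[OF w])
    have L'0: "0 \<le> L' t \<omega>" if "0 \<le> t" for t using d.L_monoD[of 0 t] d.L_0 that by simp
    show "collab_ruin S N LL \<omega> \<le> ruin_time (\<lambda>t. ?Z t \<omega>)"
      unfolding ruin unfolding ruin_time_def
      by (rule Inf_superset_mono) (use L'0 in fastforce)
    show "0 \<le> controlled S N LL Two t \<omega>" if "collab_ruin S N LL \<omega> = ereal t" "N Two t \<omega> = 0" for t
      using transfers[OF w, of t] ruin_neg[OF w that(1)] that by simp
  qed
qed

end

section \<open>What the surviving company is worth\<close>

text \<open>The payoffs are not known to be measurable as functions of the outcome; for arbitrary \<open>f\<close> the integral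
  is a supremum over simple functions below \<open>f\<close>, which still gives this inequality.\<close>

lemma nn_integral_ge_scaled_plus_indicator:
  assumes A: "A \<in> sets M"
  shows "c * (\<integral>\<^sup>+x. f x \<partial>M) + d * emeasure M A \<le> (\<integral>\<^sup>+x. c * f x + d * indicator A x \<partial>M)"
proof -
  let ?S = "{g. simple_function M g \<and> g \<le> f}"
  have ne: "?S \<noteq> {}" by (auto intro!: exI[of _ "\<lambda>_. 0"] simp: le_fun_def)
  have "c * (\<integral>\<^sup>+x. f x \<partial>M) + d * emeasure M A = (SUP g\<in>?S. c * integral\<^sup>S M g + d * emeasure M A)"
    unfolding nn_integral_def using ne by (simp add: SUP_mult_left_ennreal ennreal_SUP_add_left)
  also have "\<dots> \<le> (\<integral>\<^sup>+x. c * f x + d * indicator A x \<partial>M)"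
  proof (rule SUP_least)
    fix g assume "g \<in> ?S"
    then have g: "simple_function M g" "\<And>x. g x \<le> f x" by (auto simp: le_fun_def)
    have m[measurable]: "g \<in> borel_measurable M" by (rule borel_measurable_simple_function[OF g(1)])
    have "c * integral\<^sup>S M g + d * emeasure M A = (\<integral>\<^sup>+x. c * g x + d * indicator A x \<partial>M)"
      using A by (simp add: nn_integral_add nn_integral_cmult nn_integral_eq_simple_integral[OF g(1)])
    also have "\<dots> \<le> (\<integral>\<^sup>+x. c * f x + d * indicator A x \<partial>M)"
      by (intro nn_integral_mono add_right_mono mult_left_mono g) simp
    finally show "c * integral\<^sup>S M g + d * emeasure M A \<le> (\<integral>\<^sup>+x. c * f x + d * indicator A x \<partial>M)" .
  qed
  finally show ?thesis .
qed

lemma (in information) constant_rate_admissible: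
  assumes q: "0 \<le> q" and sp: "space M = \<Omega>"
  shows "(\<lambda>t \<omega>. q * t) \<in> single_admissible M G S"
  unfolding single_admissible_def dividend_process_def
proof (intro CollectI conjI ballI allI impI)
  show "predictable M G (\<lambda>t \<omega>. q * t)"
    by (rule predictable_if_left_continuous[OF _ sp]) (auto simp: adapted_def intro!: continuous_intros)
  fix \<omega> t
  show "q * 0 = 0" by simp
  show "mono_on {0..} (\<lambda>t. q * t)" using q by (auto intro!: mono_onI mult_left_mono)
  show "continuous (at_left t) (\<lambda>t. q * t)" by (intro continuous_intros)
  show "\<exists>l. ((\<lambda>t. q * t) \<longlongrightarrow> l) (at_right t)" by (intro exI[of _ "q * t"] tendsto_intros)
  show "q * t \<le> S t \<omega>" if "0 \<le> t" "ereal t < ruin_time (\<lambda>s. S s \<omega> - q * s)"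
    using before_ruin[OF that] by simp
qed

text \<open>Only the dividends paid in \<open>(0, 1/2]\<close> are counted, discounted by the full \<open>exp (- \<delta>)\<close>.\<close>

lemma discounted_dividends_constant_rate:
  assumes q: "0 \<le> q" and d: "0 \<le> \<delta>" and \<tau>: "1 \<le> \<tau>"
  shows "ennreal (exp (- \<delta>) * (q / 2)) \<le> discounted_dividends \<delta> (\<lambda>t. q * t) \<tau>"
proof -
  let ?L = "\<lambda>t. q * t"
  have L: "mono_on {0..} ?L" "0 \<le> ?L 0" using q by (auto intro!: mono_onI mult_left_mono)
  have rv: "right_version ?L s = q * s" if "0 \<le> s" for s
    using that unfolding right_version_def
    by (simp, intro tendsto_Lim) (auto intro!: tendsto_intros)
  have "ennreal (exp (- \<delta>) * (q / 2)) = ennreal (exp (- \<delta>)) * emeasure (dividend_measure ?L) {0<..1/2}"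
    using q by (simp add: emeasure_dividend_measure_Ioc[OF L] rv flip: ennreal_mult')
  also have "\<dots> = (\<integral>\<^sup>+s. ennreal (exp (- \<delta>)) * indicator {0<..1/2} s \<partial>dividend_measure ?L)"
    by (simp add: nn_integral_cmult_indicator)
  also have "\<dots> \<le> discounted_dividends \<delta> ?L \<tau>"
    unfolding discounted_dividends_def
  proof (rule nn_integral_mono)
    fix s :: real
    show "ennreal (exp (- \<delta>)) * indicator {0<..1/2} s \<le> ennreal (exp (- \<delta> * s)) * indicator {s. 0 \<le> s \<and> ereal s < \<tau>} s"
    proof (cases "0 < s \<and> s \<le> 1/2")
      case True
      then have "ereal s < 1" by (simp add: one_ereal_def)
      then have "ereal s < \<tau>" using \<tau> by (rule less_le_trans)
      moreover have "\<delta> * s \<le> \<delta>" using True d mult_left_mono[of s 1 \<delta>] by simp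
      ultimately show ?thesis using True by (auto intro: ennreal_leI)
    qed simp
  qed
  finally show ?thesis .
qed

context two_company_model
begin

lemma prob_N_pos: "0 < prob {\<omega>\<in>space M. N k 1 \<omega> = n}"
proof -
  have [measurable]: "N k t \<in> measurable M (count_space UNIV)" if "0 \<le> t" for t
    using poisson[of k] that unfolding poisson_process_def by blast
  have [measurable]: "N k 1 \<in> measurable M (count_space UNIV)" "N k 0 \<in> measurable M (count_space UNIV)" by simp_all
  have d: "distr M (count_space UNIV) (\<lambda>\<omega>. N k 1 \<omega> - N k 0 \<omega>) = measure_pmf (poisson_pmf (lam k * (1 - 0)))"
  proof -
    have "\<forall>s t. 0 \<le> s \<and> s < t \<longrightarrow>
        distr M (count_space UNIV) (\<lambda>\<omega>. N k t \<omega> - N k s \<omega>) = measure_pmf (poisson_pmf (lam k * (t - s)))"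
      using poisson[of k] unfolding poisson_process_def by blast
    then show ?thesis by (metis order_refl zero_less_one)
  qed
  have "{\<omega>\<in>space M. N k 1 \<omega> = n} = (\<lambda>\<omega>. N k 1 \<omega> - N k 0 \<omega>) -` {n} \<inter> space M"
    using N_path(1) by auto
  then have "prob {\<omega>\<in>space M. N k 1 \<omega> = n} = measure (distr M (count_space UNIV) (\<lambda>\<omega>. N k 1 \<omega> - N k 0 \<omega>)) {n}"
    by (simp add: measure_distr)
  also have "\<dots> = pmf (poisson_pmf (lam k)) n" unfolding d by (simp add: pmf.rep_eq)
  also have "\<dots> > 0" using intensity_pos[of k] by (simp add: less_imp_le)
  finally show ?thesis .
qed

text \<open>Pay out exactly the premiums.  With probability \<open>exp (- lam k)\<close> there is no claim in the first unit of
  time, and then ruin does not occur in it, whatever \<open>z \<ge> 0\<close> is.\<close>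

lemma standalone_value_bounded_below:
  assumes d: "0 \<le> \<delta>"
  shows "\<exists>c>0. \<forall>z\<ge>0. ennreal c \<le> standalone_value M p N U \<delta> k z"
proof (intro exI conjI allI impI)
  let ?E = "{\<omega>\<in>space M. N k 1 \<omega> = 0}"
  let ?c = "exp (- \<delta>) * (p k / 2)"
  have pk: "0 < p k" by (rule premium_pos)
  show "0 < ?c * prob ?E" using prob_N_pos[of k 0] pk by simp
  have E: "?E \<in> sets M"
  proof (rule ccontr)
    assume "?E \<notin> sets M"
    then have "prob ?E = 0" by (rule measure_notin_sets)
    then show False using prob_N_pos[of k 0] by simp
  qed
  fix z :: real assume z: "0 \<le> z"
  let ?S = "surplus p N U (\<lambda>_. z)"
  let ?L = "\<lambda>t (\<omega>::'a). p k * t"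
  have "ennreal (?c * prob ?E) = ennreal ?c * emeasure M ?E"
    using pk by (simp add: emeasure_eq_measure flip: ennreal_mult')
  also have "\<dots> = (\<integral>\<^sup>+\<omega>. ennreal ?c * indicator ?E \<omega> \<partial>M)"
    using E by (simp add: nn_integral_cmult_indicator)
  also have "\<dots> \<le> (\<integral>\<^sup>+\<omega>. discounted_dividends \<delta> (\<lambda>t. p k * t) (ruin_time (\<lambda>s. ?S k s \<omega> - p k * s)) \<partial>M)"
  proof (rule nn_integral_mono)
    fix \<omega> assume w: "\<omega> \<in> space M"
    show "ennreal ?c * indicator ?E \<omega> \<le> discounted_dividends \<delta> (\<lambda>t. p k * t) (ruin_time (\<lambda>s. ?S k s \<omega> - p k * s))"
    proof (cases "N k 1 \<omega> = 0")
      case True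
      have "\<not> ruin_time (\<lambda>s. ?S k s \<omega> - p k * s) < ereal 1"
      proof
        assume "ruin_time (\<lambda>s. ?S k s \<omega> - p k * s) < ereal 1"
        then obtain s where s: "0 \<le> s" "s < 1" "?S k s \<omega> - p k * s < 0"
          unfolding ruin_time_less_iff by blast
        have "N k s \<omega> = 0" using N_path(3)[OF w, of s 1 k] s True by simp
        then show False using s z by (simp add: surplus_def)
      qed
      then have "1 \<le> ruin_time (\<lambda>s. ?S k s \<omega> - p k * s)" by (simp add: one_ereal_def not_less)
      then show ?thesis using discounted_dividends_constant_rate[of "p k" \<delta>] pk d w by (simp add: True)
    qed simp
  qed
  also have "\<dots> \<le> single_value M \<delta> (natural_filtration M {k} ?S) (?S k)"
    unfolding single_value_def
    by (rule SUP_upper2[OF information.constant_rate_admissible[where q = "p k", OF information_natural_filtration]])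
       (use pk in simp_all)
  also have "\<dots> = standalone_value M p N U \<delta> k z" using z by (simp add: standalone_value_def Let_def)
  finally show "ennreal (?c * prob ?E) \<le> standalone_value M p N U \<delta> k z" .
qed

text \<open>The distribution function vanishes at 0 and is continuous, hence below 1 at some \<open>\<epsilon> > 0\<close>; it is common
  to all claims of a company, and so is \<open>\<epsilon>\<close>.\<close>

lemma claim_exceeds:
  "\<exists>\<epsilon>>0. \<forall>i. 0 < prob (U k i -` {\<epsilon><..} \<inter> space M)"
proof -
  have [measurable]: "U k i \<in> borel_measurable M" for i by (rule claim_measurable)
  have F: "F k r = prob (U k i -` {..r} \<inter> space M)" for r i
    unfolding claim_cdf[of k i, symmetric] by (simp add: cdf_def measure_distr)
  have "U k 0 -` {..0} \<inter> space M = {}" using claim_pos[of _ k 0] by (fastforce simp: not_le)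
  then have F0: "F k 0 = 0" using F[of 0 0] by simp
  have "isCont (F k) 0" using cdf_continuous[of k] by (simp add: continuous_on_eq_continuous_at)
  then have "((F k) \<longlongrightarrow> 0) (at_right 0)"
    using F0 by (metis filterlim_at_split isCont_def)
  then have "eventually (\<lambda>r. F k r < 1) (at_right 0)" by (rule order_tendstoD) simp
  then obtain b where b: "0 < b" "\<And>r. 0 < r \<Longrightarrow> r < b \<Longrightarrow> F k r < 1"
    unfolding eventually_at_right_field by blast
  show ?thesis
  proof (intro exI[of _ "b / 2"] conjI allI)
    fix i
    have "U k i -` {b/2<..} \<inter> space M = space M - (U k i -` {..b/2} \<inter> space M)" by auto
    then have "prob (U k i -` {b/2<..} \<inter> space M) = 1 - F k (b/2)"
      using prob_compl[of "U k i -` {..b/2} \<inter> space M"] F[of "b/2" i] by simp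
    then show "0 < prob (U k i -` {b/2<..} \<inter> space M)" using b(2)[of "b/2"] b(1) by simp
  qed (use b in simp)
qed

text \<open>One has exactly \<open>n\<close> claims, each above \<open>\<epsilon>\<close>, with \<open>n\<close> so large that \<open>n * \<epsilon> > r\<close>, while Two has none.
  These finitely many conditions are independent and each has positive probability.\<close>

lemma ruin_by_One_event:
  "\<exists>E\<in>sets M. 0 < prob E \<and> (\<forall>\<omega>\<in>E. \<omega> \<in> space M \<and> N Two 1 \<omega> = 0 \<and> r < claims One 1 \<omega>)"
proof -
  obtain \<epsilon> where \<epsilon>: "\<epsilon> > 0" "\<And>i. 0 < prob (U One i -` {\<epsilon><..} \<inter> space M)"
    using claim_exceeds[of One] by blast
  obtain n :: nat where n: "r < real n * \<epsilon>" using ex_less_of_nat_mult[OF \<epsilon>(1)] by blast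
  define B where "B j = (case j of Arrivals k \<Rightarrow> N k 1 -` {if k = One then n else 0} \<inter> space M
      | Claim k i \<Rightarrow> U k i -` {\<epsilon><..} \<inter> space M)" for j
  let ?J = "{Arrivals One, Arrivals Two} \<union> Claim One ` {..<n}"
  define E where "E = (\<Inter>j\<in>?J. B j)"
  have BJ: "0 < prob (B j)" if "j \<in> ?J" for j
  proof -
    have *: "N k 1 -` {m} \<inter> space M = {\<omega>\<in>space M. N k 1 \<omega> = m}" for k m by auto
    show ?thesis using that \<epsilon>(2) prob_N_pos by (auto simp: B_def *)
  qed
  have "prob E = (\<Prod>j\<in>?J. prob (B j))"
    unfolding E_def
  proof (rule indep_setsD[OF independent])
    show "\<forall>j\<in>?J. B j \<in> (case j of Arrivals k \<Rightarrow> sigma_sets (space M) {N k t -` A \<inter> space M |t A. 0 \<le> t}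
              | Claim k i \<Rightarrow> {U k i -` B \<inter> space M |B. B \<in> sets borel})"
    proof
      fix j assume "j \<in> ?J"
      show "B j \<in> (case j of Arrivals k \<Rightarrow> sigma_sets (space M) {N k t -` A \<inter> space M |t A. 0 \<le> t}
              | Claim k i \<Rightarrow> {U k i -` B \<inter> space M |B. B \<in> sets borel})"
      proof (cases j)
        case (Arrivals k)
        have "B j \<in> {N k t -` A \<inter> space M |t A. 0 \<le> t}"
          unfolding Arrivals B_def by (intro CollectI exI[of _ 1] exI[of _ "{if k = One then n else 0}"]) simp
        then show ?thesis unfolding Arrivals by (simp add: sigma_sets.Basic)
      next
        case (Claim k i)
        then show ?thesis by (auto simp: B_def intro!: exI[of _ "{\<epsilon><..}"])
      qed
    qed
  qed auto
  also have "\<dots> > 0" using BJ by (intro prod_pos) blast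
  finally have pos: "0 < prob E" .
  have EM: "E \<in> sets M" using pos measure_notin_sets[of E M] by force
  have "\<omega> \<in> space M \<and> N Two 1 \<omega> = 0 \<and> r < claims One 1 \<omega>" if "\<omega> \<in> E" for \<omega>
  proof -
    have B: "\<omega> \<in> B j" if "j \<in> ?J" for j using that \<open>\<omega> \<in> E\<close> by (auto simp: E_def)
    have N: "N One 1 \<omega> = n" "N Two 1 \<omega> = 0" "\<omega> \<in> space M"
      using B[of "Arrivals One"] B[of "Arrivals Two"] by (auto simp: B_def)
    have U: "\<epsilon> \<le> U One i \<omega>" if "i < n" for i
      using B[of "Claim One i"] that by (auto simp: B_def)
    have "real n * \<epsilon> \<le> (\<Sum>i<n. U One i \<omega>)"
      using sum_mono[of "{..<n}" "\<lambda>_. \<epsilon>" "\<lambda>i. U One i \<omega>"] U by simp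
    then show ?thesis using N n by (simp add: claims_def)
  qed
  then show ?thesis using EM pos by blast
qed

end

section \<open>Comparison of the values\<close>

lemma ennreal_half_mult: "ennreal (1 / 2) * x = x / 2"
proof -
  have "ennreal (1 / 2) = 1 / 2"
    by (metis divide_ennreal ennreal_1 ennreal_numeral zero_le_one zero_less_numeral)
  then show ?thesis by (simp add: divide_ennreal_def mult.commute)
qed

context two_company_model
begin

text \<open>The merger can thus be regarded as acting on the surpluses and on the information of the collaboration.\<close>

lemma merger_value_eq:
  "merger_value M p N U \<delta> (x + y) =
   single_value M \<delta> (natural_filtration M UNIV (surplus p N U (case_company x y)))
     (\<lambda>t \<omega>. surplus p N U (case_company x y) One t \<omega> + surplus p N U (case_company x y) Two t \<omega>)"
proof -
  let ?S' = "surplus p N U (case_company (x + y) 0)" and ?S = "surplus p N U (case_company x y)"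
  have "?S' i s \<omega> = ?S i s \<omega> + case_company y (- y) i" for i s \<omega>
    by (cases i) (simp_all add: surplus_def)
  then have G: "natural_filtration M UNIV ?S' = natural_filtration M UNIV ?S"
    by (intro ext natural_filtration_shift)
  have Z: "(\<lambda>t \<omega>. ?S' One t \<omega> + ?S' Two t \<omega>) = (\<lambda>t \<omega>. ?S One t \<omega> + ?S Two t \<omega>)"
    by (simp add: surplus_def fun_eq_iff)
  show ?thesis unfolding merger_value_def Let_def G Z ..
qed

lemma merger_value_finite:
  assumes d: "0 < \<delta>" and xy: "0 \<le> x" "0 \<le> y"
  shows "merger_value M p N U \<delta> (x + y) < \<infinity>"
proof -
  let ?S = "surplus p N U (case_company x y)"
  let ?Z = "\<lambda>t \<omega>. ?S One t \<omega> + ?S Two t \<omega>"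
  let ?G = "natural_filtration M UNIV ?S"
  let ?q = "p One + p Two"
  define B where "B = (\<Sum>n. ennreal (exp (- \<delta> * real n) * (x + y + ?q * (real n + 1))))"
  have q: "0 \<le> ?q" using premium_pos[of One] premium_pos[of Two] by simp
  have "single_value M \<delta> ?G ?Z \<le> B"
    unfolding single_value_def
  proof (rule SUP_least)
    fix L assume "L \<in> single_admissible M ?G ?Z"
    then have L: "\<And>\<omega>. \<omega> \<in> space M \<Longrightarrow> mono_on {0..} (\<lambda>t. L t \<omega>) \<and> L 0 \<omega> = 0"
      unfolding single_admissible_def dividend_process_def by blast
    have "(\<integral>\<^sup>+\<omega>. discounted_dividends \<delta> (\<lambda>s. L s \<omega>) (ruin_time (\<lambda>s. ?Z s \<omega> - L s \<omega>)) \<partial>M) \<le> (\<integral>\<^sup>+\<omega>. B \<partial>M)"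
    proof (rule nn_integral_mono)
      fix \<omega> assume w: "\<omega> \<in> space M"
      show "discounted_dividends \<delta> (\<lambda>s. L s \<omega>) (ruin_time (\<lambda>s. ?Z s \<omega> - L s \<omega>)) \<le> B"
        unfolding B_def
      proof (rule discounted_dividends_le_exp)
        fix t assume t: "0 \<le> t" "ereal t < ruin_time (\<lambda>s. ?Z s \<omega> - L s \<omega>)"
        have "L t \<omega> \<le> ?Z t \<omega>" using before_ruin[OF t] by simp
        also have "\<dots> \<le> x + y + ?q * t"
          using claims_nonneg[OF w, of One t] claims_nonneg[OF w, of Two t]
          by (simp add: surplus_alt algebra_simps)
        finally show "L t \<omega> \<le> x + y + ?q * t" .
      qed (use L[OF w] d xy q in auto)
    qed
    also have "\<dots> = B" by (simp add: emeasure_space_1)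
    finally show "(\<integral>\<^sup>+\<omega>. discounted_dividends \<delta> (\<lambda>s. L s \<omega>) (ruin_time (\<lambda>s. ?Z s \<omega> - L s \<omega>)) \<partial>M) \<le> B" .
  qed
  also have "B < \<infinity>" unfolding B_def by (rule exp_series_finite) (use d xy q in auto)
  finally show ?thesis unfolding merger_value_eq .
qed

text \<open>The gap is half of \<open>exp (- \<delta>) * c\<close>, a lower bound for the discounted value of Two at ruin on the event
  \<open>E\<close>, times the probability of \<open>E\<close>; neither factor depends on the merger strategy, so the
  supremum over these strategies keeps the gap.\<close>

lemma collab_value_gap:
  assumes d: "0 < \<delta>" and a: "a One = 1 / 2" "a Two = 1 / 2" and xy: "0 \<le> x" "0 \<le> y"
  shows "\<exists>g>0. merger_value M p N U \<delta> (x + y) / 2 + ennreal g \<le> collab_value M p N U \<delta> a x y"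
proof -
  let ?S = "surplus p N U (case_company x y)"
  let ?Z = "\<lambda>t \<omega>. ?S One t \<omega> + ?S Two t \<omega>"
  let ?G = "natural_filtration M UNIV ?S"
  obtain c where c: "c > 0" "\<And>z. 0 \<le> z \<Longrightarrow> ennreal c \<le> standalone_value M p N U \<delta> Two z"
    using standalone_value_bounded_below[of \<delta> Two] d by auto
  obtain E where E: "E \<in> sets M" "0 < prob E"
    "\<And>\<omega>. \<omega> \<in> E \<Longrightarrow> \<omega> \<in> space M \<and> N Two 1 \<omega> = 0 \<and> x + y + p One + p Two < claims One 1 \<omega>"
    using ruin_by_One_event[of "x + y + p One + p Two"] by blast
  define g where "g = exp (- \<delta>) * c / 2"
  have g: "0 < g" using c by (simp add: g_def)
  have gE: "ennreal (g * prob E) = ennreal g * emeasure M E"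
    using g by (simp add: emeasure_eq_measure ennreal_mult')
  have each: "ennreal (1 / 2) * (\<integral>\<^sup>+\<omega>. discounted_dividends \<delta> (\<lambda>s. L s \<omega>) (ruin_time (\<lambda>s. ?Z s \<omega> - L s \<omega>)) \<partial>M)
      + ennreal (g * prob E) \<le> collab_value M p N U \<delta> a x y"
    if L: "L \<in> single_admissible M ?G ?Z" for L
  proof -
    have Ld: "dividend_process M ?G L" using L by (simp add: single_admissible_def)
    have x0: "0 \<le> case_company x y One" "0 \<le> case_company x y Two" using xy by simp_all
    from collaboration_from_merger[OF x0 Ld, of \<delta>]
    obtain LL where LL: "LL \<in> collab_admissible M ?S N"
      and pay: "\<And>\<omega>. \<omega> \<in> space M \<Longrightarrow>
        discounted_dividends \<delta> (\<lambda>s. L s \<omega>) (ruin_time (\<lambda>s. ?Z s \<omega> - L s \<omega>))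
       \<le> discounted_dividends \<delta> (\<lambda>s. LL One s \<omega>) (collab_ruin ?S N LL \<omega>) +
         discounted_dividends \<delta> (\<lambda>s. LL Two s \<omega>) (collab_ruin ?S N LL \<omega>)"
      and ruin: "\<And>\<omega>. \<omega> \<in> space M \<Longrightarrow> collab_ruin ?S N LL \<omega> \<le> ruin_time (\<lambda>t. ?Z t \<omega>)"
      and surv: "\<And>\<omega> t. \<omega> \<in> space M \<Longrightarrow> collab_ruin ?S N LL \<omega> = ereal t \<Longrightarrow> N Two t \<omega> = 0 \<Longrightarrow>
        0 \<le> controlled ?S N LL Two t \<omega>"
      by blast
    let ?term = "\<lambda>k \<omega>. discounted_terminal \<delta> (collab_ruin ?S N LL \<omega>)
            (\<lambda>t. standalone_value M p N U \<delta> k (controlled ?S N LL k t \<omega>))"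
    have survivor: "ennreal (exp (- \<delta>) * c) \<le> ?term Two \<omega>" if "\<omega> \<in> E" for \<omega>
    proof -
      note e = E(3)[OF that]
      have "?Z 1 \<omega> < 0"
        using e claims_nonneg[of \<omega> Two 1] by (simp add: surplus_alt)
      then have "ruin_time (\<lambda>t. ?Z t \<omega>) \<le> ereal 1"
        unfolding ruin_time_def by (intro Inf_lower) simp
      then have le: "collab_ruin ?S N LL \<omega> \<le> ereal 1" using ruin[of \<omega>] e by (meson order_trans)
      have "0 \<le> collab_ruin ?S N LL \<omega>" unfolding collab_ruin_def by (rule ruin_time_nonneg)
      with le obtain t where t: "collab_ruin ?S N LL \<omega> = ereal t" "0 \<le> t" "t \<le> 1"
        by (cases "collab_ruin ?S N LL \<omega>") auto
      have "N Two t \<omega> = 0" using N_path(3)[of \<omega> t 1 Two] e t by simp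
      then have "0 \<le> controlled ?S N LL Two t \<omega>" using surv t e by blast
      then have w: "ennreal c \<le> standalone_value M p N U \<delta> Two (controlled ?S N LL Two t \<omega>)" by (rule c(2))
      have "\<delta> * t \<le> \<delta>" using t d mult_left_mono[of t 1 \<delta>] by simp
      then have "ennreal (exp (- \<delta>)) \<le> ennreal (exp (- \<delta> * t))" by (simp add: ennreal_leI)
      then have "ennreal (exp (- \<delta>)) * ennreal c \<le> ?term Two \<omega>"
        unfolding discounted_terminal_def t(1) using w by (simp add: mult_mono)
      then show ?thesis using c(1) by (simp add: ennreal_mult)
    qed
    have "ennreal (1 / 2) * (\<integral>\<^sup>+\<omega>. discounted_dividends \<delta> (\<lambda>s. L s \<omega>) (ruin_time (\<lambda>s. ?Z s \<omega> - L s \<omega>)) \<partial>M)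
      + ennreal g * emeasure M E
      \<le> (\<integral>\<^sup>+\<omega>. ennreal (1 / 2) * discounted_dividends \<delta> (\<lambda>s. L s \<omega>) (ruin_time (\<lambda>s. ?Z s \<omega> - L s \<omega>))
            + ennreal g * indicator E \<omega> \<partial>M)"
      by (rule nn_integral_ge_scaled_plus_indicator[OF E(1)])
    also have "\<dots> \<le> collab_payoff M p N U \<delta> a ?S LL"
      unfolding collab_payoff_def
    proof (rule nn_integral_mono)
      fix \<omega> assume w: "\<omega> \<in> space M"
      have g_le: "ennreal g * indicator E \<omega> \<le> ennreal (1 / 2) * ?term Two \<omega>"
      proof (cases "\<omega> \<in> E")
        case True
        have "g = 1 / 2 * (exp (- \<delta>) * c)" by (simp add: g_def)
        then have "ennreal g = ennreal (1 / 2) * ennreal (exp (- \<delta>) * c)"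
          by (simp only: ennreal_mult' zero_le_divide_1_iff zero_le_numeral)
        then show ?thesis using survivor[OF True] True by (simp add: mult_left_mono)
      qed simp
      let ?D = "\<lambda>k. discounted_dividends \<delta> (\<lambda>s. LL k s \<omega>) (collab_ruin ?S N LL \<omega>)"
      have "ennreal (1 / 2) * discounted_dividends \<delta> (\<lambda>s. L s \<omega>) (ruin_time (\<lambda>s. ?Z s \<omega> - L s \<omega>))
            + ennreal g * indicator E \<omega>
        \<le> ennreal (1 / 2) * (?D One + ?D Two) + ennreal (1 / 2) * ?term Two \<omega>"
        by (intro add_mono mult_left_mono pay[OF w] g_le) simp
      also have "\<dots> \<le> ennreal (1 / 2) * (?D One + ?term One \<omega>) + ennreal (1 / 2) * (?D Two + ?term Two \<omega>)"
        unfolding distrib_left[symmetric] by (intro mult_left_mono) (simp_all add: ac_simps add_increasing)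
      also have "\<dots> = (\<Sum>k\<in>{One, Two}. ennreal (a k) * (?D k + ?term k \<omega>))"
        by (simp add: a)
      finally show "ennreal (1 / 2) * discounted_dividends \<delta> (\<lambda>s. L s \<omega>) (ruin_time (\<lambda>s. ?Z s \<omega> - L s \<omega>))
            + ennreal g * indicator E \<omega> \<le> (\<Sum>k\<in>{One, Two}. ennreal (a k) * (?D k + ?term k \<omega>))" .
    qed
    also have "\<dots> \<le> collab_value M p N U \<delta> a x y"
      unfolding collab_value_def Let_def by (rule SUP_upper[OF LL])
    finally show ?thesis unfolding gE .
  qed
  have ne: "single_admissible M ?G ?Z \<noteq> {}"
    using information.constant_rate_admissible[OF information_natural_filtration, of 0 M M UNIV ?S ?Z] by auto
  have "merger_value M p N U \<delta> (x + y) / 2 + ennreal (g * prob E) =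
    (SUP L\<in>single_admissible M ?G ?Z. ennreal (1 / 2) *
      (\<integral>\<^sup>+\<omega>. discounted_dividends \<delta> (\<lambda>s. L s \<omega>) (ruin_time (\<lambda>s. ?Z s \<omega> - L s \<omega>)) \<partial>M) + ennreal (g * prob E))"
    unfolding merger_value_eq single_value_def ennreal_half_mult[symmetric]
    by (simp only: SUP_mult_left_ennreal ennreal_SUP_add_left[OF ne])
  also have "\<dots> \<le> collab_value M p N U \<delta> a x y" by (rule SUP_least) (rule each)
  finally show ?thesis using g E(2) by (intro exI[of _ "g * prob E"]) simp
qed

end

theorem mainTheorem1:
  fixes M :: "'a measure"
    and lam p :: "company \<Rightarrow> real"
    and N :: "company \<Rightarrow> real \<Rightarrow> 'a \<Rightarrow> nat"
    and U :: "company \<Rightarrow> nat \<Rightarrow> 'a \<Rightarrow> real"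
    and F :: "company \<Rightarrow> real \<Rightarrow> real"
    and \<delta> x y :: real
    and a :: "company \<Rightarrow> real"
  assumes "two_company_model M lam p N U F"
    and "\<delta> > 0"
    and "a One = 1 / 2" and "a Two = 1 / 2"
    and "x \<ge> 0" and "y \<ge> 0"
  shows "collab_value M p N U \<delta> a x y > merger_value M p N U \<delta> (x + y) / 2"
proof -
  interpret two_company_model M lam p N U F by fact
  let ?v = "merger_value M p N U \<delta> (x + y) / 2"
  obtain g where g: "g > 0" "?v + ennreal g \<le> collab_value M p N U \<delta> a x y"
    using collab_value_gap[OF assms(2-6)] by blast
  have "?v < \<infinity>"
    using merger_value_finite[OF assms(2,5,6)] by (simp add: ennreal_divide_eq_top_iff less_top[symmetric])
  then have "?v < ?v + ennreal g"
    using g(1) by (metis add.right_neutral ennreal_add_left_cancel_less ennreal_less_zero_iff infinity_ennreal_def less_top)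
  with g(2) show ?thesis by (rule order.strict_trans2[rotated])
qed

end
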